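(* The crossing number of $K_{5,5}$ in the orientable surface $S_2$ of genus 2 is $\mathrm{cr}_2(K_{5,5}) = 2$.
   Context: $S_g$ denotes the closed orientable surface of genus $g$, and $\mathrm{cr}_g(G)$ is the minimum number of crossings over all drawings of the graph $G$ in $S_g$. A drawing is a locally injective map of the graph into the surface with vertices mapped to distinct points, no vertex in the interior of an edge, and finitely many crossings, i.e., identifications of interior points of two edges. $K_{5,5}$ is the complete bipartite graph with both parts of size 5. *)

theory Defs
  imports "HOL-Analysis.Analysis"
begin

type_synonym pt = "real \<times> real \<times> real"

text \<open>A concrete model of the closed orientable surface of genus 2: the boundary of a
  thickened figure-eight curve y^2 = x^2 - x^4 in R^3, namely f(x,y)^2 + z^2 = (1/10)^2 with
  f(x,y) = y^2 - x^2 + x^4.  (Critical values of f are 0 and -1/4, so the region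
  |f| <= 1/10 is a disk with two holes and the surface is its double, genus 2.)\<close>
definition S2 :: "pt set" where
  "S2 = {(x, y, z). (y^2 - x^2 + x^4)^2 + z^2 = 1/100}"

definition K55_edges :: "(nat \<times> nat) set" where
  "K55_edges = {..<5} \<times> {..<5}"

definition crossings :: "(nat \<times> nat \<Rightarrow> real \<Rightarrow> pt) \<Rightarrow> ((nat \<times> nat) \<times> real) set set" where
  "crossings \<gamma> = {{(e, s), (f, t)} | e s f t.
      e \<in> K55_edges \<and> f \<in> K55_edges \<and> s \<in> {0<..<1} \<and> t \<in> {0<..<1} \<and>
      (e, s) \<noteq> (f, t) \<and> \<gamma> e s = \<gamma> f t}"

definition drawing_K55 :: "pt set \<Rightarrow> (nat \<Rightarrow> pt) \<Rightarrow> (nat \<Rightarrow> pt) \<Rightarrow> (nat \<times> nat \<Rightarrow> real \<Rightarrow> pt) \<Rightarrow> bool" where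
  "drawing_K55 S p q \<gamma> \<longleftrightarrow>
     p ` {..<5} \<subseteq> S \<and> q ` {..<5} \<subseteq> S \<and>
     inj_on p {..<5} \<and> inj_on q {..<5} \<and> p ` {..<5} \<inter> q ` {..<5} = {} \<and>
     (\<forall>e \<in> K55_edges.
        continuous_on {0..1} (\<gamma> e) \<and> \<gamma> e ` {0..1} \<subseteq> S \<and>
        \<gamma> e 0 = p (fst e) \<and> \<gamma> e 1 = q (snd e) \<and>
        (\<forall>t \<in> {0..1}. \<exists>\<epsilon>>0. inj_on (\<gamma> e) ({0..1} \<inter> ball t \<epsilon>)) \<and>
        (\<forall>t \<in> {0<..<1}. \<gamma> e t \<notin> p ` {..<5} \<union> q ` {..<5})) \<and>
     finite (crossings \<gamma>)"

definition cr_K55 :: "pt set \<Rightarrow> nat" where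
  "cr_K55 S = (LEAST n. \<exists>p q \<gamma>. drawing_K55 S p q \<gamma> \<and> card (crossings \<gamma>) = n)"

end

theory Submission
  imports Defs "HOL-Library.Z2"
begin

text \<open>
  \<^bold>\<open>Lower bound.\<close> The planes \<open>y = 0\<close> and \<open>z = 0\<close> cut the surface into four hexagons, and each of
  them is embedded in the plane by \<open>(x, y, z) \<mapsto> x + i F\<close> with \<open>F = y\<^sup>2 - x\<^sup>2 + x\<^sup>4\<close>. Two disjoint paths
  \<open>g\<close>, \<open>h\<close> in one hexagon satisfy a parity relation, because \<open>g s - h t\<close> has a continuous logarithm on
  the parameter square. Seen from a boundary point of a hexagon, directions have a global branch of the
  argument, so, after cutting the edges of a drawing at the two planes, an interior cut point contributes only
  through the side that it lies on. Thus each edge \<open>e\<close> gets a class \<open>h(e) \<in> F\<^sub>2\<^sup>4\<close>, and two independent edges that do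
  not cross satisfy \<open>\<omega>(h e, h f) = \<close> terms depending on one edge and one end of the other or on two ends, where
  \<open>\<omega>\<close> is the symplectic form.

  If at most one pair of independent edges crosses, then summing over the edge pairs of the subgraphs \<open>K\<^sub>3\<^sub>,\<^sub>3\<close>
  and of pairs of 4-cycles with no common vertex removes these terms: the classes \<open>m\<^sub>i\<^sub>j\<close> of the 4-cycles
  \<open>a\<^sub>0b\<^sub>0a\<^sub>ib\<^sub>j\<close> satisfy \<open>\<omega>(m\<^sub>i\<^sub>j, m\<^sub>k\<^sub>l) = P\<^sub>i\<^sub>k + T\<^sub>j\<^sub>l\<close> with tournaments \<open>P\<close> and \<open>T\<close>, except possibly for one
  pair of cells. A finite search, made small by normalising two of the \<open>m\<^sub>i\<^sub>j\<close> to a hyperbolic pair, shows that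
  \<open>F\<^sub>2\<^sup>4\<close> has no such vectors.

  \<^bold>\<open>Upper bound.\<close> Six vertices are the corners of the hexagons, namely the points of the surface with
  \<open>y = z = 0\<close>, alternately from the two parts; the other four are centres of the hexagons. Spokes join the
  centres to the corners, sides join neighbouring corners and neighbouring centres, and the three diagonals
  between opposite corners cause two crossings.
\<close>

section \<open>Crossing parity in a hexagon\<close>

text \<open>Euler's formula allows a bipartite graph with 10 vertices on a surface of genus 2 at
  most 24 edges, so for the 25 edges of K_{5,5} it yields one crossing only. The difficulty is to
  exclude drawings with exactly one crossing, and for this the relations are kept modulo 2 and for
  all pairs of independent edges but one. The vector of a 4-cycle plays the role of its homology
  class modulo 2 and the symplectic form that of the intersection form, but all relations are proved
  directly, without homology. The edges of a drawing are only continuous and may meet the two planes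
  infinitely often. Hence they are replaced by nearby chains of finitely many pieces, so close that
  disjoint edges give disjoint chains; a chain may well intersect itself. Two coordinates suffice on
  a hexagon because x and F determine y^2 and z^2. The values -1/10 and 1/10 are the extremes of F
  on the surface, attained exactly where z = 0.\<close>

declare add_bit_eq_xor [simp del] mult_bit_eq_and [simp del] minus_bit_def [simp del]

lemma bit_add_self [simp]: "a + a = (0::bit)"
  by (cases a) (simp_all add: add_bit_eq_xor)

lemma bit_add_self_left [simp]: "a + (a + b) = (b::bit)"
  by (simp flip: add.assoc)

lemma bit_diff_eq_add: "a - b = a + (b::bit)"
  by (simp add: minus_bit_def)

definition ff :: "pt \<Rightarrow> real" where
  "ff p = (case p of (x, y, z) \<Rightarrow> y\<^sup>2 - x\<^sup>2 + x ^ 4)"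

type_synonym hex = "bit \<times> bit"
type_synonym h4 = "bit \<times> bit \<times> bit \<times> bit"

definition chart :: "pt \<Rightarrow> complex" where
  "chart p = Complex (fst p) (ff p)"

text \<open>The two bits of a hexagon are the signs of \<open>y\<close> and \<open>z\<close>, with 1 for negative.\<close>

definition hexagon :: "hex \<Rightarrow> pt set" where
  "hexagon H = {(x, y, z) \<in> S2. (if fst H = 0 then 0 \<le> y else y \<le> 0) \<and>
                               (if snd H = 0 then 0 \<le> z else z \<le> 0)}"

definition upper :: "pt \<Rightarrow> bool" where
  "upper v \<longleftrightarrow> ff v = 1/10 \<and> fst (snd v) \<noteq> 0"

text \<open>The argument of \<open>chart u - chart v\<close>. For a boundary point \<open>v\<close> the branch is cut along a vertical ray
  that leaves the hexagon at \<open>v\<close>, so that no point of the hexagon lies on the cut. The shift by \<open>2 * pi\<close>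
  starts the cyclic order of the boundary in the middle of the upper side.\<close>

definition dir :: "pt \<Rightarrow> pt \<Rightarrow> real" where
  "dir v u = (if upper v
     then Arg ((chart u - chart v) * \<i>) - pi / 2 + (if fst v < 0 then 0 else 2 * pi)
     else Arg ((chart u - chart v) * (- \<i>)) + pi / 2)"

definition bd :: "pt set" where
  "bd = {(x, y, z). y = 0 \<or> z = 0}"

lemma S2_iff: "(x, y, z) \<in> S2 \<longleftrightarrow> (ff (x, y, z))\<^sup>2 + z\<^sup>2 = 1/100"
  by (simp add: S2_def ff_def)

lemma S2_z2: assumes "(x, y, z) \<in> S2" shows "z\<^sup>2 = 1/100 - (ff (x, y, z))\<^sup>2"
  using assms by (simp add: S2_iff)

lemma S2_ff_bound: assumes "p \<in> S2" shows "\<bar>ff p\<bar> \<le> 1/10"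
proof -
  obtain x y z where p: "p = (x, y, z)" by (cases p)
  have "(ff p)\<^sup>2 \<le> (1/10)\<^sup>2" using assms S2_z2[of x y z] zero_le_power2[of z] unfolding p
    by (simp add: power_divide)
  then show ?thesis by (metis abs_le_square_iff abs_of_nonneg zero_le_divide_1_iff zero_le_numeral)
qed

lemma hexagon_subset: "hexagon H \<subseteq> S2"
  by (auto simp: hexagon_def)

text \<open>Given x and F, the definition of \<open>ff\<close> fixes y^2 and the equation of the
  surface fixes z^2; the hexagon fixes both signs.\<close>

lemma chart_inj: "inj_on chart (hexagon H)"
proof (rule inj_onI)
  fix p q assume a: "p \<in> hexagon H" "q \<in> hexagon H" "chart p = chart q"
  obtain x y z where p: "p = (x, y, z)" by (cases p)
  obtain x' y' z' where q: "q = (x', y', z')" by (cases q)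
  have x: "x' = x" and f: "ff p = ff q" using a(3) by (auto simp: chart_def p q)
  have "y\<^sup>2 = y'\<^sup>2" using f x by (simp add: ff_def p q)
  then have y: "y = y'" using a(1,2) by (auto simp: hexagon_def p q power2_eq_iff split: if_splits)
  have "z\<^sup>2 = z'\<^sup>2" using a(1,2) f S2_z2[of x y z] S2_z2[of x' y' z'] by (auto simp: hexagon_def p q)
  then have z: "z = z'" using a(1,2) by (auto simp: hexagon_def p q power2_eq_iff split: if_splits)
  show "p = q" by (simp add: p q x y z)
qed

lemma continuous_ff: "continuous_on A ff"
  unfolding ff_def case_prod_unfold by (intro continuous_intros)

lemma continuous_chart: "continuous_on A chart"
proof -
  have "chart = (\<lambda>p. of_real (fst p) + \<i> * of_real (ff p))"
    by (rule ext) (simp add: chart_def complex_eq_iff)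
  moreover have "continuous_on A (\<lambda>p. of_real (fst p) + \<i> * of_real (ff p))"
    by (intro continuous_intros continuous_ff)
  ultimately show ?thesis by metis
qed

text \<open>Multiplication by \<open>\<i>\<close> or \<open>- \<i>\<close> makes the cut of
  \<open>Arg\<close> vertical; the shift by \<open>pi / 2\<close> undoes this rotation, and
  \<open>2 * pi\<close> is a period of the exponential.\<close>

lemma dir_is_Arg:
  assumes "chart u \<noteq> chart v"
  shows "chart u - chart v = of_real (cmod (chart u - chart v)) * exp (\<i> * of_real (dir v u))"
proof -
  let ?c = "chart u - chart v"
  have nz: "?c \<noteq> 0" using assms by simp
  have e1: "exp (\<i> * complex_of_real (pi/2)) = \<i>"
    by (metis cis_conv_exp cis_pi_half)
  have e2: "exp (\<i> * complex_of_real (-(pi/2))) = -\<i>"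
    by (metis cis_conv_exp cis_minus_pi_half)
  have A: "?c * \<i> = of_real (cmod ?c) * exp (\<i> * of_real (Arg (?c * \<i>)))"
    using Arg_eq[of "?c * \<i>"] nz by (simp add: norm_mult)
  have B: "?c * (- \<i>) = of_real (cmod ?c) * exp (\<i> * of_real (Arg (?c * (-\<i>))))"
    using Arg_eq[of "?c * (-\<i>)"] nz by (simp add: norm_mult)
  have per: "exp (\<i> * of_real (a + 2 * pi)) = exp (\<i> * of_real a)" for a
    by (metis cis_2pi cis_conv_exp cis_mult mult.right_neutral)
  have rot: "w * k = of_real r * exp (\<i> * of_real (a + b))"
    if "w = of_real r * exp (\<i> * of_real a)" "exp (\<i> * of_real b) = k" for w k r a b
    unfolding that(1) that(2)[symmetric] by (simp add: exp_add distrib_left mult.assoc)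
  have U: "?c = of_real (cmod ?c) * exp (\<i> * of_real (Arg (?c * \<i>) - pi/2))"
    using rot[OF A e2] by (simp add: mult.assoc)
  have L: "?c = of_real (cmod ?c) * exp (\<i> * of_real (Arg (?c * (-\<i>)) + pi/2))"
    using rot[OF B e1] by (simp add: mult.assoc)
  show ?thesis
    using U L per[of "Arg (?c * \<i>) - pi/2"] unfolding dir_def by (auto split: if_splits)
qed

lemma dir_antisym:
  assumes "chart u \<noteq> chart v"
  obtains k :: int where "dir v u - dir u v = pi * (2 * of_int k + 1)"
proof -
  let ?r = "complex_of_real (cmod (chart u - chart v))"
  have r: "?r \<noteq> 0" using assms by simp
  have "chart u - chart v = ?r * exp (\<i> * of_real (dir v u))"
    by (rule dir_is_Arg[OF assms])
  moreover have "chart v - chart u = ?r * exp (\<i> * of_real (dir u v))"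
    using dir_is_Arg[of v u] assms by (simp add: norm_minus_commute)
  ultimately have "?r * exp (\<i> * of_real (dir v u)) = - (?r * exp (\<i> * of_real (dir u v)))"
    by (metis minus_diff_eq)
  then have "exp (\<i> * of_real (dir v u)) = - exp (\<i> * of_real (dir u v))"
    using r by (metis mult_cancel_left mult_minus_right)
  also have "\<dots> = exp (\<i> * of_real (dir u v) + \<i> * of_real pi)"
    by (simp add: exp_add)
  finally have "exp (\<i> * of_real (dir v u)) = exp (\<i> * of_real (dir u v) + \<i> * of_real pi)" .
  then obtain n :: int where "\<i> * of_real (dir v u) = \<i> * of_real (dir u v) + \<i> * of_real pi + (of_int (2 * n) * pi) * \<i>"
    unfolding exp_eq by auto
  then have "Im (\<i> * of_real (dir v u)) = Im (\<i> * of_real (dir u v) + \<i> * of_real pi + (of_int (2 * n) * pi) * \<i>)"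
    by simp
  then have "dir v u = dir u v + pi + of_int (2 * n) * pi" by simp
  then show ?thesis by (intro that[of n]) (simp add: algebra_simps)
qed

text \<open>By \<open>dir_antisym\<close> the two directions differ by \<open>(2 * k + 1) * pi\<close>; this is the parity of \<open>k\<close>.\<close>

definition crossbit :: "pt \<Rightarrow> pt \<Rightarrow> bit" where
  "crossbit u v = of_int \<lfloor>((dir v u - dir u v) / pi - 1) / 2\<rfloor>"

lemma crossbit_eq:
  assumes "dir v u - dir u v = pi * (2 * of_int k + 1)"
  shows "crossbit u v = of_int k"
proof -
  have "((dir v u - dir u v) / pi - 1) / 2 = of_int k" unfolding assms by simp
  then show ?thesis by (simp add: crossbit_def)
qed

text \<open>Exchanging the points replaces k by -k - 1, which has the other parity.\<close>

lemma crossbit_commute: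
  assumes "chart u \<noteq> chart v"
  shows "crossbit u v = 1 + crossbit v u"
proof -
  obtain k where k: "dir v u - dir u v = pi * (2 * of_int k + 1)" using dir_antisym[OF assms] by blast
  have k': "dir u v - dir v u = pi * (2 * of_int (- k - 1) + 1)" using k by (simp add: algebra_simps)
  have "crossbit v u = of_int (- k - 1)" using crossbit_eq[OF k'] .
  moreover have "crossbit u v = of_int k" using crossbit_eq[OF k] .
  ultimately show ?thesis by (cases "of_int k :: bit") (simp_all add: bit_diff_eq_add)
qed

section \<open>Continuous logarithms and winding modulo 2\<close>

definition log_lift :: "(real \<Rightarrow> complex) \<Rightarrow> (real \<Rightarrow> complex) \<Rightarrow> bool" where
  "log_lift G L \<longleftrightarrow> continuous_on {0..1} L \<and> (\<forall>t\<in>{0..1}. G t = exp (L t))"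

text \<open>By \<open>log_lift_unique\<close> the value does not depend on the chosen lift.\<close>

definition arg_change :: "(real \<Rightarrow> complex) \<Rightarrow> real" where
  "arg_change G = (let L = (SOME L. log_lift G L) in Im (L 1) - Im (L 0))"

text \<open>Two lifts differ by 2 \<pi> i times a continuous integer-valued function, which is
  constant on the interval.\<close>

lemma log_lift_unique:
  assumes "log_lift G L" "log_lift G M"
  shows "Im (L 1) - Im (L 0) = Im (M 1) - Im (M 0)"
proof -
  let ?d = "\<lambda>t. (L t - M t) / (2 * of_real pi * \<i>)"
  have tpi: "2 * complex_of_real pi * \<i> \<noteq> 0" by simp
  have c: "continuous_on {0..1} ?d"
    using assms by (intro continuous_intros) (auto simp: log_lift_def)
  have i: "?d t \<in> \<int>" if "t \<in> {0..1}" for t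
  proof -
    have "exp (L t) = exp (M t)" using assms that by (auto simp: log_lift_def)
    then obtain n :: int where "L t = M t + (of_int (2 * n) * pi) * \<i>" unfolding exp_eq by auto
    then have "L t - M t = of_int n * (2 * of_real pi * \<i>)" by simp
    then have "?d t = of_int n" by (simp only: nonzero_mult_div_cancel_right[OF tpi])
    then show ?thesis by (metis Ints_of_int)
  qed
  have "?d constant_on {0..1}"
  proof (rule continuous_discrete_range_constant[OF _ c])
    show "connected {0..1::real}" by simp
    fix x :: real assume x: "x \<in> {0..1}"
    show "\<exists>e>0. \<forall>y. y \<in> {0..1} \<and> ?d y \<noteq> ?d x \<longrightarrow> e \<le> norm (?d y - ?d x)"
    proof (intro exI[of _ 1] conjI allI impI)
      fix y assume y: "y \<in> {0..1} \<and> ?d y \<noteq> ?d x"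
      obtain m where m: "?d y = of_int m" using i y by (meson Ints_cases)
      obtain n where n: "?d x = of_int n" using i[OF x] by (meson Ints_cases)
      have "m \<noteq> n" using y m n by metis
      then have le: "1 \<le> \<bar>of_int (m - n) :: real\<bar>" by linarith
      have "?d y - ?d x = of_int (m - n)" unfolding m n by simp
      then have "norm (?d y - ?d x) = \<bar>of_int (m - n) :: real\<bar>" by (metis norm_of_int)
      then show "1 \<le> norm (?d y - ?d x)" using le by (simp only:)
    qed simp
  qed
  then obtain w where w: "\<And>x. x \<in> {0..1} \<Longrightarrow> ?d x = w" unfolding constant_on_def by blast
  have "L 1 - M 1 = L 0 - M 0"
    using w[of 0] w[of 1] tpi divide_cancel_right[of "L 1 - M 1" "2 * complex_of_real pi * \<i>" "L 0 - M 0"] by simp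
  then have "Im (L 1 - M 1) = Im (L 0 - M 0)" by (rule arg_cong)
  then show ?thesis by simp
qed

lemma arg_change_eq:
  assumes "log_lift G L" shows "arg_change G = Im (L 1) - Im (L 0)"
  unfolding arg_change_def Let_def
  by (rule log_lift_unique[OF someI[of "log_lift G", OF assms] assms])

lemma log_lift_exists:
  assumes "continuous_on {0..1} G" "\<And>t. t \<in> {0..1} \<Longrightarrow> G t \<noteq> 0"
  obtains L where "log_lift G L"
  using continuous_logarithm_on_contractible[OF assms(1) convex_imp_contractible assms(2)]
  unfolding log_lift_def by (metis convex_real_interval(5))

lemma arg_change_uminus:
  assumes "log_lift G L" shows "arg_change (\<lambda>t. - G t) = Im (L 1) - Im (L 0)"
proof -
  have "log_lift (\<lambda>t. - G t) (\<lambda>t. L t + \<i> * of_real pi)"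
    using assms by (auto simp: log_lift_def exp_add intro!: continuous_intros)
  from arg_change_eq[OF this] show ?thesis by simp
qed

definition piece :: "hex \<Rightarrow> (real \<Rightarrow> pt) \<Rightarrow> bool" where
  "piece H g \<longleftrightarrow> continuous_on {0..1} g \<and> g ` {0..1} \<subseteq> hexagon H"

definition turn :: "(real \<Rightarrow> pt) \<Rightarrow> pt \<Rightarrow> real" where
  "turn g v = arg_change (\<lambda>t. chart (g t) - chart v)"

text \<open>The number of times, modulo 2, that \<open>chart \<circ> g\<close> passes the branch cut of \<open>dir v\<close>.\<close>

definition wind :: "(real \<Rightarrow> pt) \<Rightarrow> pt \<Rightarrow> bit" where
  "wind g v = of_int \<lfloor>(turn g v - (dir v (g 1) - dir v (g 0))) / (2 * pi)\<rfloor>"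

lemma piece_avoid:
  assumes "piece H g" "v \<in> hexagon H" "v \<notin> g ` {0..1}" "t \<in> {0..1}"
  shows "chart (g t) \<noteq> chart v"
proof
  assume "chart (g t) = chart v"
  moreover have "g t \<in> hexagon H" using assms(1,4) unfolding piece_def by blast
  ultimately have "g t = v" using inj_onD[OF chart_inj] assms(2) by blast
  then show False using assms(3,4) by blast
qed

text \<open>A continuous argument along \<open>g\<close> and the branch \<open>dir v\<close> differ
  by a multiple of \<open>2 * pi\<close> at either end; \<open>wind\<close> keeps the parity of the
  difference of these two multiples.\<close>

lemma turn_eq:
  assumes "piece H g" "v \<in> hexagon H" "v \<notin> g ` {0..1}"
  obtains n :: int where "turn g v = dir v (g 1) - dir v (g 0) + 2 * pi * of_int n" "wind g v = of_int n"
proof -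
  have nz: "chart (g t) - chart v \<noteq> 0" if "t \<in> {0..1}" for t using piece_avoid[OF assms that] by simp
  have "continuous_on {0..1} (\<lambda>t. chart (g t) - chart v)"
    using assms(1) unfolding piece_def
    by (intro continuous_intros continuous_on_compose2[OF continuous_chart[of UNIV]]) auto
  then obtain L where L: "log_lift (\<lambda>t. chart (g t) - chart v) L" using log_lift_exists nz by blast
  have e: "\<exists>n::int. Im (L t) = dir v (g t) + 2 * pi * of_int n" if t: "t \<in> {0..1}" for t
  proof -
    let ?c = "chart (g t) - chart v"
    have 1: "exp (L t) = ?c" using L t by (simp add: log_lift_def)
    have 2: "?c = of_real (cmod ?c) * exp (\<i> * of_real (dir v (g t)))"
      by (rule dir_is_Arg) (use nz[OF t] in auto)
    have "of_real (cmod ?c) = exp (of_real (ln (cmod ?c)) :: complex)"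
      using nz[OF t] by (metis exp_ln exp_of_real zero_less_norm_iff)
    then have "exp (L t) = exp (of_real (ln (cmod ?c)) + \<i> * of_real (dir v (g t)))"
      using 1 2 by (simp add: exp_add)
    then obtain n :: int where "L t = of_real (ln (cmod ?c)) + \<i> * of_real (dir v (g t)) + (of_int (2 * n) * pi) * \<i>"
      unfolding exp_eq by auto
    then have "Im (L t) = Im (of_real (ln (cmod ?c)) + \<i> * of_real (dir v (g t)) + (of_int (2 * n) * pi) * \<i>)"
      by simp
    then show ?thesis by (intro exI[of _ n]) simp
  qed
  obtain a where a: "Im (L 0) = dir v (g 0) + 2 * pi * of_int a" using e[of 0] by auto
  obtain b where b: "Im (L 1) = dir v (g 1) + 2 * pi * of_int b" using e[of 1] by auto
  have t: "turn g v = dir v (g 1) - dir v (g 0) + 2 * pi * of_int (b - a)"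
    unfolding turn_def arg_change_eq[OF L] a b by (simp add: algebra_simps)
  then have "(turn g v - (dir v (g 1) - dir v (g 0))) / (2 * pi) = of_int (b - a)"
    by (simp add: field_simps)
  then have "wind g v = of_int (b - a)" unfolding wind_def by (metis floor_of_int)
  then show ?thesis using t that by blast
qed

text \<open>The four turns are the changes of one logarithm along the sides of the square, so with
  orientation they sum to zero. In \<open>turn h\<close> the difference has the opposite sign, which
  does not alter the change of its argument.\<close>

lemma turn_square:
  assumes g: "piece H g" and h: "piece H h" and disj: "g ` {0..1} \<inter> h ` {0..1} = {}"
  shows "turn g (h 0) + turn h (g 1) - turn g (h 1) - turn h (g 0) = 0"
proof -
  let ?Q = "{0..1::real} \<times> {0..1::real}"
  let ?G = "\<lambda>q. chart (g (fst q)) - chart (h (snd q))"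
  have ch: "continuous_on UNIV chart" by (rule continuous_chart)
  have cg: "continuous_on ?Q (\<lambda>q. g (fst q))" and chh: "continuous_on ?Q (\<lambda>q. h (snd q))"
    using g h unfolding piece_def
    by (auto intro!: continuous_on_compose2[of "{0..1}" g] continuous_on_compose2[of "{0..1}" h] continuous_intros)
  have c: "continuous_on ?Q ?G"
    by (intro continuous_intros continuous_on_compose2[OF ch] cg chh) auto
  have nz: "?G q \<noteq> 0" if "q \<in> ?Q" for q
  proof -
    have q: "fst q \<in> {0..1}" "snd q \<in> {0..1}" using that by auto
    then have "h (snd q) \<in> hexagon H" "h (snd q) \<notin> g ` {0..1}" using h disj unfolding piece_def by blast+
    then show ?thesis using piece_avoid[OF g _ _ q(1)] by simp
  qed
  have "convex ?Q" by (intro convex_Times convex_real_interval)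
  then obtain L where L: "continuous_on ?Q L" "\<And>q. q \<in> ?Q \<Longrightarrow> ?G q = exp (L q)"
    using continuous_logarithm_on_contractible[OF c convex_imp_contractible nz] by blast
  have row: "log_lift (\<lambda>s. chart (g s) - chart (h t)) (\<lambda>s. L (s, t))" if "t \<in> {0..1}" for t
    unfolding log_lift_def using that L(2)
    by (auto intro!: continuous_on_compose2[OF L(1)] continuous_intros)
  have col: "log_lift (\<lambda>t. chart (g s) - chart (h t)) (\<lambda>t. L (s, t))" if "s \<in> {0..1}" for s
    unfolding log_lift_def using that L(2)
    by (auto intro!: continuous_on_compose2[OF L(1)] continuous_intros)
  have "turn g (h t) = Im (L (1, t)) - Im (L (0, t))" if "t \<in> {0..1}" for t
    unfolding turn_def using arg_change_eq[OF row[OF that]] by simp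
  moreover have "turn h (g s) = Im (L (s, 1)) - Im (L (s, 0))" if "s \<in> {0..1}" for s
    unfolding turn_def using arg_change_uminus[OF col[OF that]] by simp
  ultimately show ?thesis by simp
qed

text \<open>In \<open>turn_square\<close> each turn is a difference of two directions plus a
  multiple of \<open>2 * pi\<close>. Grouping the eight directions by pairs of end points gives four
  odd multiples of \<open>pi\<close>, two with each sign, so their odd parts cancel; dividing by
  \<open>2 * pi\<close> leaves the parity.\<close>

lemma pieces_crossing_parity:
  assumes g: "piece H g" and h: "piece H h" and disj: "g ` {0..1} \<inter> h ` {0..1} = {}"
  shows "crossbit (g 0) (h 0) + crossbit (g 0) (h 1) + crossbit (g 1) (h 0) + crossbit (g 1) (h 1)
       + wind g (h 0) + wind g (h 1) + wind h (g 0) + wind h (g 1) = 0"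
proof -
  have gi: "g 0 \<in> hexagon H" "g 1 \<in> hexagon H" "h 0 \<in> hexagon H" "h 1 \<in> hexagon H"
    using g h by (auto simp: piece_def)
  have av: "h 0 \<notin> g ` {0..1}" "h 1 \<notin> g ` {0..1}" "g 0 \<notin> h ` {0..1}" "g 1 \<notin> h ` {0..1}"
  proof -
    have "(0::real) \<in> {0..1}" "(1::real) \<in> {0..1}" by auto
    then show "h 0 \<notin> g ` {0..1}" "h 1 \<notin> g ` {0..1}" "g 0 \<notin> h ` {0..1}" "g 1 \<notin> h ` {0..1}"
      using disj by blast+
  qed
  have ne: "chart (g a) \<noteq> chart (h b)" if "a = 0 \<or> a = 1" "b = 0 \<or> b = 1" for a b
    using that piece_avoid[OF g gi(3) av(1), of a] piece_avoid[OF g gi(4) av(2), of a] by auto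
  obtain k00 where k00: "dir (h 0) (g 0) - dir (g 0) (h 0) = pi * (2 * of_int k00 + 1)" using dir_antisym ne by blast
  obtain k01 where k01: "dir (h 1) (g 0) - dir (g 0) (h 1) = pi * (2 * of_int k01 + 1)" using dir_antisym ne by blast
  obtain k10 where k10: "dir (h 0) (g 1) - dir (g 1) (h 0) = pi * (2 * of_int k10 + 1)" using dir_antisym ne by blast
  obtain k11 where k11: "dir (h 1) (g 1) - dir (g 1) (h 1) = pi * (2 * of_int k11 + 1)" using dir_antisym ne by blast
  obtain n0 where n0: "turn g (h 0) = dir (h 0) (g 1) - dir (h 0) (g 0) + 2 * pi * of_int n0" "wind g (h 0) = of_int n0"
    using turn_eq[OF g gi(3) av(1)] .
  obtain n1 where n1: "turn g (h 1) = dir (h 1) (g 1) - dir (h 1) (g 0) + 2 * pi * of_int n1" "wind g (h 1) = of_int n1"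
    using turn_eq[OF g gi(4) av(2)] .
  obtain m0 where m0: "turn h (g 0) = dir (g 0) (h 1) - dir (g 0) (h 0) + 2 * pi * of_int m0" "wind h (g 0) = of_int m0"
    using turn_eq[OF h gi(1) av(3)] .
  obtain m1 where m1: "turn h (g 1) = dir (g 1) (h 1) - dir (g 1) (h 0) + 2 * pi * of_int m1" "wind h (g 1) = of_int m1"
    using turn_eq[OF h gi(2) av(4)] .
  have "2 * pi * of_int (k10 - k00 - k11 + k01 + n0 + m1 - n1 - m0) = 0"
    using turn_square[OF g h disj] k00 k01 k10 k11 n0(1) n1(1) m0(1) m1(1)
    by (simp add: algebra_simps)
  then have z: "k10 - k00 - k11 + k01 + n0 + m1 - n1 - m0 = 0" by (simp del: of_int_add of_int_diff)
  have "(of_int (k10 - k00 - k11 + k01 + n0 + m1 - n1 - m0) :: bit) = 0" unfolding z by simp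
  then have "(of_int k10 + of_int k00 + of_int k11 + of_int k01 + of_int n0 + of_int m1 + of_int n1 + of_int m0 :: bit) = 0"
    by (simp only: of_int_add of_int_diff bit_diff_eq_add)
  then show ?thesis
    unfolding crossbit_eq[OF k00] crossbit_eq[OF k01] crossbit_eq[OF k10] crossbit_eq[OF k11] n0(2) n1(2) m0(2) m1(2)
    by (simp only: ac_simps)
qed

section \<open>Directions seen from boundary points\<close>

text \<open>On \<open>y = 0\<close> the value of \<open>ff\<close> is x^4 - x^2, the least possible
  over this x; on \<open>z = 0\<close> off the upper side it is -1/10, the minimum on the surface.
  So the downward ray from the chart point of \<open>v\<close> leaves the image of the
  surface.\<close>

lemma bd_floor:
  assumes "v \<in> S2" "v \<in> bd" "\<not> upper v" "u \<in> S2" "fst u = fst v"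
  shows "ff v \<le> ff u"
proof -
  obtain x y z where v: "v = (x, y, z)" by (cases v)
  obtain x' y' z' where u: "u = (x', y', z')" by (cases u)
  show ?thesis
  proof (cases "y = 0")
    case True
    then show ?thesis using assms(5) by (simp add: ff_def u v)
  next
    case False
    then have "z = 0" using assms(2) by (simp add: bd_def v)
    then have "(ff v)\<^sup>2 = (1/10)\<^sup>2" using S2_z2[of x y z] assms(1) by (simp add: v power_divide)
    then have "ff v = 1/10 \<or> ff v = - (1/10)" using power2_eq_iff by blast
    then have "ff v = - (1/10)" using assms(3) False by (simp add: upper_def v)
    then show ?thesis using S2_ff_bound[OF assms(4)] by linarith
  qed
qed

lemma continuous_on_dir_bd:
  assumes v: "v \<in> S2" "v \<in> bd" and g: "continuous_on T g" "g ` T \<subseteq> S2"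
    and ne: "\<And>t. t \<in> T \<Longrightarrow> chart (g t) \<noteq> chart v"
  shows "continuous_on T (\<lambda>t. dir v (g t))"
proof -
  have c: "continuous_on T (\<lambda>t. chart (g t))"
    by (rule continuous_on_compose2[OF continuous_chart[of UNIV] g(1)]) simp
  show ?thesis
  proof (cases "upper v")
    case True
    have "(chart (g t) - chart v) * \<i> \<notin> \<real>\<^sub>\<le>\<^sub>0" if t: "t \<in> T" for t
    proof
      assume "(chart (g t) - chart v) * \<i> \<in> \<real>\<^sub>\<le>\<^sub>0"
      then have "fst (g t) = fst v" "ff (g t) \<ge> ff v"
        by (auto simp: complex_nonpos_Reals_iff chart_def)
      moreover have "ff (g t) \<le> ff v"
        using S2_ff_bound[of "g t"] g(2) t True by (auto simp: upper_def)
      ultimately show False using ne[OF t] by (simp add: chart_def)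
    qed
    then have "continuous_on T (\<lambda>t. Arg ((chart (g t) - chart v) * \<i>))"
      by (intro continuous_on_compose2[OF continuous_on_Arg] continuous_intros c) auto
    then show ?thesis unfolding dir_def using True by (auto intro!: continuous_intros)
  next
    case False
    have "(chart (g t) - chart v) * (- \<i>) \<notin> \<real>\<^sub>\<le>\<^sub>0" if t: "t \<in> T" for t
    proof
      assume "(chart (g t) - chart v) * (- \<i>) \<in> \<real>\<^sub>\<le>\<^sub>0"
      then have 1: "fst (g t) = fst v" "ff (g t) \<le> ff v"
        by (auto simp: complex_nonpos_Reals_iff chart_def)
      have "g t \<in> S2" using g(2) t by auto
      then have "ff v \<le> ff (g t)" using bd_floor[OF v False _ 1(1)] by simp
      with 1 show False using ne[OF t] by (simp add: chart_def)
    qed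
    then have "continuous_on T (\<lambda>t. Arg ((chart (g t) - chart v) * (- \<i>)))"
      by (intro continuous_on_compose2[OF continuous_on_Arg] continuous_intros c) auto
    then show ?thesis unfolding dir_def using False by (auto intro!: continuous_intros)
  qed
qed

text \<open>The cut of \<open>dir v\<close> misses the hexagon, so \<open>dir v\<close> along
  \<open>g\<close> is itself the imaginary part of a continuous logarithm.\<close>

lemma wind_bd:
  assumes g: "piece H g" and v: "v \<in> hexagon H" "v \<in> bd" and a: "v \<notin> g ` {0..1}"
  shows "wind g v = 0"
proof -
  have vS: "v \<in> S2" and gS: "g ` {0..1} \<subseteq> S2" and gc: "continuous_on {0..1} g"
    using v(1) g hexagon_subset[of H] unfolding piece_def by blast+
  have nz: "chart (g t) \<noteq> chart v" if "t \<in> {0..1}" for t using piece_avoid[OF g v(1) a that] .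
  have cc: "continuous_on {0..1} (\<lambda>t. chart (g t))"
    by (rule continuous_on_compose2[OF continuous_chart[of UNIV] gc]) simp
  let ?L = "\<lambda>t. of_real (ln (cmod (chart (g t) - chart v))) + \<i> * of_real (dir v (g t))"
  have "log_lift (\<lambda>t. chart (g t) - chart v) ?L"
    unfolding log_lift_def
  proof (intro conjI ballI)
    show "continuous_on {0..1} ?L"
      using nz by (intro continuous_intros cc continuous_on_dir_bd[OF vS v(2) gc gS]) auto
    fix t :: real assume t: "t \<in> {0..1}"
    have "exp (?L t) = of_real (exp (ln (cmod (chart (g t) - chart v)))) * exp (\<i> * of_real (dir v (g t)))"
      by (simp only: exp_add exp_of_real)
    also have "\<dots> = chart (g t) - chart v"
      using dir_is_Arg[OF nz[OF t]] nz[OF t] by simp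
    finally show "chart (g t) - chart v = exp (?L t)" ..
  qed
  from arg_change_eq[OF this] have "turn g v = dir v (g 1) - dir v (g 0)"
    by (simp add: turn_def)
  then show ?thesis by (simp add: wind_def)
qed

text \<open>Both directions use the same branch for opposite numbers, so they differ by
  \<open>pi\<close>, and the sign is decided by which point lies to the left.\<close>

lemma crossbit_lower:
  assumes "\<not> upper u" "\<not> upper v" "fst v < fst u"
  shows "crossbit u v = 1"
proof -
  let ?z = "(chart u - chart v) * (- \<i>)"
  have im: "Im ?z < 0" using assms(3) by (simp add: chart_def)
  then have "?z \<noteq> 0" by auto
  moreover have "Arg ?z < 0" using im by (simp only: Arg_neg_iff)
  ultimately have "Arg (- ?z) = Arg ?z + pi" using Arg_minus[of ?z] by simp
  moreover have "(chart v - chart u) * (- \<i>) = - ?z" by (simp add: algebra_simps)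
  ultimately have "dir v u - dir u v = pi * (2 * of_int (-1) + 1)"
    using assms(1,2) unfolding dir_def by simp
  from crossbit_eq[OF this] show ?thesis by simp
qed

text \<open>The opposite quarter turns make both directions shifts of the same \<open>Arg\<close>,
  so their difference is \<open>pi\<close> or \<open>- pi\<close>, depending only on the shift by
  \<open>2 * pi\<close>.\<close>

lemma crossbit_lower_upper:
  assumes "\<not> upper u" "upper v"
  shows "crossbit u v = of_bool (fst v < 0)"
proof -
  have e: "(chart v - chart u) * (- \<i>) = (chart u - chart v) * \<i>" by (simp add: algebra_simps)
  have "dir v u - dir u v = pi * (2 * of_int (if fst v < 0 then -1 else 0) + 1)"
    using assms unfolding dir_def e by simp
  from crossbit_eq[OF this] show ?thesis by simp
qed

text \<open>Indicators of arcs of the boundary of a hexagon. \<open>midbit\<close> and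
  \<open>rightbit\<close> serve for points with \<open>y = 0\<close>, where |x| is never 1/2; the
  others serve for points with \<open>z = 0\<close>: the two hole sides and the left half of the
  upper side.\<close>

definition midbit :: "pt \<Rightarrow> bit" where "midbit u = of_bool (\<bar>fst u\<bar> \<le> 1/2)"
definition rightbit :: "pt \<Rightarrow> bit" where "rightbit u = of_bool (fst u > 1/2)"
definition lhole :: "pt \<Rightarrow> bit" where "lhole v = of_bool (ff v = - (1/10) \<and> fst v < 0)"
definition rhole :: "pt \<Rightarrow> bit" where "rhole v = of_bool (ff v = - (1/10) \<and> fst v > 0)"
definition outl :: "pt \<Rightarrow> bit" where "outl v = of_bool (ff v = 1/10 \<and> fst v < 0)"

text \<open>The bit tells whether \<open>v\<close> comes before \<open>u\<close> along the boundary
  cut open in the middle of the upper side: left half of the upper side, left side on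
  \<open>y = 0\<close>, left hole, middle side, right hole, right side on \<open>y = 0\<close>,
  right half of the upper side. Positions are compared through the squares of the x-coordinates,
  because t^2 - t decreases up to 1/2 and increases afterwards.\<close>

lemma crossbit_sides:
  assumes u: "u \<in> S2" "fst (snd u) = 0" and v: "v \<in> S2" "snd (snd v) = 0" and ne: "chart u \<noteq> chart v"
  shows "crossbit u v = midbit u * lhole v + rightbit u * (lhole v + rhole v) + outl v"
proof -
  obtain a b c where ue: "u = (a, b, c)" by (cases u)
  obtain x y z where ve: "v = (x, y, z)" by (cases v)
  have lu: "\<not> upper u" using u(2) by (simp add: upper_def)
  obtain A where A: "A = a\<^sup>2" "0 \<le> A" by simp
  obtain X where X: "X = x\<^sup>2" "0 \<le> X" by simp
  have p4: "t^4 = t\<^sup>2 * t\<^sup>2" for t :: real by simp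
  have fu: "ff u = A * A - A" using u(2) unfolding ff_def ue A p4 by simp
  have bu: "A * A - A \<le> 1/10" "- (1/10) \<le> A * A - A" using S2_ff_bound[OF u(1)] unfolding fu by linarith+
  have "(ff v)\<^sup>2 = (1/10)\<^sup>2" using S2_z2[of x y z] v by (simp add: ve power_divide)
  then have fv: "ff v = 1/10 \<or> ff v = - (1/10)" using power2_eq_iff by blast
  have fve: "ff v = y\<^sup>2 - X + X * X" unfolding ff_def ve X p4 by simp
  \<comment> \<open>The bounds on \<open>A * A - A\<close> force \<open>A\<close> below 1/2 - sqrt
    (3/20) or above 1/2 + sqrt (3/20). The numbers 1/5 and 4/5 are rational points of this gap, and
    the square of 1/2 lies between them.\<close>
  have dich: "A \<le> 1/5 \<or> 4/5 \<le> A"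
  proof (rule ccontr)
    assume "\<not> ?thesis"
    then have "0 < (A - 1/5) * (4/5 - A)" by (intro mult_pos_pos) auto
    moreover have "(A - 1/5) * (4/5 - A) = A - 4/25 - A * A" by (simp add: field_simps)
    ultimately show False using bu by linarith
  qed
  have mid: "\<bar>a\<bar> \<le> 1/2 \<longleftrightarrow> A \<le> 1/5"
  proof -
    have "\<bar>a\<bar> \<le> \<bar>1/2\<bar> \<longleftrightarrow> A \<le> (1/2)\<^sup>2" unfolding A by (rule abs_le_square_iff)
    then have "\<bar>a\<bar> \<le> 1/2 \<longleftrightarrow> A \<le> 1/4" by (simp add: power_divide)
    then show ?thesis using dich by linarith
  qed
  have le: "\<bar>a\<bar> \<le> \<bar>x\<bar> \<longleftrightarrow> A \<le> X" "\<bar>x\<bar> \<le> \<bar>a\<bar> \<longleftrightarrow> X \<le> A"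
    unfolding A X by (rule abs_le_square_iff)+
  show ?thesis
  proof (cases "upper v")
    case True
    then have "ff v = 1/10" by (simp add: upper_def)
    then show ?thesis using crossbit_lower_upper[OF lu True] by (simp add: lhole_def rhole_def outl_def)
  next
    case False
    \<comment> \<open>On a common vertical both points would have the least value of
      \<open>ff\<close>, hence the same chart.\<close>
    have ne': "a \<noteq> x"
    proof
      assume e: "a = x"
      have "ff v \<le> ff u" using bd_floor[OF v(1) _ False u(1)] v(2) e by (simp add: bd_def ve ue)
      moreover have "ff u \<le> ff v" unfolding fu fve using e A X by simp
      ultimately show False using ne e by (simp add: chart_def ue ve)
    qed
    have cr: "crossbit u v = of_bool (x < a)"
    proof (cases "x < a")
      case True then show ?thesis using crossbit_lower[OF lu False] by (simp add: ue ve)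
    next
      case f: False
      then have "crossbit v u = 1" using crossbit_lower[OF False lu] ne' by (simp add: ue ve)
      then show ?thesis using crossbit_commute[OF ne] f by simp
    qed
    have sides: "fst u = a" "fst v = x" by (simp_all add: ue ve)
    show ?thesis
    proof (cases "ff v = 1/10")
      case t: True
      then have "y = 0" using False by (simp add: upper_def ve)
      then have Xe: "X * X - X = 1/10" using t fve by simp
      have "A \<le> X"
      proof (rule ccontr)
        assume "\<not> ?thesis"
        then have l: "X < A" by simp
        have "1 < X"
        proof (rule ccontr)
          assume "\<not> 1 < X"
          then have "X * X \<le> X * 1" using X(2) by (intro mult_left_mono) auto
          then show False using Xe by simp
        qed
        then have "0 < (A - X) * (A + X - 1)" using l by (intro mult_pos_pos) auto
        then have "A * A - A > X * X - X" by (simp add: algebra_simps)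
        then show False using Xe bu by simp
      qed
      then have "x < a \<longleftrightarrow> x < 0" using ne' le by linarith
      then show ?thesis using cr t by (simp add: lhole_def rhole_def outl_def sides)
    next
      case f: False
      then have fm: "ff v = - (1/10)" using fv by simp
      then have Xe: "X * X - X \<le> - (1/10)" using fve zero_le_power2[of y] by linarith
      have x0: "x \<noteq> 0"
      proof
        assume "x = 0" then have "X = 0" by (simp add: X)
        then show False using Xe by simp
      qed
      have "0 \<le> X * X" by simp
      then have xx1: "1/10 \<le> X" using Xe by linarith
      have xx: "X \<le> 9/10"
      proof (rule ccontr)
        assume "\<not> ?thesis"
        then have "0 \<le> (X - 9/10) * (X - 1/10)" by (intro mult_nonneg_nonneg) auto
        moreover have "(X - 9/10) * (X - 1/10) = X * X - X + 9/100" by (simp add: field_simps)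
        ultimately show False using Xe by linarith
      qed
      have cmp: "X * X - X \<le> A * A - A" using Xe bu by simp
      show ?thesis
      proof (cases "\<bar>a\<bar> \<le> 1/2")
        case m: True
        then have aa: "A \<le> 1/5" using mid by simp
        have "A \<le> X"
        proof (rule ccontr)
          assume "\<not> ?thesis"
          then have l: "X < A" by simp
          have "0 < (A - X) * (1 - A - X)" using l aa by (intro mult_pos_pos) auto
          then show False using cmp by (simp add: algebra_simps)
        qed
        then have "x < a \<longleftrightarrow> x < 0" using ne' le by linarith
        moreover have "\<not> 1/2 < a" using m by linarith
        ultimately show ?thesis using cr m fm x0 by (simp add: lhole_def rhole_def outl_def sides midbit_def rightbit_def)
      next
        case nm: False
        then have aa: "4/5 \<le> A" using mid dich by blast
        have "X \<le> A"
        proof (rule ccontr)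
          assume "\<not> ?thesis"
          then have l: "A < X" by simp
          have "0 < (X - A) * (X + A - 1)" using l aa by (intro mult_pos_pos) auto
          then show False using cmp by (simp add: algebra_simps)
        qed
        then have "x < a \<longleftrightarrow> 1/2 < a" using ne' nm le by linarith
        moreover have "lhole v + rhole v = 1"
          using fm x0 by (cases "x < 0") (simp_all add: lhole_def rhole_def sides)
        ultimately show ?thesis using cr nm fm by (simp add: outl_def sides midbit_def rightbit_def)
      qed
    qed
  qed
qed

section \<open>Chains of pieces\<close>

definition samehex :: "hex \<Rightarrow> hex \<Rightarrow> bit" where
  "samehex H K = of_bool (H = K)"

lemma samehex_commute: "samehex H K = samehex K H"
  by (auto simp: samehex_def)

text \<open>As a polynomial in the bits, \<open>samehex\<close> is (1 + y + y')(1 + z + z'). Its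
  mixed second difference retains only products of a change of y in one argument and a change of z
  in the other, so two break points interact only if they lie on different planes.\<close>

lemma samehex_four:
  "samehex H K + samehex H' K + samehex H K' + samehex H' K' =
   (fst H + fst H') * (snd K + snd K') + (snd H + snd H') * (fst K + fst K')"
proof -
  have e: "samehex A B = (1 + fst A + fst B) * (1 + snd A + snd B)" for A B
    by (cases "fst A"; cases "fst B"; cases "snd A"; cases "snd B")
      (auto simp: samehex_def prod_eq_iff)
  define p q a b c d where "p = 1 + fst H + fst K" "q = 1 + snd H + snd K" "a = fst H + fst H'"
    "b = snd H + snd H'" "c = fst K + fst K'" "d = snd K + snd K'"
  note df = this
  have "1 + fst H' + fst K = p + a" "1 + snd H' + snd K = q + b" "1 + fst H + fst K' = p + c"
    "1 + snd H + snd K' = q + d" "1 + fst H' + fst K' = p + a + c" "1 + snd H' + snd K' = q + b + d"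
    unfolding df by (simp_all add: ac_simps)
  then show ?thesis unfolding e df(1,2)[symmetric] unfolding df(3-6)[symmetric]
    by (simp add: algebra_simps)
qed

text \<open>With \<open>t a b\<close> belonging to vertex \<open>a\<close> of piece
  \<open>b\<close>, a sum over pieces of both ends becomes a sum over interior vertices of both
  adjoining pieces, plus the two outer ends.\<close>

lemma sum_by_parts_bit:
  fixes t :: "nat \<Rightarrow> nat \<Rightarrow> bit"
  shows "(\<Sum>j\<le>m. t j j + t (Suc j) j) = t 0 0 + t (Suc m) m + (\<Sum>j<m. t (Suc j) j + t (Suc j) (Suc j))"
proof (induction m)
  case (Suc m)
  have "(\<Sum>j\<le>Suc m. t j j + t (Suc j) j) = (\<Sum>j\<le>m. t j j + t (Suc j) j) + (t (Suc m) (Suc m) + t (Suc (Suc m)) (Suc m))"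
    by simp
  also have "\<dots> = t 0 0 + t (Suc m) m + (\<Sum>j<m. t (Suc j) j + t (Suc j) (Suc j)) + (t (Suc m) (Suc m) + t (Suc (Suc m)) (Suc m))"
    unfolding Suc.IH ..
  finally show ?case by (simp add: ac_simps)
qed simp

text \<open>Here \<open>n\<close> counts the interior break points: the pieces are
  \<open>g 0\<close> to \<open>g n\<close>, the vertices \<open>u 0\<close> to
  \<open>u (Suc n)\<close>.\<close>

definition is_chain :: "nat \<Rightarrow> (nat \<Rightarrow> pt) \<Rightarrow> (nat \<Rightarrow> hex) \<Rightarrow> (nat \<Rightarrow> real \<Rightarrow> pt) \<Rightarrow> bool" where
  "is_chain n u H g \<longleftrightarrow> (\<forall>i\<le>n. piece (H i) (g i) \<and> g i 0 = u i \<and> g i 1 = u (Suc i))"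

definition flip_sum :: "nat \<Rightarrow> (nat \<Rightarrow> pt) \<Rightarrow> (nat \<Rightarrow> bit) \<Rightarrow> (pt \<Rightarrow> bit) \<Rightarrow> bit" where
  "flip_sum n u s \<phi> = (\<Sum>i<n. (s i + s (Suc i)) * \<phi> (u (Suc i)))"

abbreviation "y_flip H i \<equiv> fst (H i) + fst (H (Suc i)) :: bit"
abbreviation "z_flip H i \<equiv> snd (H i) + snd (H (Suc i)) :: bit"
abbreviation "y_flips n u H \<equiv> flip_sum n u (\<lambda>i. fst (H i))"
abbreviation "z_flips n u H \<equiv> flip_sum n u (\<lambda>i. snd (H i))"

text \<open>Collects what a chain contributes against one end \<open>v\<close> of another chain,
  with \<open>K\<close> the hexagon at that end. The last summand takes up the \<open>outl\<close>
  term of \<open>crossbit_sides\<close>, whose other factor telescopes to the ends of the other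
  chain.\<close>

definition tau :: "nat \<Rightarrow> (nat \<Rightarrow> pt) \<Rightarrow> (nat \<Rightarrow> hex) \<Rightarrow> (nat \<Rightarrow> real \<Rightarrow> pt) \<Rightarrow> pt \<Rightarrow> hex \<Rightarrow> bit" where
  "tau n u H g v K = (\<Sum>i\<le>n. samehex (H i) K * wind (g i) v)
     + (\<Sum>i<n. (samehex (H i) K + samehex (H (Suc i)) K) * crossbit (u (Suc i)) v)
     + fst K * z_flips n u H outl"

lemma sum_flip_bit: "(\<Sum>i<n. s i + s (Suc i)) = s 0 + (s n :: bit)"
  by (induction n) (simp_all add: ac_simps)

lemma chain_points:
  assumes "is_chain n u H g"
  shows "i \<le> n \<Longrightarrow> u i \<in> hexagon (H i)" "i \<le> n \<Longrightarrow> u (Suc i) \<in> hexagon (H i)"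
    "i \<le> n \<Longrightarrow> u i \<in> g i ` {0..1}" "i \<le> n \<Longrightarrow> u (Suc i) \<in> g i ` {0..1}"
proof -
  have *: "i \<le> n \<Longrightarrow> u i \<in> g i ` {0..1}" "i \<le> n \<Longrightarrow> u (Suc i) \<in> g i ` {0..1}" for i
  proof -
    have "(0::real) \<in> {0..1}" "(1::real) \<in> {0..1}" by auto
    then show "i \<le> n \<Longrightarrow> u i \<in> g i ` {0..1}" "i \<le> n \<Longrightarrow> u (Suc i) \<in> g i ` {0..1}"
      using assms unfolding is_chain_def by (metis imageI)+
  qed
  have "i \<le> n \<Longrightarrow> g i ` {0..1} \<subseteq> hexagon (H i)" for i
    using assms unfolding is_chain_def piece_def by blast
  then show "i \<le> n \<Longrightarrow> u i \<in> hexagon (H i)" "i \<le> n \<Longrightarrow> u (Suc i) \<in> hexagon (H i)"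
    "i \<le> n \<Longrightarrow> u i \<in> g i ` {0..1}" "i \<le> n \<Longrightarrow> u (Suc i) \<in> g i ` {0..1}"
    using * by blast+
qed

lemma hexagon_flip:
  assumes "p \<in> hexagon H" "p \<in> hexagon K"
  shows "fst H \<noteq> fst K \<Longrightarrow> fst (snd p) = 0" "snd H \<noteq> snd K \<Longrightarrow> snd (snd p) = 0"
proof -
  obtain x y z where p: "p = (x, y, z)" by (cases p)
  show "fst H \<noteq> fst K \<Longrightarrow> fst (snd p) = 0"
    using assms by (cases "fst H"; cases "fst K") (auto simp: hexagon_def p)
  show "snd H \<noteq> snd K \<Longrightarrow> snd (snd p) = 0"
    using assms by (cases "snd H"; cases "snd K") (auto simp: hexagon_def p)
qed

section \<open>Summing the parity relation over two disjoint chains\<close>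

locale disjoint_chains =
  fixes n :: nat and u H g and m :: nat and v K h
  assumes chu: "is_chain n u H g" and chv: "is_chain m v K h"
    and disj: "\<And>i j. i \<le> n \<Longrightarrow> j \<le> m \<Longrightarrow> g i ` {0..1} \<inter> h j ` {0..1} = {}"
begin

lemma flipped: "disjoint_chains m v K h n u H g"
  using chu chv disj by unfold_locales blast+

lemma piece_sum_zero:
  "(\<Sum>i\<le>n. \<Sum>j\<le>m. samehex (H i) (K j) *
      (crossbit (u i) (v j) + crossbit (u (Suc i)) (v j) + crossbit (u i) (v (Suc j)) + crossbit (u (Suc i)) (v (Suc j))
      + wind (g i) (v j) + wind (g i) (v (Suc j)) + wind (h j) (u i) + wind (h j) (u (Suc i)))) = 0"
proof (intro sum.neutral ballI)
  fix i j assume "i \<in> {..n}" "j \<in> {..m}"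
  then have ij: "i \<le> n" "j \<le> m" by auto
  have e: "g i 0 = u i" "g i 1 = u (Suc i)" "h j 0 = v j" "h j 1 = v (Suc j)" "piece (H i) (g i)" "piece (K j) (h j)"
    using chu chv ij by (auto simp: is_chain_def)
  show "samehex (H i) (K j) *
      (crossbit (u i) (v j) + crossbit (u (Suc i)) (v j) + crossbit (u i) (v (Suc j)) + crossbit (u (Suc i)) (v (Suc j))
      + wind (g i) (v j) + wind (g i) (v (Suc j)) + wind (h j) (u i) + wind (h j) (u (Suc i))) = 0"
  proof (cases "H i = K j")
    case True
    have "piece (H i) (h j)" using e True by simp
    from pieces_crossing_parity[OF e(5) this disj[OF ij]] show ?thesis
      unfolding e by (simp add: ac_simps)
  qed (simp add: samehex_def)
qed

text \<open>A break at which the hexagon changes belongs to both hexagons, hence to one of the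
  planes, and \<open>wind_bd\<close> applies.\<close>

lemma wind_break:
  assumes "i \<le> n" "j < m" "K j \<noteq> K (Suc j)" "L = K j \<or> L = K (Suc j)"
  shows "samehex (H i) L * wind (g i) (v (Suc j)) = 0"
proof (cases "H i = L")
  case True
  have v: "v (Suc j) \<in> hexagon (K j)" "v (Suc j) \<in> hexagon (K (Suc j))" "v (Suc j) \<in> h j ` {0..1}"
    using chain_points[OF chv] assms(2) by auto
  have bd: "v (Suc j) \<in> bd" using hexagon_flip[OF v(1,2)] assms(3)
    by (cases "v (Suc j)") (auto simp: bd_def prod_eq_iff)
  have "v (Suc j) \<notin> g i ` {0..1}" using disj[OF assms(1) less_imp_le[OF assms(2)]] v(3) by blast
  moreover have "piece L (g i)" using chu assms(1) True by (auto simp: is_chain_def)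
  moreover have "v (Suc j) \<in> hexagon L" using v assms(4) by auto
  ultimately have "wind (g i) (v (Suc j)) = 0" using wind_bd bd by blast
  then show ?thesis by simp
qed (simp add: samehex_def)

text \<open>At an interior break the two adjoining terms cancel if the hexagon stays the same, and
  each of them vanishes if it changes.\<close>

lemma wind_sum:
  "(\<Sum>i\<le>n. \<Sum>j\<le>m. samehex (H i) (K j) * (wind (g i) (v j) + wind (g i) (v (Suc j)))) =
   (\<Sum>i\<le>n. samehex (H i) (K 0) * wind (g i) (v 0)) + (\<Sum>i\<le>n. samehex (H i) (K m) * wind (g i) (v (Suc m)))"
proof -
  have "(\<Sum>j\<le>m. samehex (H i) (K j) * (wind (g i) (v j) + wind (g i) (v (Suc j)))) =
     samehex (H i) (K 0) * wind (g i) (v 0) + samehex (H i) (K m) * wind (g i) (v (Suc m))" if i: "i \<le> n" for i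
  proof -
    let ?t = "\<lambda>a b. samehex (H i) (K b) * wind (g i) (v a)"
    have "?t (Suc j) j + ?t (Suc j) (Suc j) = 0" if "j < m" for j
    proof (cases "K j = K (Suc j)")
      case False
      show ?thesis by (simp only: wind_break[OF i that False disjI1[OF refl]] wind_break[OF i that False disjI2[OF refl]] add_0_left)
    qed simp
    then have "(\<Sum>j<m. ?t (Suc j) j + ?t (Suc j) (Suc j)) = 0" by (intro sum.neutral) auto
    then show ?thesis using sum_by_parts_bit[of ?t m] by (simp add: distrib_left)
  qed
  then show ?thesis by (simp add: sum.distrib)
qed

lemma crossbit_vertex_commute:
  assumes "a \<in> hexagon L" "b \<in> hexagon L" "a \<in> g i ` {0..1}" "b \<in> h j ` {0..1}" "i \<le> n" "j \<le> m"
  shows "crossbit a b = 1 + crossbit b a"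
proof (rule crossbit_commute)
  have "a \<noteq> b" using disj[OF assms(5,6)] assms(3,4) by blast
  then show "chart a \<noteq> chart b" using inj_onD[OF chart_inj] assms(1,2) by blast
qed

text \<open>The flips place the two points on different planes, so \<open>crossbit_sides\<close>
  evaluates the bit. In the second product the points have exchanged roles, and antisymmetry
  contributes the summand 1.\<close>

lemma flip_flip:
  assumes i: "i < n" and j: "j < m"
  shows "(y_flip H i * z_flip K j
        + z_flip H i * y_flip K j) * crossbit (u (Suc i)) (v (Suc j))
    = y_flip H i * z_flip K j *
        (midbit (u (Suc i)) * lhole (v (Suc j)) + rightbit (u (Suc i)) * (lhole (v (Suc j)) + rhole (v (Suc j))) + outl (v (Suc j)))
    + z_flip H i * y_flip K j *
        (1 + midbit (v (Suc j)) * lhole (u (Suc i)) + rightbit (v (Suc j)) * (lhole (u (Suc i)) + rhole (u (Suc i))) + outl (u (Suc i)))"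
proof -
  let ?a = "u (Suc i)" and ?b = "v (Suc j)"
  have a: "?a \<in> hexagon (H i)" "?a \<in> hexagon (H (Suc i))" "?a \<in> g i ` {0..1}"
    using chain_points[OF chu] i by auto
  have b: "?b \<in> hexagon (K j)" "?b \<in> hexagon (K (Suc j))" "?b \<in> h j ` {0..1}"
    using chain_points[OF chv] j by auto
  have aS: "?a \<in> S2" "?b \<in> S2" using a(1) b(1) hexagon_subset by blast+
  have ne: "?a \<noteq> ?b" using disj[OF less_imp_le[OF i] less_imp_le[OF j]] a(3) b(3) by force
  \<comment> \<open>With one point on each plane, equal charts give equal y^2 and equal z^2, so y
    and z vanish at both points and the points coincide.\<close>
  have cn: "chart ?a \<noteq> chart ?b" if "fst (snd ?a) = 0 \<and> snd (snd ?b) = 0 \<or> fst (snd ?b) = 0 \<and> snd (snd ?a) = 0"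
  proof
    assume c: "chart ?a = chart ?b"
    obtain x y z where A: "?a = (x, y, z)" by (cases "?a")
    obtain x' y' z' where B: "?b = (x', y', z')" by (cases "?b")
    have x: "x' = x" and f: "ff ?a = ff ?b" using c by (auto simp: chart_def A B)
    have y: "y\<^sup>2 = y'\<^sup>2" using f x by (simp add: ff_def A B)
    have z: "z\<^sup>2 = z'\<^sup>2" using S2_z2[of x y z] S2_z2[of x' y' z'] aS f by (simp add: A B)
    have "y = 0 \<and> z' = 0 \<or> y' = 0 \<and> z = 0" using that by (simp add: A B)
    then have "y = 0 \<and> y' = 0 \<and> z = 0 \<and> z' = 0" using y z by auto
    then show False using ne x by (simp add: A B)
  qed
  have 1: "crossbit ?a ?b = midbit ?a * lhole ?b + rightbit ?a * (lhole ?b + rhole ?b) + outl ?b"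
    if "fst (H i) \<noteq> fst (H (Suc i))" "snd (K j) \<noteq> snd (K (Suc j))"
    using crossbit_sides[OF aS(1) _ aS(2)] hexagon_flip[OF a(1,2)] hexagon_flip[OF b(1,2)] that cn by blast
  have 2: "crossbit ?a ?b = 1 + midbit ?b * lhole ?a + rightbit ?b * (lhole ?a + rhole ?a) + outl ?a"
    if "snd (H i) \<noteq> snd (H (Suc i))" "fst (K j) \<noteq> fst (K (Suc j))"
  proof -
    have z: "snd (snd ?a) = 0" "fst (snd ?b) = 0"
      using hexagon_flip[OF a(1,2)] hexagon_flip[OF b(1,2)] that by blast+
    then have c: "chart ?a \<noteq> chart ?b" using cn by blast
    have "crossbit ?b ?a = midbit ?b * lhole ?a + rightbit ?b * (lhole ?a + rhole ?a) + outl ?a"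
      using crossbit_sides[OF aS(2) z(2) aS(1) z(1)] c by metis
    then show ?thesis using crossbit_commute[OF c] by (simp add: ac_simps)
  qed
  have d: "x + y = 0 \<or> (x + y = 1 \<and> x \<noteq> y)" for x y :: bit by (cases x; cases y) auto
  consider "fst (H i) + fst (H (Suc i)) = 0 \<or> snd (K j) + snd (K (Suc j)) = 0"
    | "fst (H i) + fst (H (Suc i)) = 1 \<and> fst (H i) \<noteq> fst (H (Suc i))" "snd (K j) + snd (K (Suc j)) = 1 \<and> snd (K j) \<noteq> snd (K (Suc j))"
    using d[of "fst (H i)"] d[of "snd (K j)"] by blast
  then have p1: "y_flip H i * z_flip K j * crossbit ?a ?b =
    y_flip H i * z_flip K j * (midbit ?a * lhole ?b + rightbit ?a * (lhole ?b + rhole ?b) + outl ?b)"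
    by cases (use 1 in auto)
  consider "snd (H i) + snd (H (Suc i)) = 0 \<or> fst (K j) + fst (K (Suc j)) = 0"
    | "snd (H i) + snd (H (Suc i)) = 1 \<and> snd (H i) \<noteq> snd (H (Suc i))" "fst (K j) + fst (K (Suc j)) = 1 \<and> fst (K j) \<noteq> fst (K (Suc j))"
    using d[of "snd (H i)"] d[of "fst (K j)"] by blast
  then have p2: "z_flip H i * y_flip K j * crossbit ?a ?b =
    z_flip H i * y_flip K j * (1 + midbit ?b * lhole ?a + rightbit ?b * (lhole ?a + rhole ?a) + outl ?a)"
    by cases (use 2 in auto)
  show ?thesis unfolding distrib_right[of _ _ "crossbit ?a ?b"] p1 p2 ..
qed

text \<open>Each summand is a factor at \<open>i\<close> times a factor at \<open>j\<close>, so the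
  double sum splits into products, and unweighted flips telescope to the ends. The products with
  \<open>midbit\<close> and \<open>rightbit\<close> will form the symplectic form; those with
  \<open>outl\<close> go into \<open>tau\<close>.\<close>

lemma flip_flip_sum:
  "(\<Sum>i<n. \<Sum>j<m. (y_flip H i * z_flip K j
        + z_flip H i * y_flip K j) * crossbit (u (Suc i)) (v (Suc j)))
   = y_flips n u H midbit * z_flips m v K lhole
   + y_flips n u H rightbit * (z_flips m v K lhole + z_flips m v K rhole)
   + (fst (H 0) + fst (H n)) * z_flips m v K outl
   + (snd (H 0) + snd (H n)) * (fst (K 0) + fst (K m))
   + y_flips m v K midbit * z_flips n u H lhole
   + y_flips m v K rightbit * (z_flips n u H lhole + z_flips n u H rhole)
   + (fst (K 0) + fst (K m)) * z_flips n u H outl"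
  (is "?L = ?R")
proof -
  let ?y = "\<lambda>i. y_flip H i" and ?z = "\<lambda>i. z_flip H i" and ?y' = "\<lambda>j. y_flip K j" and ?z' = "\<lambda>j. z_flip K j"
  let ?a = "\<lambda>i. u (Suc i)" and ?b = "\<lambda>j. v (Suc j)"
  have "?L = (\<Sum>i<n. \<Sum>j<m.
      (?y i * midbit (?a i)) * (?z' j * lhole (?b j)) + (?y i * rightbit (?a i)) * (?z' j * lhole (?b j))
    + (?y i * rightbit (?a i)) * (?z' j * rhole (?b j)) + ?y i * (?z' j * outl (?b j))
    + ?z i * ?y' j + (?z i * lhole (?a i)) * (?y' j * midbit (?b j)) + (?z i * lhole (?a i)) * (?y' j * rightbit (?b j))
    + (?z i * rhole (?a i)) * (?y' j * rightbit (?b j)) + (?z i * outl (?a i)) * ?y' j)"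
    by (intro sum.cong refl) (subst flip_flip, simp_all only: lessThan_iff, simp only: distrib_left distrib_right ac_simps mult_1_left)
  also have "\<dots> = y_flips n u H midbit * z_flips m v K lhole
   + y_flips n u H rightbit * z_flips m v K lhole
   + y_flips n u H rightbit * z_flips m v K rhole
   + (\<Sum>i<n. ?y i) * z_flips m v K outl
   + (\<Sum>i<n. ?z i) * (\<Sum>j<m. ?y' j)
   + z_flips n u H lhole * y_flips m v K midbit
   + z_flips n u H lhole * y_flips m v K rightbit
   + z_flips n u H rhole * y_flips m v K rightbit
   + z_flips n u H outl * (\<Sum>j<m. ?y' j)"
    unfolding flip_sum_def sum_product by (simp only: sum.distrib)
  also have "\<dots> = ?R"
    unfolding sum_flip_bit[of "\<lambda>i. fst (H i)"] sum_flip_bit[of "\<lambda>i. snd (H i)"] sum_flip_bit[of "\<lambda>j. fst (K j)"]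
    by (simp only: distrib_left distrib_right ac_simps)
  finally show ?thesis .
qed

text \<open>Summation by parts in both chains; a pair of interior breaks then carries a mixed second
  difference of \<open>samehex\<close>.\<close>

lemma crossbit_sum:
  "(\<Sum>i\<le>n. \<Sum>j\<le>m. samehex (H i) (K j) *
      (crossbit (u i) (v j) + crossbit (u (Suc i)) (v j) + crossbit (u i) (v (Suc j)) + crossbit (u (Suc i)) (v (Suc j))))
   = samehex (H 0) (K 0) * crossbit (u 0) (v 0) + samehex (H n) (K 0) * crossbit (u (Suc n)) (v 0)
   + samehex (H 0) (K m) * crossbit (u 0) (v (Suc m)) + samehex (H n) (K m) * crossbit (u (Suc n)) (v (Suc m))
   + (\<Sum>i<n. (samehex (H i) (K 0) + samehex (H (Suc i)) (K 0)) * crossbit (u (Suc i)) (v 0))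
   + (\<Sum>i<n. (samehex (H i) (K m) + samehex (H (Suc i)) (K m)) * crossbit (u (Suc i)) (v (Suc m)))
   + (\<Sum>j<m. (samehex (H 0) (K j) + samehex (H 0) (K (Suc j))) * crossbit (u 0) (v (Suc j)))
   + (\<Sum>j<m. (samehex (H n) (K j) + samehex (H n) (K (Suc j))) * crossbit (u (Suc n)) (v (Suc j)))
   + (\<Sum>i<n. \<Sum>j<m. (y_flip H i * z_flip K j
        + z_flip H i * y_flip K j) * crossbit (u (Suc i)) (v (Suc j)))"
proof -
  define B where "B q L = samehex (H 0) L * crossbit (u 0) q + samehex (H n) L * crossbit (u (Suc n)) q
     + (\<Sum>i<n. (samehex (H i) L + samehex (H (Suc i)) L) * crossbit (u (Suc i)) q)" for q L
  have B: "(\<Sum>i\<le>n. samehex (H i) L * (crossbit (u i) q + crossbit (u (Suc i)) q)) = B q L" for q L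
    using sum_by_parts_bit[of "\<lambda>a b. samehex (H b) L * crossbit (u a) q" n]
    by (simp add: B_def distrib_left distrib_right)
  have "(\<Sum>i\<le>n. \<Sum>j\<le>m. samehex (H i) (K j) *
      (crossbit (u i) (v j) + crossbit (u (Suc i)) (v j) + crossbit (u i) (v (Suc j)) + crossbit (u (Suc i)) (v (Suc j))))
    = (\<Sum>j\<le>m. \<Sum>i\<le>n. samehex (H i) (K j) *
      (crossbit (u i) (v j) + crossbit (u (Suc i)) (v j) + crossbit (u i) (v (Suc j)) + crossbit (u (Suc i)) (v (Suc j))))"
    by (rule sum.swap)
  also have "\<dots> = (\<Sum>j\<le>m. B (v j) (K j) + B (v (Suc j)) (K j))"
    unfolding B[symmetric] sum.distrib[symmetric] by (intro sum.cong refl) (simp only: distrib_left ac_simps)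
  also have "\<dots> = B (v 0) (K 0) + B (v (Suc m)) (K m) + (\<Sum>j<m. B (v (Suc j)) (K j) + B (v (Suc j)) (K (Suc j)))"
    by (rule sum_by_parts_bit[of "\<lambda>a b. B (v a) (K b)"])
  also have "(\<Sum>j<m. B (v (Suc j)) (K j) + B (v (Suc j)) (K (Suc j))) =
     (\<Sum>j<m. (samehex (H 0) (K j) + samehex (H 0) (K (Suc j))) * crossbit (u 0) (v (Suc j))
      + (samehex (H n) (K j) + samehex (H n) (K (Suc j))) * crossbit (u (Suc n)) (v (Suc j))
      + (\<Sum>i<n. (y_flip H i * z_flip K j
        + z_flip H i * y_flip K j) * crossbit (u (Suc i)) (v (Suc j))))"
    unfolding B_def samehex_four[symmetric]
    by (intro sum.cong refl) (simp only: distrib_right distrib_left sum.distrib ac_simps)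
  finally show ?thesis
    unfolding B_def sum.swap[of _ "{..<m}" "{..<n}"] by (simp only: sum.distrib ac_simps)
qed

text \<open>Where the coefficient is nonzero, \<open>a\<close> and the break share a hexagon, so the
  arguments of \<open>crossbit\<close> can be put in the order used in \<open>tau\<close>.\<close>

lemma break_commute:
  assumes a: "a \<in> hexagon L" "a \<in> g i ` {0..1}" "i \<le> n" and j: "j < m"
  shows "(samehex L (K j) + samehex L (K (Suc j))) * crossbit a (v (Suc j)) =
         (samehex L (K j) + samehex L (K (Suc j))) + (samehex (K j) L + samehex (K (Suc j)) L) * crossbit (v (Suc j)) a"
proof (cases "samehex L (K j) + samehex L (K (Suc j)) = 0")
  case False
  then have "L = K j \<or> L = K (Suc j)" by (auto simp: samehex_def split: if_splits)
  moreover have "v (Suc j) \<in> hexagon (K j)" "v (Suc j) \<in> hexagon (K (Suc j))" "v (Suc j) \<in> h j ` {0..1}"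
    using chain_points[OF chv] j by auto
  ultimately have "crossbit a (v (Suc j)) = 1 + crossbit (v (Suc j)) a"
    using crossbit_vertex_commute[OF a(1) _ a(2) _ a(3), of "v (Suc j)" j] j by auto
  then show ?thesis by (simp add: samehex_commute distrib_left)
qed (simp add: samehex_commute)

lemma break_sum_commute:
  assumes a: "a \<in> hexagon L" "a \<in> g i ` {0..1}" "i \<le> n"
  shows "(\<Sum>j<m. (samehex L (K j) + samehex L (K (Suc j))) * crossbit a (v (Suc j))) =
         samehex L (K 0) + samehex L (K m) + (\<Sum>j<m. (samehex (K j) L + samehex (K (Suc j)) L) * crossbit (v (Suc j)) a)"
  using break_commute[OF a] sum_flip_bit[of "\<lambda>j. samehex L (K j)" m] by (simp add: sum.distrib)

end

text \<open>The summand 1 is left over from the exchange in \<open>break_sum_commute\<close>, the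
  product \<open>snd P * fst Q\<close> from the flips that telescope to the ends.\<close>

definition vertex_term :: "pt \<Rightarrow> hex \<Rightarrow> pt \<Rightarrow> hex \<Rightarrow> bit" where
  "vertex_term p P q Q = samehex P Q * (1 + crossbit p q) + snd P * fst Q"

lemma (in disjoint_chains) chain_parity:
  shows "y_flips n u H midbit * z_flips m v K lhole
   + y_flips m v K midbit * z_flips n u H lhole
   + y_flips n u H rightbit * (z_flips m v K lhole + z_flips m v K rhole)
   + y_flips m v K rightbit * (z_flips n u H lhole + z_flips n u H rhole)
   + tau n u H g (v 0) (K 0) + tau n u H g (v (Suc m)) (K m)
   + tau m v K h (u 0) (H 0) + tau m v K h (u (Suc n)) (H n)
   + vertex_term (u 0) (H 0) (v 0) (K 0) + vertex_term (u 0) (H 0) (v (Suc m)) (K m)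
   + vertex_term (u (Suc n)) (H n) (v 0) (K 0) + vertex_term (u (Suc n)) (H n) (v (Suc m)) (K m) = 0"
proof -
  interpret fl: disjoint_chains m v K h n u H g by (rule flipped)
  have split: "(\<Sum>i\<le>n. \<Sum>j\<le>m. samehex (H i) (K j) *
      (crossbit (u i) (v j) + crossbit (u (Suc i)) (v j) + crossbit (u i) (v (Suc j)) + crossbit (u (Suc i)) (v (Suc j))))
    + (\<Sum>i\<le>n. \<Sum>j\<le>m. samehex (H i) (K j) * (wind (g i) (v j) + wind (g i) (v (Suc j))))
    + (\<Sum>j\<le>m. \<Sum>i\<le>n. samehex (K j) (H i) * (wind (h j) (u i) + wind (h j) (u (Suc i)))) = 0"
  proof -
    have "(\<Sum>j\<le>m. \<Sum>i\<le>n. samehex (K j) (H i) * (wind (h j) (u i) + wind (h j) (u (Suc i))))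
       = (\<Sum>i\<le>n. \<Sum>j\<le>m. samehex (H i) (K j) * (wind (h j) (u i) + wind (h j) (u (Suc i))))"
      by (subst sum.swap) (simp only: samehex_commute)
    then show ?thesis using piece_sum_zero by (simp only: distrib_left sum.distrib ac_simps)
  qed
  have p: "u 0 \<in> hexagon (H 0)" "u 0 \<in> g 0 ` {0..1}" "u (Suc n) \<in> hexagon (H n)" "u (Suc n) \<in> g n ` {0..1}"
    using chain_points[OF chu] by auto
  show ?thesis
    using split
    unfolding crossbit_sum wind_sum fl.wind_sum flip_flip_sum
      break_sum_commute[OF p(1,2) le0] break_sum_commute[OF p(3,4) order_refl]
      tau_def vertex_term_def
    by (simp add: distrib_left distrib_right samehex_commute ac_simps)
qed

section \<open>Approximation by chains\<close>

definition sg :: "bit \<Rightarrow> real" where "sg b = (if b = 0 then 1 else -1)"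

definition wave :: "real \<Rightarrow> real" where "wave x = x^4 - x\<^sup>2"

text \<open>Inverse of the chart on the hexagon \<open>H\<close>. Since the real \<open>sqrt\<close>
  is continuous everywhere, \<open>lift\<close> is continuous even off the image of the
  chart.\<close>

definition lift :: "hex \<Rightarrow> real \<times> real \<Rightarrow> pt" where
  "lift H q = (fst q, sg (fst H) * sqrt (snd q - wave (fst q)), sg (snd H) * sqrt (1/100 - (snd q)\<^sup>2))"

lemma continuous_on_lift: "continuous_on A (lift H)"
  unfolding lift_def wave_def by (intro continuous_intros)

lemma sq_le_hundredth: "\<bar>F\<bar> \<le> 1/10 \<Longrightarrow> F\<^sup>2 \<le> (1/100::real)"
  using power_mono[of "\<bar>F\<bar>" "1/10" 2] by (simp add: power_divide)

lemma lift_in_hexagon: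
  assumes "wave x \<le> F" "\<bar>F\<bar> \<le> 1/10" shows "lift H (x, F) \<in> hexagon H"
  using assms sq_le_hundredth[OF assms(2)]
  by (auto simp: lift_def hexagon_def S2_iff ff_def sg_def wave_def real_sqrt_pow2 power_mult_distrib)

lemma ff_lift: "wave x \<le> F \<Longrightarrow> ff (lift H (x, F)) = F"
  by (auto simp: lift_def ff_def sg_def wave_def real_sqrt_pow2 power_mult_distrib)

lemma wave_le_ff: "p \<in> S2 \<Longrightarrow> wave (fst p) \<le> ff p"
  by (cases p) (simp add: ff_def wave_def)

lemma lift_chart:
  assumes "p \<in> hexagon H" shows "lift H (fst p, ff p) = p"
proof -
  obtain x y z where p: "p = (x, y, z)" by (cases p)
  have S: "p \<in> S2" using assms hexagon_subset by blast
  have "ff p - wave x = y\<^sup>2" by (simp add: ff_def wave_def p)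
  moreover have "1/100 - (ff p)\<^sup>2 = z\<^sup>2" using S2_z2[of x y z] S by (simp add: p)
  ultimately show ?thesis using assms
    by (auto simp: lift_def sg_def p hexagon_def split: if_splits)
qed

text \<open>Where \<open>wave\<close> is positive it increases with |x|, so the x with
  \<open>wave x \<le> 1/10\<close> form an interval.\<close>

lemma wave_bound_segment:
  assumes "wave a \<le> 1/10" "wave b \<le> 1/10" "x \<in> closed_segment a b"
  shows "wave x \<le> 1/10"
proof -
  have w: "wave t = t\<^sup>2 * (t\<^sup>2 - 1)" for t by (simp add: wave_def algebra_simps flip: power_add)
  have "\<bar>x\<bar> \<le> \<bar>a\<bar> \<or> \<bar>x\<bar> \<le> \<bar>b\<bar>" using assms(3) by (auto simp: closed_segment_eq_real_ivl split: if_splits)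
  then obtain c where c: "x\<^sup>2 \<le> c\<^sup>2" "wave c \<le> 1/10" using assms(1,2) by (auto simp: abs_le_square_iff)
  show ?thesis
  proof (cases "x\<^sup>2 \<le> 1")
    case True
    then have "x\<^sup>2 * (x\<^sup>2 - 1) \<le> 0" by (intro mult_nonneg_nonpos) auto
    then show ?thesis unfolding w by simp
  next
    case False
    then have "x\<^sup>2 * (x\<^sup>2 - 1) \<le> c\<^sup>2 * (c\<^sup>2 - 1)" using c(1) by (intro mult_mono) auto
    then show ?thesis using c(2) unfolding w by simp
  qed
qed

text \<open>Near \<open>p\<close> a nonzero coordinate y or z keeps its sign, and a zero coordinate
  of \<open>p\<close> suits either sign.\<close>

lemma common_hexagon:
  assumes "p \<in> S2"
  obtains \<delta> where "0 < \<delta>" "\<And>q. q \<in> S2 \<Longrightarrow> dist q p < \<delta> \<Longrightarrow> \<exists>L. p \<in> hexagon L \<and> q \<in> hexagon L"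
proof -
  obtain x y z where p: "p = (x, y, z)" by (cases p)
  define \<delta> where "\<delta> = min (if y = 0 then 1 else \<bar>y\<bar>) (if z = 0 then 1 else \<bar>z\<bar>)"
  have "\<exists>L. p \<in> hexagon L \<and> q \<in> hexagon L" if q: "q \<in> S2" "dist q p < \<delta>" for q
  proof -
    obtain x' y' z' where qe: "q = (x', y', z')" by (cases q)
    have "dist y' y \<le> dist q p" "dist z' z \<le> dist q p"
      using dist_snd_le[of q p] dist_fst_le[of "snd q" "snd p"] dist_snd_le[of "snd q" "snd p"] by (auto simp: p qe)
    then have d: "\<bar>y' - y\<bar> < \<delta>" "\<bar>z' - z\<bar> < \<delta>" using q(2) by (auto simp: dist_real_def)
    define b where "b u u' = (if 0 \<le> u \<and> 0 \<le> u' then 0 else 1::bit)" for u u' :: real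
    have "0 \<le> y \<and> 0 \<le> y' \<or> y \<le> 0 \<and> y' \<le> 0" using d(1) by (auto simp: \<delta>_def split: if_splits)
    moreover have "0 \<le> z \<and> 0 \<le> z' \<or> z \<le> 0 \<and> z' \<le> 0" using d(2) by (auto simp: \<delta>_def split: if_splits)
    ultimately have "p \<in> hexagon (b y y', b z z') \<and> q \<in> hexagon (b y y', b z z')"
      using assms q(1) by (auto simp: hexagon_def p qe b_def)
    then show ?thesis by blast
  qed
  moreover have "0 < \<delta>" by (simp add: \<delta>_def)
  ultimately show ?thesis using that by blast
qed

text \<open>The segment between two chart points may fall below the graph of \<open>wave\<close>,
  because the image of the hexagon is not convex. Raising F to \<open>wave x\<close> where necessary
  gives a path in the hexagon, and continuity of this correction keeps the path near
  \<open>p\<close>.\<close>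

lemma hexagon_locally_connected:
  assumes p: "p \<in> hexagon H" and e: "0 < \<epsilon>"
  obtains \<delta> where "0 < \<delta>"
    "\<And>q. q \<in> hexagon H \<Longrightarrow> dist q p < \<delta> \<Longrightarrow> \<exists>g. piece H g \<and> g 0 = q \<and> g 1 = p \<and> g ` {0..1} \<subseteq> ball p \<epsilon>"
proof -
  let ?\<Phi> = "\<lambda>a::real \<times> real. lift H (fst a, max (snd a) (wave (fst a)))"
  let ?c = "\<lambda>q. (fst q, ff q)"
  have c\<Phi>: "continuous_on UNIV ?\<Phi>"
    by (intro continuous_on_compose2[OF continuous_on_lift[of UNIV H]]) (auto simp: wave_def intro!: continuous_intros)
  have \<Phi>: "?\<Phi> (?c q) = q" if "q \<in> hexagon H" for q
  proof -
    have "wave (fst q) \<le> ff q" using wave_le_ff that hexagon_subset by blast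
    then show ?thesis using lift_chart[OF that] by (simp add: max_absorb1)
  qed
  have "?\<Phi> (?c p) = p" using \<Phi> p by simp
  moreover have "isCont ?\<Phi> (?c p)" using c\<Phi> by (simp add: continuous_on_eq_continuous_at)
  ultimately obtain \<eta> where \<eta>: "0 < \<eta>" "\<And>a. dist a (?c p) < \<eta> \<Longrightarrow> dist (?\<Phi> a) p < \<epsilon>"
    using e unfolding continuous_at_eps_delta by (metis (lifting))
  have "isCont ?c p"
  proof -
    have "isCont ff p" using continuous_ff[of UNIV] continuous_on_eq_continuous_at[of UNIV ff] by blast
    then show ?thesis by (intro continuous_intros)
  qed
  then obtain \<delta> where \<delta>: "0 < \<delta>" "\<And>q. dist q p < \<delta> \<Longrightarrow> dist (?c q) (?c p) < \<eta>"
    using \<eta>(1) unfolding continuous_at_eps_delta by (metis (lifting))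
  have "\<exists>g. piece H g \<and> g 0 = q \<and> g 1 = p \<and> g ` {0..1} \<subseteq> ball p \<epsilon>" if q: "q \<in> hexagon H" "dist q p < \<delta>" for q
  proof -
    let ?l = "linepath (?c q) (?c p)"
    let ?g = "\<lambda>s. ?\<Phi> (?l s)"
    have "continuous_on {0..1} ?g"
      by (rule continuous_on_compose2[OF c\<Phi>]) (auto intro!: continuous_intros)
    moreover have "?g s \<in> hexagon H \<and> dist (?g s) p < \<epsilon>" if s: "s \<in> {0..1}" for s
    proof
      have l: "?l s = ((1 - s) * fst q + s * fst p, (1 - s) * ff q + s * ff p)"
        by (simp add: linepath_def)
      have S: "p \<in> S2" "q \<in> S2" using p q hexagon_subset by blast+
      have "wave (fst p) \<le> 1/10" "wave (fst q) \<le> 1/10"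
        using wave_le_ff S S2_ff_bound by (meson abs_le_D1 order_trans)+
      moreover have "fst (?l s) \<in> closed_segment (fst q) (fst p)"
        using s unfolding l closed_segment_def by auto
      ultimately have w: "wave (fst (?l s)) \<le> 1/10" using wave_bound_segment by blast
      have "snd (?l s) \<in> closed_segment (ff q) (ff p)"
        using s unfolding l closed_segment_def by auto
      moreover have "closed_segment (ff q) (ff p) \<subseteq> {- (1/10)..1/10}"
        using S2_ff_bound[OF S(1)] S2_ff_bound[OF S(2)] by (intro closed_segment_subset) (auto simp: abs_le_iff)
      ultimately have "snd (?l s) \<in> {- (1/10)..1/10}" by blast
      then have "\<bar>snd (?l s)\<bar> \<le> 1/10" unfolding atLeastAtMost_iff by linarith
      then show "?g s \<in> hexagon H" using w by (intro lift_in_hexagon) auto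
      have "?l s \<in> closed_segment (?c q) (?c p)" using s by (auto simp: linepath_in_path)
      moreover have "closed_segment (?c q) (?c p) \<subseteq> ball (?c p) \<eta>"
        using \<delta>(2)[OF q(2)] \<eta>(1) by (intro closed_segment_subset) (auto simp: dist_commute)
      ultimately show "dist (?g s) p < \<epsilon>" using \<eta>(2) by (auto simp: dist_commute)
    qed
    moreover have "?g 0 = q" "?g 1 = p" using \<Phi> p q by (simp_all add: linepath_def)
    ultimately show ?thesis by (intro exI[of _ ?g]) (auto simp: piece_def dist_commute)
  qed
  then show ?thesis using \<delta>(1) that by blast
qed

lemma S2_locally_connected:
  assumes p: "p \<in> S2" and e: "0 < \<epsilon>"
  obtains \<delta> where "0 < \<delta>"
    "\<And>q. q \<in> S2 \<Longrightarrow> dist q p < \<delta> \<Longrightarrow> \<exists>H g. piece H g \<and> g 0 = q \<and> g 1 = p \<and> g ` {0..1} \<subseteq> ball p \<epsilon>"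
proof -
  obtain \<delta>0 where \<delta>0: "0 < \<delta>0" "\<And>q. q \<in> S2 \<Longrightarrow> dist q p < \<delta>0 \<Longrightarrow> \<exists>L. p \<in> hexagon L \<and> q \<in> hexagon L"
    using common_hexagon[OF p] by blast
  have "\<forall>H. \<exists>\<delta>>0. p \<in> hexagon H \<longrightarrow> (\<forall>q\<in>hexagon H. dist q p < \<delta> \<longrightarrow>
      (\<exists>g. piece H g \<and> g 0 = q \<and> g 1 = p \<and> g ` {0..1} \<subseteq> ball p \<epsilon>))"
    using hexagon_locally_connected[OF _ e] by (metis zero_less_one)
  then obtain d where d: "\<And>H. 0 < d H" "\<And>H q. p \<in> hexagon H \<Longrightarrow> q \<in> hexagon H \<Longrightarrow> dist q p < d H \<Longrightarrow>
      \<exists>g. piece H g \<and> g 0 = q \<and> g 1 = p \<and> g ` {0..1} \<subseteq> ball p \<epsilon>" by metis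
  have fin: "finite (UNIV :: (hex) set)"
  proof -
    have "(UNIV :: bit set) \<subseteq> {0, 1}" using bit_not_one_iff by blast
    then have "finite (UNIV :: bit set)" using finite_subset by blast
    then show ?thesis by (simp add: finite_prod)
  qed
  define \<delta> where "\<delta> = min \<delta>0 (Min (range d))"
  have "0 < Min (range d)" using fin d(1) by (subst Min_gr_iff) auto
  then have "0 < \<delta>" using \<delta>0(1) by (simp add: \<delta>_def)
  moreover have "\<exists>H g. piece H g \<and> g 0 = q \<and> g 1 = p \<and> g ` {0..1} \<subseteq> ball p \<epsilon>" if q: "q \<in> S2" "dist q p < \<delta>" for q
  proof -
    have "dist q p < \<delta>0" using q(2) by (simp add: \<delta>_def)
    then obtain L where L: "p \<in> hexagon L" "q \<in> hexagon L" using \<delta>0(2)[OF q(1)] by blast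
    have "Min (range d) \<le> d L" using fin by (intro Min_le) auto
    then have "dist q p < d L" using q(2) by (simp add: \<delta>_def)
    then show ?thesis using d(2)[OF L] by blast
  qed
  ultimately show ?thesis using that by blast
qed

text \<open>Chains inside \<open>U\<close>, built piece by piece; the two hexagons are those of the
  first and the last piece.\<close>

inductive reach :: "pt set \<Rightarrow> pt \<Rightarrow> hex \<Rightarrow> pt \<Rightarrow> hex \<Rightarrow> bool" for U p H where
  start: "p \<in> hexagon H \<Longrightarrow> p \<in> U \<Longrightarrow> reach U p H p H"
| step: "reach U p H q K \<Longrightarrow> piece L g \<Longrightarrow> g ` {0..1} \<subseteq> U \<Longrightarrow> g 0 = q \<Longrightarrow> reach U p H (g 1) L"

lemma reach_chain:
  assumes "reach U p H q K"
  shows "\<exists>n u Hs g. is_chain n u Hs g \<and> u 0 = p \<and> Hs 0 = H \<and> u (Suc n) = q \<and> Hs n = K \<and> (\<forall>i\<le>n. g i ` {0..1} \<subseteq> U)"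
  using assms
proof induction
  case start
  have "is_chain 0 (\<lambda>_. p) (\<lambda>_. H) (\<lambda>_ _. p)"
    using start by (auto simp: is_chain_def piece_def)
  then show ?case using start by (intro exI[of _ 0] exI[of _ "\<lambda>_. p"] exI[of _ "\<lambda>_. H"] exI[of _ "\<lambda>_ _. p"]) auto
next
  case (step q K L g)
  then obtain n u Hs gs where c: "is_chain n u Hs gs" "u 0 = p" "Hs 0 = H" "u (Suc n) = q" "Hs n = K"
    "\<forall>i\<le>n. gs i ` {0..1} \<subseteq> U" by blast
  have "is_chain (Suc n) (u(Suc (Suc n) := g 1)) (Hs(Suc n := L)) (gs(Suc n := g))"
    unfolding is_chain_def
  proof (intro allI impI)
    fix i assume "i \<le> Suc n"
    then consider "i = Suc n" | "i \<le> n" by linarith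
    then show "piece ((Hs(Suc n := L)) i) ((gs(Suc n := g)) i) \<and>
         (gs(Suc n := g)) i 0 = (u(Suc (Suc n) := g 1)) i \<and> (gs(Suc n := g)) i 1 = (u(Suc (Suc n) := g 1)) (Suc i)"
      by cases (use c step.hyps in \<open>auto simp: is_chain_def\<close>)
  qed
  moreover have "(gs(Suc n := g)) i ` {0..1} \<subseteq> U" if "i \<le> Suc n" for i
    using c(6) step.hyps(3) that by (cases "i = Suc n") auto
  moreover have "(u(Suc (Suc n) := g 1)) 0 = p" "(Hs(Suc n := L)) 0 = H"
    "(u(Suc (Suc n) := g 1)) (Suc (Suc n)) = g 1" "(Hs(Suc n := L)) (Suc n) = L" using c(2,3) by auto
  ultimately show ?case by blast
qed

lemma piece_reverse: "piece H g \<Longrightarrow> piece H (\<lambda>s. g (1 - s))"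
  unfolding piece_def by (auto intro!: continuous_on_compose2[of "{0..1}" g] continuous_intros)

text \<open>Induction along the connected parameter interval: every curve point near
  \<open>\<gamma> a\<close> is joined to it by a short piece, so reachability passes from one such
  point to another through \<open>\<gamma> a\<close>. Constant pieces change the hexagon at a
  point.\<close>

lemma chain_approximation:
  fixes \<gamma> :: "real \<Rightarrow> pt"
  assumes \<gamma>: "continuous_on {0..1} \<gamma>" "\<gamma> ` {0..1} \<subseteq> S2" and e: "0 < \<epsilon>"
    and ends: "\<gamma> 0 \<in> hexagon H" "\<gamma> 1 \<in> hexagon K"
  obtains n u Hs g where "is_chain n u Hs g" "u 0 = \<gamma> 0" "Hs 0 = H" "u (Suc n) = \<gamma> 1" "Hs n = K"
    "\<And>i s. i \<le> n \<Longrightarrow> s \<in> {0..1} \<Longrightarrow> \<exists>t\<in>{0..1}. dist (g i s) (\<gamma> t) < \<epsilon>"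
proof -
  define U where "U = (\<Union>t\<in>{0..1}. ball (\<gamma> t) \<epsilon>)"
  let ?P = "\<lambda>t. \<forall>L. \<gamma> t \<in> hexagon L \<longrightarrow> reach U (\<gamma> 0) H (\<gamma> t) L"
  have U: "ball (\<gamma> t) \<epsilon> \<subseteq> U" if "t \<in> {0..1}" for t using that by (auto simp: U_def)
  have gU: "\<gamma> t \<in> U" if "t \<in> {0..1}" for t using U[OF that] e by (meson centre_in_ball subsetD)
  have change: "reach U p M q L" if "reach U p M q L'" "q \<in> hexagon L" "q \<in> U" for p M q L L'
    using reach.step[OF that(1), of L "\<lambda>_. q"] that(2,3) by (auto simp: piece_def)
  have "?P 1"
  proof (rule connected_induction_simple[of "{0..1::real}" 0 1 ?P])
    show "?P 0"
    proof (intro allI impI)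
      fix L assume L: "\<gamma> 0 \<in> hexagon L"
      show "reach U (\<gamma> 0) H (\<gamma> 0) L"
        by (rule change[OF reach.start]) (use ends gU[of 0] L in auto)
    qed
    fix a :: real assume a: "a \<in> {0..1}"
    obtain \<delta> where \<delta>: "0 < \<delta>" "\<And>q. q \<in> S2 \<Longrightarrow> dist q (\<gamma> a) < \<delta> \<Longrightarrow>
        \<exists>H g. piece H g \<and> g 0 = q \<and> g 1 = \<gamma> a \<and> g ` {0..1} \<subseteq> ball (\<gamma> a) \<epsilon>"
      using S2_locally_connected[OF _ e, of "\<gamma> a"] a \<gamma>(2) by (metis image_subset_iff)
    let ?T = "{0..1} \<inter> \<gamma> -` ball (\<gamma> a) \<delta>"
    have "openin (top_of_set {0..1}) ?T" using continuous_openin_preimage_gen[OF \<gamma>(1) open_ball] .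
    moreover have "a \<in> ?T" using a \<delta>(1) by simp
    moreover have "?P y" if x: "x \<in> ?T" "?P x" and y: "y \<in> ?T" for x y
    proof (intro allI impI)
      fix L assume L: "\<gamma> y \<in> hexagon L"
      have xS: "\<gamma> x \<in> S2" "\<gamma> y \<in> S2" using x y \<gamma>(2) by auto
      obtain M g where g: "piece M g" "g 0 = \<gamma> x" "g 1 = \<gamma> a" "g ` {0..1} \<subseteq> ball (\<gamma> a) \<epsilon>"
        using \<delta>(2)[OF xS(1)] x(1) by (auto simp: dist_commute)
      obtain N h where h: "piece N h" "h 0 = \<gamma> y" "h 1 = \<gamma> a" "h ` {0..1} \<subseteq> ball (\<gamma> a) \<epsilon>"
        using \<delta>(2)[OF xS(2)] y by (auto simp: dist_commute)
      have "(0::real) \<in> {0..1}" by simp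
      then have "\<gamma> x \<in> hexagon M" using g(1,2) unfolding piece_def by (metis image_subset_iff)
      then have "reach U (\<gamma> 0) H (\<gamma> x) M" using x(2) by blast
      then have "reach U (\<gamma> 0) H (g 1) M"
        by (rule reach.step[OF _ g(1) _ g(2)]) (use g(4) U[OF a] in blast)
      moreover have "(\<lambda>s. h (1 - s)) ` {0..1} \<subseteq> U"
      proof -
        have "(\<lambda>s. h (1 - s)) ` {0..1} \<subseteq> h ` {0..1}" by auto
        then show ?thesis using h(4) U[OF a] by blast
      qed
      ultimately have "reach U (\<gamma> 0) H ((\<lambda>s. h (1 - s)) 1) N"
        using reach.step[OF _ piece_reverse[OF h(1)], of U "\<gamma> 0" H "g 1"] g(3) h(3) by simp
      then have "reach U (\<gamma> 0) H (\<gamma> y) N" using h(2) by simp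
      then show "reach U (\<gamma> 0) H (\<gamma> y) L" using change L gU y by auto
    qed
    ultimately show "\<exists>T. openin (top_of_set {0..1}) T \<and> a \<in> T \<and> (\<forall>x\<in>T. \<forall>y\<in>T. ?P x \<longrightarrow> ?P y)" by blast
  qed auto
  then have "reach U (\<gamma> 0) H (\<gamma> 1) K" using ends by blast
  from reach_chain[OF this] obtain n u Hs g where c: "is_chain n u Hs g" "u 0 = \<gamma> 0" "Hs 0 = H" "u (Suc n) = \<gamma> 1" "Hs n = K"
    "\<forall>i\<le>n. g i ` {0..1} \<subseteq> U" by blast
  have "\<exists>t\<in>{0..1}. dist (g i s) (\<gamma> t) < \<epsilon>" if "i \<le> n" "s \<in> {0..1}" for i s
  proof -
    have "g i s \<in> U" using c(6) that by blast
    then show ?thesis by (auto simp: U_def dist_commute)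
  qed
  then show ?thesis using c that by blast
qed

section \<open>The relation between independent edges\<close>

text \<open>The sum of \<open>vertex_term\<close> in both orders, which by
  \<open>vertex_term_skew\<close> depends on the hexagons alone.\<close>

definition hex_skew :: "hex \<Rightarrow> hex \<Rightarrow> bit" where
  "hex_skew P Q = samehex P Q + snd P * fst Q + snd Q * fst P"

lemma vertex_term_skew:
  assumes "p \<in> hexagon P" "q \<in> hexagon Q" "p \<noteq> q"
  shows "vertex_term p P q Q + vertex_term q Q p P = hex_skew P Q"
proof (cases "P = Q")
  case True
  have "chart p \<noteq> chart q" using inj_onD[OF chart_inj] assms True by blast
  from crossbit_commute[OF this] show ?thesis
    by (simp add: vertex_term_def hex_skew_def samehex_commute True distrib_left ac_simps)
next
  case False
  then show ?thesis by (simp add: vertex_term_def hex_skew_def samehex_def)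
qed

lemma in_some_hexagon: "p \<in> S2 \<Longrightarrow> \<exists>H. p \<in> hexagon H"
  using common_hexagon[of p] by (metis dist_self)

definition symp :: "h4 \<Rightarrow> h4 \<Rightarrow> bit" where
  "symp x y = (case x of (a, b, c, d) \<Rightarrow> case y of (a', b', c', d') \<Rightarrow> a * b' + b * a' + c * d' + d * c')"

text \<open>Independent edges have four different ends and no vertex lies inside an edge, so a
  common point is interior to both and counts as a crossing.\<close>

lemma drawing_independent_disjoint:
  assumes dr: "drawing_K55 S p q \<gamma>" and ij: "i < 5" "j < 5" "i' < 5" "j' < 5" "i \<noteq> i'" "j \<noteq> j'"
    and nc: "\<And>s t. {((i, j), s), ((i', j'), t)} \<notin> crossings \<gamma>"
  shows "\<gamma> (i, j) ` {0..1} \<inter> \<gamma> (i', j') ` {0..1} = {}"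
proof (rule ccontr)
  assume "\<not> ?thesis"
  then obtain w where "w \<in> \<gamma> (i, j) ` {0..1}" "w \<in> \<gamma> (i', j') ` {0..1}" by blast
  then obtain s t where st: "s \<in> {0..1}" "t \<in> {0..1}" "\<gamma> (i, j) s = \<gamma> (i', j') t" by (metis imageE)
  have e: "(i, j) \<in> K55_edges" "(i', j') \<in> K55_edges" using ij by (auto simp: K55_edges_def)
  have V: "inj_on p {..<5}" "inj_on q {..<5}" "p ` {..<5} \<inter> q ` {..<5} = {}"
    using dr by (auto simp: drawing_K55_def)
  have E: "\<gamma> (i, j) 0 = p i" "\<gamma> (i, j) 1 = q j" "\<gamma> (i', j') 0 = p i'" "\<gamma> (i', j') 1 = q j'"
    using dr e by (auto simp: drawing_K55_def)
  have I: "\<And>t. t \<in> {0<..<1} \<Longrightarrow> \<gamma> (i, j) t \<notin> p ` {..<5} \<union> q ` {..<5}"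
    "\<And>t. t \<in> {0<..<1} \<Longrightarrow> \<gamma> (i', j') t \<notin> p ` {..<5} \<union> q ` {..<5}"
    using dr e unfolding drawing_K55_def by blast+
  have v: "p i \<in> p ` {..<5}" "p i' \<in> p ` {..<5}" "q j \<in> q ` {..<5}" "q j' \<in> q ` {..<5}" using ij by auto
  have ne: "p i \<noteq> p i'" "q j \<noteq> q j'" "p i \<noteq> q j'" "q j \<noteq> p i'"
    using V ij v by (auto dest: inj_onD)
  consider "s = 0" | "s = 1" | "s \<in> {0<..<1}" using st(1) by fastforce
  then show False
  proof cases
    case 3
    have "t \<in> {0<..<1}" using I(1)[OF 3] st(2,3) E v by (cases "t = 0"; cases "t = 1") auto
    then have "{((i, j), s), ((i', j'), t)} \<in> crossings \<gamma>"
      using 3 e st(3) ij unfolding crossings_def by blast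
    then show False using nc by blast
  next
    case 1
    then have "t \<noteq> 0" "t \<noteq> 1" using st(3) E ne by auto
    then have "t \<in> {0<..<1}" using st(2) by auto
    from I(2)[OF this] show False using 1 st(3) E v by auto
  next
    case 2
    then have "t \<noteq> 0" "t \<noteq> 1" using st(3) E ne by auto
    then have "t \<in> {0<..<1}" using st(2) by auto
    from I(2)[OF this] show False using 2 st(3) E v by auto
  qed
qed

text \<open>The property is required for all smaller gaps, so the minimum works for every element;
  the inserted 1 covers an empty \<open>F\<close>.\<close>

lemma finite_common_gap:
  assumes "finite F" "\<And>x. x \<in> F \<Longrightarrow> \<exists>d>0::real. \<forall>d'. d' \<le> d \<longrightarrow> P x d'"
  shows "\<exists>d>0. \<forall>x\<in>F. P x d"
proof -
  obtain d where d: "\<And>x. x \<in> F \<Longrightarrow> 0 < d x" "\<And>x d'. x \<in> F \<Longrightarrow> d' \<le> d x \<Longrightarrow> P x d'"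
    using assms(2) by metis
  let ?m = "Min (insert 1 (d ` F))"
  have "0 < ?m" using assms(1) d(1) by (subst Min_gr_iff) auto
  moreover have "P x ?m" if "x \<in> F" for x using assms(1) that by (intro d(2)) auto
  ultimately show ?thesis by blast
qed

definition independent_relation ::
  "(nat \<times> nat \<Rightarrow> h4) \<Rightarrow> (nat \<times> nat \<Rightarrow> nat \<Rightarrow> bit) \<Rightarrow> (nat \<times> nat \<Rightarrow> nat \<Rightarrow> bit) \<Rightarrow>
   (nat \<Rightarrow> nat \<Rightarrow> bit) \<Rightarrow> (nat \<Rightarrow> nat \<Rightarrow> bit) \<Rightarrow> (nat \<Rightarrow> nat \<Rightarrow> bit) \<Rightarrow> (nat \<Rightarrow> nat \<Rightarrow> bit) \<Rightarrow>
   nat \<times> nat \<Rightarrow> nat \<times> nat \<Rightarrow> bool" where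
  "independent_relation h \<tau>A \<tau>B SAA SAB SBA SBB e f \<longleftrightarrow>
     symp (h e) (h f) + \<tau>A e (fst f) + \<tau>B e (snd f) + \<tau>A f (fst e) + \<tau>B f (snd e)
     + SAA (fst e) (fst f) + SAB (fst e) (snd f) + SBA (snd e) (fst f) + SBB (snd e) (snd f) = 0"

text \<open>The pair \<open>(i0, j0)\<close>, \<open>(i1, j1)\<close> is the only pair of independent edges that may cross.\<close>

lemma drawing_parity:
  assumes dr: "drawing_K55 S2 p q \<gamma>" and card: "card (crossings \<gamma>) \<le> 1"
  obtains h \<tau>A \<tau>B SAA SAB SBA SBB HB i0 j0 i1 j1 where
    "i0 < 5" "i1 < 5" "j0 < 5" "j1 < 5" "i0 \<noteq> i1" "j0 \<noteq> j1"
    "\<And>i j i' j'. i < 5 \<Longrightarrow> j < 5 \<Longrightarrow> i' < 5 \<Longrightarrow> j' < 5 \<Longrightarrow> i \<noteq> i' \<Longrightarrow> j \<noteq> j' \<Longrightarrow>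
       {(i, j), (i', j')} \<noteq> {(i0, j0), (i1, j1)} \<Longrightarrow>
       independent_relation h \<tau>A \<tau>B SAA SAB SBA SBB (i, j) (i', j')"
    "\<And>j j'. j < 5 \<Longrightarrow> j' < 5 \<Longrightarrow> j \<noteq> j' \<Longrightarrow> SBB j j' + SBB j' j = hex_skew (HB j) (HB j')"
proof -
  have fin: "finite (crossings \<gamma>)" using dr by (simp add: drawing_K55_def)
  have uniq: "X = Y" if "X \<in> crossings \<gamma>" "Y \<in> crossings \<gamma>" for X Y
    using card_le_Suc0_iff_eq[OF fin] card that by simp
  let ?free = "\<lambda>i0 i1 j0 j1. \<forall>i j i' j' s t. i < 5 \<longrightarrow> j < 5 \<longrightarrow> i' < 5 \<longrightarrow> j' < 5 \<longrightarrow> i \<noteq> i' \<longrightarrow> j \<noteq> j' \<longrightarrow>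
       {(i, j), (i', j')} \<noteq> {(i0, j0), (i1, j1)} \<longrightarrow> {((i, j), s), ((i', j'), t)} \<notin> crossings \<gamma>"
  have "\<exists>i0 i1 j0 j1 :: nat. i0 < 5 \<and> i1 < 5 \<and> j0 < 5 \<and> j1 < 5 \<and> i0 \<noteq> i1 \<and> j0 \<noteq> j1 \<and> ?free i0 i1 j0 j1"
  proof (cases "\<exists>i j i' j' s t. i < 5 \<and> j < 5 \<and> i' < 5 \<and> j' < 5 \<and> i \<noteq> i' \<and> j \<noteq> j' \<and>
      {((i, j), s), ((i', j'), t)} \<in> crossings \<gamma>")
    case True
    then obtain i0 j0 i1 j1 s0 t0 where a: "i0 < 5" "j0 < 5" "i1 < 5" "j1 < 5" "i0 \<noteq> i1" "j0 \<noteq> j1"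
      "{((i0, j0), s0), ((i1, j1), t0)} \<in> crossings \<gamma>" by blast
    have "{((i, j), s), ((i', j'), t)} \<notin> crossings \<gamma>"
      if "{(i, j), (i', j')} \<noteq> {(i0, j0), (i1, j1)}" for i j i' j' s t
    proof
      assume "{((i, j), s), ((i', j'), t)} \<in> crossings \<gamma>"
      then have "{((i, j), s), ((i', j'), t)} = {((i0, j0), s0), ((i1, j1), t0)}"
        by (rule uniq[OF _ a(7)])
      then have "fst ` {((i, j), s), ((i', j'), t)} = fst ` {((i0, j0), s0), ((i1, j1), t0)}" by (rule arg_cong)
      then show False using that by simp
    qed
    then have "?free i0 i1 j0 j1" by simp
    then show ?thesis using a(1-6) by blast
  next
    case False
    \<comment> \<open>No independent pair crosses, so any pair may be named the exceptional
      one.\<close>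
    then have "?free 0 1 0 1" by blast
    then show ?thesis by (intro exI[of _ 0] exI[of _ 1]) simp
  qed
  then obtain i0 j0 i1 j1 where b: "i0 < 5" "i1 < 5" "j0 < 5" "j1 < 5" "i0 \<noteq> i1" "j0 \<noteq> j1"
    and free: "?free i0 i1 j0 j1" by blast
  have cr: "{((i, j), s), ((i', j'), t)} \<notin> crossings \<gamma>" if "i < 5" "j < 5" "i' < 5" "j' < 5" "i \<noteq> i'" "j \<noteq> j'"
       "{(i, j), (i', j')} \<noteq> {(i0, j0), (i1, j1)}" for i j i' j' s t
    using free that by simp
  define ok where "ok e f \<longleftrightarrow> e \<in> K55_edges \<and> f \<in> K55_edges \<and> fst e \<noteq> fst f \<and> snd e \<noteq> snd f \<and> {e, f} \<noteq> {(i0, j0), (i1, j1)}" for e f :: "nat \<times> nat"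
  have G: "continuous_on {0..1} (\<gamma> e)" "\<gamma> e ` {0..1} \<subseteq> S2" "\<gamma> e 0 = p (fst e)" "\<gamma> e 1 = q (snd e)"
    if "e \<in> K55_edges" for e using dr that by (auto simp: drawing_K55_def)
  have V: "p ` {..<5} \<subseteq> S2" "q ` {..<5} \<subseteq> S2" "inj_on p {..<5}" "inj_on q {..<5}" "p ` {..<5} \<inter> q ` {..<5} = {}"
    using dr by (auto simp: drawing_K55_def)
  have disj: "\<gamma> e ` {0..1} \<inter> \<gamma> f ` {0..1} = {}" if "ok e f" for e f
  proof -
    obtain i j i' j' where ef: "e = (i, j)" "f = (i', j')" by (cases e; cases f)
    have "\<gamma> (i, j) ` {0..1} \<inter> \<gamma> (i', j') ` {0..1} = {}"
    proof (rule drawing_independent_disjoint[OF dr])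
      show "i < 5" "j < 5" "i' < 5" "j' < 5" "i \<noteq> i'" "j \<noteq> j'"
        using that unfolding ok_def ef K55_edges_def by auto
      then show "{((i, j), s), ((i', j'), t)} \<notin> crossings \<gamma>" for s t
        by (intro cr) (use that in \<open>simp_all add: ok_def ef\<close>)
    qed
    then show ?thesis by (simp add: ef)
  qed
  have finE: "finite K55_edges" by (simp add: K55_edges_def)
  have "\<exists>d>0. \<forall>x\<in>{(e, f). ok e f}. \<forall>a\<in>\<gamma> (fst x) ` {0..1}. \<forall>b\<in>\<gamma> (snd x) ` {0..1}. d \<le> dist a b"
  proof (rule finite_common_gap)
    have "{(e, f). ok e f} \<subseteq> K55_edges \<times> K55_edges" by (auto simp: ok_def)
    then show "finite {(e, f). ok e f}" using finE finite_subset by blast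
    fix x assume "x \<in> {(e, f). ok e f}"
    then obtain e f where x: "x = (e, f)" "ok e f" by auto
    have ee: "e \<in> K55_edges" "f \<in> K55_edges" using x by (auto simp: ok_def)
    have "compact (\<gamma> e ` {0..1})" "closed (\<gamma> f ` {0..1})"
      using compact_continuous_image[OF G(1)[OF ee(1)] compact_Icc]
        compact_imp_closed[OF compact_continuous_image[OF G(1)[OF ee(2)] compact_Icc]] by blast+
    then obtain d where "0 < d" "\<forall>a\<in>\<gamma> e ` {0..1}. \<forall>b\<in>\<gamma> f ` {0..1}. d \<le> dist a b"
      using separate_compact_closed disj[OF x(2)] by metis
    then show "\<exists>d>0. \<forall>d'\<le>d. \<forall>a\<in>\<gamma> (fst x) ` {0..1}. \<forall>b\<in>\<gamma> (snd x) ` {0..1}. d' \<le> dist a b"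
      using x(1) by (intro exI[of _ d]) force
  qed
  then obtain d where d: "0 < d" "\<And>e f a b. ok e f \<Longrightarrow> a \<in> \<gamma> e ` {0..1} \<Longrightarrow> b \<in> \<gamma> f ` {0..1} \<Longrightarrow> d \<le> dist a b"
    by fastforce
  have "\<forall>i. \<exists>H. i < 5 \<longrightarrow> p i \<in> hexagon H" using in_some_hexagon V(1) by (meson image_subset_iff lessThan_iff)
  then obtain HA where HA: "\<And>i. i < 5 \<Longrightarrow> p i \<in> hexagon (HA i)" by metis
  have "\<forall>i. \<exists>H. i < 5 \<longrightarrow> q i \<in> hexagon H" using in_some_hexagon V(2) by (meson image_subset_iff lessThan_iff)
  then obtain HB where HB: "\<And>j. j < 5 \<Longrightarrow> q j \<in> hexagon (HB j)" by metis
  \<comment> \<open>The bound \<open>d / 2\<close> for each chain keeps chains of disjoint edges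
    apart. The hexagon at every vertex is fixed beforehand, so that the terms for two ends are the
    same for all edges meeting there.\<close>
  define good where "good e c \<longleftrightarrow> (case c of (n, u, Hs, g) \<Rightarrow> is_chain n u Hs g \<and> u 0 = p (fst e) \<and> Hs 0 = HA (fst e)
      \<and> u (Suc n) = q (snd e) \<and> Hs n = HB (snd e) \<and> (\<forall>i s. i \<le> n \<longrightarrow> s \<in> {0..1} \<longrightarrow> (\<exists>t\<in>{0..1}. dist (g i s) (\<gamma> e t) < d / 2)))"
    for e :: "nat \<times> nat" and c :: "nat \<times> (nat \<Rightarrow> pt) \<times> (nat \<Rightarrow> hex) \<times> (nat \<Rightarrow> real \<Rightarrow> pt)"
  have "\<exists>c. good e c" if e: "e \<in> K55_edges" for e
  proof -
    have "fst e < 5" "snd e < 5" using e by (auto simp: K55_edges_def)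
    then have "\<gamma> e 0 \<in> hexagon (HA (fst e))" "\<gamma> e 1 \<in> hexagon (HB (snd e))" using G[OF e] HA HB by auto
    then obtain n u Hs g where "is_chain n u Hs g" "u 0 = \<gamma> e 0" "Hs 0 = HA (fst e)" "u (Suc n) = \<gamma> e 1" "Hs n = HB (snd e)"
      "\<And>i s. i \<le> n \<Longrightarrow> s \<in> {0..1} \<Longrightarrow> \<exists>t\<in>{0..1}. dist (g i s) (\<gamma> e t) < d / 2"
      using chain_approximation[OF G(1,2)[OF e], of "d / 2"] d(1) by (metis half_gt_zero)
    then show ?thesis using G(3,4)[OF e] by (intro exI[of _ "(n, u, Hs, g)"]) (simp add: good_def)
  qed
  then obtain ch where ch: "\<And>e. e \<in> K55_edges \<Longrightarrow> good e (ch e)" by metis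
  define n u Hs g where "n e = fst (ch e)" "u e = fst (snd (ch e))" "Hs e = fst (snd (snd (ch e)))" "g e = snd (snd (snd (ch e)))" for e
  have C: "is_chain (n e) (u e) (Hs e) (g e)" "u e 0 = p (fst e)" "Hs e 0 = HA (fst e)" "u e (Suc (n e)) = q (snd e)"
      "Hs e (n e) = HB (snd e)" "\<And>i s. i \<le> n e \<Longrightarrow> s \<in> {0..1} \<Longrightarrow> \<exists>t\<in>{0..1}. dist (g e i s) (\<gamma> e t) < d / 2"
    if "e \<in> K55_edges" for e
    using ch[OF that] unfolding good_def n_u_Hs_g_def by (auto split: prod.splits)
  have dc: "disjoint_chains (n e) (u e) (Hs e) (g e) (n f) (u f) (Hs f) (g f)" if "ok e f" for e f
  proof
    have ee: "e \<in> K55_edges" "f \<in> K55_edges" using that by (auto simp: ok_def)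
    show "is_chain (n e) (u e) (Hs e) (g e)" "is_chain (n f) (u f) (Hs f) (g f)" using C(1) ee by blast+
    fix i j assume ij: "i \<le> n e" "j \<le> n f"
    show "g e i ` {0..1} \<inter> g f j ` {0..1} = {}"
    proof (rule ccontr)
      assume "\<not> ?thesis"
      then obtain w where "w \<in> g e i ` {0..1}" "w \<in> g f j ` {0..1}" by blast
      then obtain s t where st: "s \<in> {0..1}" "t \<in> {0..1}" "g e i s = g f j t" by (metis imageE)
      obtain s' where s': "s' \<in> {0..1}" "dist (g e i s) (\<gamma> e s') < d / 2" using C(6)[OF ee(1) ij(1) st(1)] by blast
      obtain t' where t': "t' \<in> {0..1}" "dist (g f j t) (\<gamma> f t') < d / 2" using C(6)[OF ee(2) ij(2) st(2)] by blast
      have "d \<le> dist (\<gamma> e s') (\<gamma> f t')" using d(2)[OF that] s' t' by blast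
      also have "\<dots> \<le> dist (g e i s) (\<gamma> e s') + dist (g f j t) (\<gamma> f t')"
        using st(3) by (metis dist_commute dist_triangle)
      finally show False using s' t' by linarith
    qed
  qed
  \<comment> \<open>The four coordinates are two hyperbolic pairs, arranged so that the first four
    summands of \<open>chain_parity\<close> are \<open>symp (h e) (h f)\<close>.\<close>
  define h where "h e = (y_flips (n e) (u e) (Hs e) midbit, z_flips (n e) (u e) (Hs e) lhole,
     y_flips (n e) (u e) (Hs e) rightbit,
     z_flips (n e) (u e) (Hs e) lhole + z_flips (n e) (u e) (Hs e) rhole)" for e
  define \<tau>A where "\<tau>A e i = tau (n e) (u e) (Hs e) (g e) (p i) (HA i)" for e i
  define \<tau>B where "\<tau>B e j = tau (n e) (u e) (Hs e) (g e) (q j) (HB j)" for e j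
  define SAA where "SAA i i' = vertex_term (p i) (HA i) (p i') (HA i')" for i i'
  define SAB where "SAB i j = vertex_term (p i) (HA i) (q j) (HB j)" for i j
  define SBA where "SBA j i = vertex_term (q j) (HB j) (p i) (HA i)" for j i
  define SBB where "SBB j j' = vertex_term (q j) (HB j) (q j') (HB j')" for j j'
  have rel: "independent_relation h \<tau>A \<tau>B SAA SAB SBA SBB e f" if "ok e f" for e f
  proof -
    have ee: "e \<in> K55_edges" "f \<in> K55_edges" using that by (auto simp: ok_def)
    from disjoint_chains.chain_parity[OF dc[OF that]] show ?thesis
      unfolding C(2-5)[OF ee(1)] C(2-5)[OF ee(2)] independent_relation_def symp_def h_def \<tau>A_def \<tau>B_def
        SAA_def SAB_def SBA_def SBB_def prod.case
      by (simp add: ac_simps)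
  qed
  have F1: "independent_relation h \<tau>A \<tau>B SAA SAB SBA SBB (i, j) (i', j')"
    if "i < 5" "j < 5" "i' < 5" "j' < 5" "i \<noteq> i'" "j \<noteq> j'" "{(i, j), (i', j')} \<noteq> {(i0, j0), (i1, j1)}" for i j i' j'
  proof (rule rel)
    have "(i, j) \<in> K55_edges" "(i', j') \<in> K55_edges" using that(1-4) by (simp_all add: K55_edges_def)
    then show "ok (i, j) (i', j')" unfolding ok_def fst_conv snd_conv by (intro conjI that(5-7))
  qed
  have F2: "SBB i i' + SBB i' i = hex_skew (HB i) (HB i')" if "i < 5" "i' < 5" "i \<noteq> i'" for i i'
  proof -
    have "q i \<noteq> q i'" using inj_on_eq_iff[OF V(4), of i i'] that by (metis lessThan_iff)
    then show ?thesis unfolding SBB_def by (rule vertex_term_skew[OF HB[OF that(1)] HB[OF that(2)]])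
  qed
  show ?thesis by (rule that[OF b F1 F2])
qed

lemma symp_add_left: "symp (x + y) z = symp x z + symp y z"
  by (cases x; cases y; cases z) (simp add: symp_def algebra_simps)

lemma symp_commute: "symp x y = symp y x"
  by (cases x; cases y) (simp add: symp_def algebra_simps)

lemma symp_add_right: "symp z (x + y) = symp z x + symp z y"
  using symp_add_left symp_commute by metis

lemma symp_self [simp]: "symp x x = 0"
  by (cases x) (simp add: symp_def mult.commute)

text \<open>The mixed products cancel: \<open>hex_skew P Q\<close> equals 1 + w(P) + w(Q), where w
  of the bits (y, z) is y + z + y z. In a triangle every w occurs twice and the three ones leave
  1.\<close>

lemma hex_skew_triangle: "hex_skew P Q + hex_skew P R + hex_skew Q R = 1"
proof -
  obtain a b c d e f where "P = (a, b)" "Q = (c, d)" "R = (e, f)" by (metis surj_pair)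
  then show ?thesis
    by (cases a; cases b; cases c; cases d; cases e; cases f) (simp_all add: hex_skew_def samehex_def)
qed

section \<open>Reduction to vectors over the field with two elements\<close>

text \<open>The pair of edges that may cross has been moved to \<open>(1, 1)\<close>, \<open>(2, 2)\<close>.\<close>

locale k55_parity =
  fixes h :: "nat \<Rightarrow> nat \<Rightarrow> h4"
    and \<tau>A \<tau>B :: "nat \<Rightarrow> nat \<Rightarrow> nat \<Rightarrow> bit" and SAA SAB SBA SBB :: "nat \<Rightarrow> nat \<Rightarrow> bit"
    and HB :: "nat \<Rightarrow> hex"
  assumes rel: "\<And>i j k l. i < 5 \<Longrightarrow> j < 5 \<Longrightarrow> k < 5 \<Longrightarrow> l < 5 \<Longrightarrow> i \<noteq> k \<Longrightarrow> j \<noteq> l \<Longrightarrow>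
      \<not> (i = 1 \<and> j = 1 \<and> k = 2 \<and> l = 2 \<or> i = 2 \<and> j = 2 \<and> k = 1 \<and> l = 1) \<Longrightarrow>
      symp (h i j) (h k l) + \<tau>A i j k + \<tau>B i j l + \<tau>A k l i + \<tau>B k l j + SAA i k + SAB i l + SBA j k + SBB j l = 0"
    and skew: "\<And>j l. j < 5 \<Longrightarrow> l < 5 \<Longrightarrow> j \<noteq> l \<Longrightarrow> SBB j l + SBB l j = hex_skew (HB j) (HB l)"
begin

definition m :: "nat \<Rightarrow> nat \<Rightarrow> h4" where
  "m i j = h 0 0 + h 0 j + h i 0 + h i j"

definition rowpair :: "nat \<Rightarrow> nat \<Rightarrow> nat \<Rightarrow> nat \<Rightarrow> nat \<Rightarrow> bit" where
  "rowpair a b x y z = symp (h a x) (h b y) + symp (h a x) (h b z) + symp (h a y) (h b x)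
     + symp (h a y) (h b z) + symp (h a z) (h b x) + symp (h a z) (h b y)"

definition \<theta> :: "nat \<Rightarrow> nat \<Rightarrow> nat \<Rightarrow> nat \<Rightarrow> bit" where
  "\<theta> a x y z = \<tau>B a x y + \<tau>B a x z + \<tau>B a y x + \<tau>B a y z + \<tau>B a z x + \<tau>B a z y"

text \<open>In the six relations each term of \<open>\<tau>A\<close>, \<open>SAB\<close> and
  \<open>SBA\<close> occurs twice and \<open>SAA a b\<close> six times. The terms of
  \<open>SBB\<close> form three pairs in opposite order, with sum 1 by
  \<open>hex_skew_triangle\<close>.\<close>

lemma rowpair_eq:
  assumes "a < 5" "b < 5" "a \<noteq> b" "x < 5" "y < 5" "z < 5" "x \<noteq> y" "x \<noteq> z" "y \<noteq> z"
    and nb: "\<not> ({1, 2} \<subseteq> {a, b} \<and> {1, 2} \<subseteq> {x, y, z})"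
  shows "rowpair a b x y z = \<theta> a x y z + \<theta> b x y z + 1"
proof -
  have r: "symp (h a p) (h b q) = \<tau>A a p b + \<tau>B a p q + \<tau>A b q a + \<tau>B b q p + SAA a b + SAB a q + SBA p b + SBB p q"
    if "p \<in> {x, y, z}" "q \<in> {x, y, z}" "p \<noteq> q" for p q
  proof -
    have "symp (h a p) (h b q) + \<tau>A a p b + \<tau>B a p q + \<tau>A b q a + \<tau>B b q p + SAA a b + SAB a q + SBA p b + SBB p q = 0"
      by (rule rel) (use assms that nb in auto)
    then have "symp (h a p) (h b q) + (\<tau>A a p b + \<tau>B a p q + \<tau>A b q a + \<tau>B b q p + SAA a b + SAB a q + SBA p b + SBB p q) = 0"
      by (simp only: ac_simps)
    then show ?thesis using bit_add_self_left[of "symp (h a p) (h b q)"] by (metis add_0_right)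
  qed
  have s: "SBB y x = SBB x y + hex_skew (HB x) (HB y)" "SBB z x = SBB x z + hex_skew (HB x) (HB z)"
    "SBB z y = SBB y z + hex_skew (HB y) (HB z)"
    using skew[of x y] skew[of x z] skew[of y z] assms by (metis bit_add_self_left)+
  have t: "hex_skew (HB x) (HB y) + (hex_skew (HB x) (HB z) + hex_skew (HB y) (HB z)) = 1"
    using hex_skew_triangle[of "HB x" "HB y" "HB z"] by (simp add: ac_simps)
  show ?thesis unfolding rowpair_def \<theta>_def
    using assms(7-9) by (simp add: r s t ac_simps)
qed

text \<open>The left side is the sum over all independent edge pairs of the K_{3,3} on rows 0, i, k
  and columns 0, j, l. Over its three pairs of rows every \<open>\<theta>\<close> occurs twice and
  three ones remain.\<close>

lemma minor:
  assumes "i \<in> {1..4}" "k \<in> {1..4}" "j \<in> {1..4}" "l \<in> {1..4}" "i \<noteq> k" "j \<noteq> l"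
    and nb: "\<not> ({i, k} = {1, 2} \<and> {j, l} = {1, 2})"
  shows "symp (m i j) (m k l) + symp (m i l) (m k j) = 1"
proof -
  have r: "rowpair a b 0 j l = \<theta> a 0 j l + \<theta> b 0 j l + 1" if "a \<in> {0, i, k}" "b \<in> {0, i, k}" "a \<noteq> b" for a b
    by (rule rowpair_eq) (use assms that in auto)
  have "symp (m i j) (m k l) + symp (m i l) (m k j) = rowpair 0 i 0 j l + rowpair 0 k 0 j l + rowpair i k 0 j l"
    unfolding m_def rowpair_def symp_add_left symp_add_right
    by (simp add: symp_commute ac_simps)
  also have "\<dots> = 1" using r[of 0 i] r[of 0 k] r[of i k] assms by (simp add: ac_simps)
  finally show ?thesis .
qed

text \<open>The four second arguments add up to the class of the 4-cycle on rows k, l and columns p,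
  q, which shares no vertex with the cycle of \<open>m i j\<close>. Over the 16 edge pairs every
  correction term occurs an even number of times.\<close>

lemma torus:
  assumes "i \<in> {1..4}" "k \<in> {1..4}" "l \<in> {1..4}" "j \<in> {1..4}" "p \<in> {1..4}" "q \<in> {1..4}"
    "i \<noteq> k" "i \<noteq> l" "k \<noteq> l" "j \<noteq> p" "j \<noteq> q" "p \<noteq> q"
    and nb: "\<not> (i = 1 \<and> j = 1 \<and> 2 \<in> {k, l} \<and> 2 \<in> {p, q})" "\<not> (i = 2 \<and> j = 2 \<and> 1 \<in> {k, l} \<and> 1 \<in> {p, q})"
  shows "symp (m i j) (m k p) + symp (m i j) (m k q) + symp (m i j) (m l p) + symp (m i j) (m l q) = 0"
proof -
  have r: "symp (h a b) (h c d) = \<tau>A a b c + \<tau>B a b d + \<tau>A c d a + \<tau>B c d b + SAA a c + SAB a d + SBA b c + SBB b d"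
    if "a = 0 \<or> a = i" "b = 0 \<or> b = j" "c = k \<or> c = l" "d = p \<or> d = q" for a b c d
  proof -
    have "symp (h a b) (h c d) + \<tau>A a b c + \<tau>B a b d + \<tau>A c d a + \<tau>B c d b + SAA a c + SAB a d + SBA b c + SBB b d = 0"
    proof (rule rel)
      show "a < 5" "b < 5" "c < 5" "d < 5" using that assms(1-6) by auto
      show "a \<noteq> c" using that(1,3) assms(1-3,7,8) by auto
      show "b \<noteq> d" using that(2,4) assms(4-6,10,11) by auto
      show "\<not> (a = 1 \<and> b = 1 \<and> c = 2 \<and> d = 2 \<or> a = 2 \<and> b = 2 \<and> c = 1 \<and> d = 1)"
      proof
        assume "a = 1 \<and> b = 1 \<and> c = 2 \<and> d = 2 \<or> a = 2 \<and> b = 2 \<and> c = 1 \<and> d = 1"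
        then have "i = 1 \<and> j = 1 \<and> 2 \<in> {k, l} \<and> 2 \<in> {p, q} \<or> i = 2 \<and> j = 2 \<and> 1 \<in> {k, l} \<and> 1 \<in> {p, q}"
          using that by (elim disjE conjE) simp_all
        then show False using nb by blast
      qed
    qed
    then have "symp (h a b) (h c d) + (\<tau>A a b c + \<tau>B a b d + \<tau>A c d a + \<tau>B c d b + SAA a c + SAB a d + SBA b c + SBB b d) = 0"
      by (simp only: ac_simps)
    then show ?thesis using bit_add_self_left[of "symp (h a b) (h c d)"] by (metis add_0_right)
  qed
  note L = disjI1[OF refl] and R = disjI2[OF refl]
  note rs = r[OF L L L L]
    r[OF L L L R]
    r[OF L L R L]
    r[OF L L R R]
    r[OF L R L L]
    r[OF L R L R]
    r[OF L R R L]
    r[OF L R R R]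
    r[OF R L L L]
    r[OF R L L R]
    r[OF R L R L]
    r[OF R L R R]
    r[OF R R L L]
    r[OF R R L R]
    r[OF R R R L]
    r[OF R R R R]
  have d: "x + x = 0" for x :: "h4" by (cases x) (simp add: zero_prod_def)
  have d2: "x + (x + y) = y" for x y :: "h4"
    unfolding add.assoc[symmetric] d by (rule add_0_left)
  have "m k p + (m k q + (m l p + m l q)) = h k p + (h k q + (h l p + h l q))"
    unfolding m_def by (simp only: ac_simps d d2 add_0_left add_0_right)
  then have "symp (m i j) (m k p + (m k q + (m l p + m l q))) = symp (m i j) (h k p + (h k q + (h l p + h l q)))"
    by (rule arg_cong)
  also have "\<dots> = 0"
    unfolding m_def symp_add_left symp_add_right rs by (simp only: ac_simps bit_add_self bit_add_self_left add_0_left add_0_right)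
  finally show ?thesis unfolding symp_add_right by (simp only: ac_simps)
qed

end

section \<open>Finite search\<close>

text \<open>\<open>V a u\<close> encodes \<open>(a, u) \<in> F\<^sub>2\<^sup>2 \<times> F\<^sub>2\<^sup>2\<close>, where \<open>Q3 = Q1 + Q2\<close>, and \<open>om\<close> is the orthogonal sum of two
  copies of the determinant.\<close>

datatype q = Q0 | Q1 | Q2 | Q3
datatype v = V q q

fun qdet :: "q \<Rightarrow> q \<Rightarrow> bool" where
  "qdet Q0 Q0 = False" | "qdet Q0 Q1 = False" | "qdet Q0 Q2 = False" | "qdet Q0 Q3 = False"
| "qdet Q1 Q0 = False" | "qdet Q1 Q1 = False" | "qdet Q1 Q2 = True" | "qdet Q1 Q3 = True"
| "qdet Q2 Q0 = False" | "qdet Q2 Q1 = True" | "qdet Q2 Q2 = False" | "qdet Q2 Q3 = True"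
| "qdet Q3 Q0 = False" | "qdet Q3 Q1 = True" | "qdet Q3 Q2 = True" | "qdet Q3 Q3 = False"

fun om :: "v \<Rightarrow> v \<Rightarrow> bool" where
  "om (V a b) (V c d) = (qdet a c = (\<not> qdet b d))"

fun sieve :: "v \<Rightarrow> bool \<Rightarrow> v list \<Rightarrow> v list" where
  "sieve x b [] = []"
| "sieve x b (y # ys) = (if om x y = b then y # sieve x b ys else sieve x b ys)"

text \<open>Forward checking after the choice of \<open>x\<close>: an entry \<open>Some b\<close>
  keeps the values whose product with \<open>x\<close> is \<open>b\<close>, an entry
  \<open>None\<close> keeps all. The result \<open>None\<close> signals failure, such as an emptied
  domain.\<close>

fun restrict :: "v \<Rightarrow> v list list \<Rightarrow> bool option list \<Rightarrow> v list list option" where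
  "restrict x [] r = Some []"
| "restrict x (d # ds) [] = None"
| "restrict x (d # ds) (None # r) = (case restrict x ds r of None \<Rightarrow> None | Some ds' \<Rightarrow> Some (d # ds'))"
| "restrict x (d # ds) (Some b # r) = (case sieve x b d of [] \<Rightarrow> None
     | y # ys \<Rightarrow> (case restrict x ds r of None \<Rightarrow> None | Some ds' \<Rightarrow> Some ((y # ys) # ds')))"

fun search :: "v list list \<Rightarrow> bool option list list \<Rightarrow> bool"
  and search_values :: "v list \<Rightarrow> v list list \<Rightarrow> bool option list \<Rightarrow> bool option list list \<Rightarrow> bool" where
  "search [] rs = True"
| "search (d # ds) [] = False"
| "search (d # ds) (r # rs) = search_values d ds r rs"
| "search_values [] ds r rs = False"
| "search_values (x # xs) ds r rs =
     ((case restrict x ds r of None \<Rightarrow> False | Some ds' \<Rightarrow> search ds' rs) \<or> search_values xs ds r rs)"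

fun agrees :: "v \<Rightarrow> v list \<Rightarrow> bool option list \<Rightarrow> bool" where
  "agrees x [] r = True"
| "agrees x (y # ys) [] = False"
| "agrees x (y # ys) (None # r) = agrees x ys r"
| "agrees x (y # ys) (Some b # r) = (om x y = b \<and> agrees x ys r)"

fun solves :: "v list \<Rightarrow> bool option list list \<Rightarrow> bool" where
  "solves [] rs = True"
| "solves (x # xs) [] = False"
| "solves (x # xs) (r # rs) = (agrees x xs r \<and> solves xs rs)"

lemma set_sieve: "set (sieve x b ys) = {y \<in> set ys. om x y = b}"
  by (induction ys) auto

lemma restrict_complete:
  assumes "list_all2 (\<lambda>y d. y \<in> set d) ys ds" "agrees x ys r"
  shows "\<exists>ds'. restrict x ds r = Some ds' \<and> list_all2 (\<lambda>y d. y \<in> set d) ys ds'"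
  using assms
proof (induction x ds r arbitrary: ys rule: restrict.induct)
  case (1 x r)
  then show ?case by simp
next
  case (2 x d ds)
  then show ?case by (auto simp: list_all2_Cons2)
next
  case (3 x d ds r)
  then obtain y zs where y: "ys = y # zs" "y \<in> set d" "list_all2 (\<lambda>y d. y \<in> set d) zs ds" "agrees x zs r"
    by (auto simp: list_all2_Cons2)
  from 3(1)[OF y(3,4)] show ?case using y by auto
next
  case (4 x d ds b r)
  then obtain y zs where y: "ys = y # zs" "y \<in> set d" "om x y = b" "list_all2 (\<lambda>y d. y \<in> set d) zs ds" "agrees x zs r"
    by (auto simp: list_all2_Cons2)
  have c: "y \<in> set (sieve x b d)" using y by (simp add: set_sieve)
  then obtain e es where e: "sieve x b d = e # es" by (cases "sieve x b d") auto
  obtain ds' where ds': "restrict x ds r = Some ds'" "list_all2 (\<lambda>y d. y \<in> set d) zs ds'"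
    using 4(1)[OF e y(4,5)] by blast
  have "restrict x (d # ds) (Some b # r) = Some ((e # es) # ds')" using e ds'(1) by simp
  moreover have "list_all2 (\<lambda>y d. y \<in> set d) ys ((e # es) # ds')"
    using c e ds'(2) y(1) by (metis list.rel_inject(2))
  ultimately show ?case by blast
qed

text \<open>A solution survives every \<open>restrict\<close>, so a failed search refutes its
  existence.\<close>

lemma search_complete:
  assumes "list_all2 (\<lambda>y d. y \<in> set d) ys ds" "solves ys rs"
  shows "search ds rs"
  using assms
proof (induction ys arbitrary: ds rs)
  case (Cons y ys)
  obtain d ds' where d: "ds = d # ds'" "y \<in> set d" "list_all2 (\<lambda>y d. y \<in> set d) ys ds'"
    using Cons.prems(1) by (auto simp: list_all2_Cons1)
  obtain r rs' where r: "rs = r # rs'" "agrees y ys r" "solves ys rs'"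
    using Cons.prems(2) by (cases rs) auto
  obtain ds'' where ds'': "restrict y ds' r = Some ds''" "list_all2 (\<lambda>y d. y \<in> set d) ys ds''"
    using restrict_complete[OF d(3) r(2)] by blast
  have "search ds'' rs'" by (rule Cons.IH[OF ds''(2) r(3)])
  then have "search_values zs ds' r rs'" if "y \<in> set zs" for zs
    using that ds''(1) by (induction zs) auto
  then show ?case using d(1,2) r(1) by simp
qed simp

abbreviation "all_q \<equiv> [Q0, Q1, Q2, Q3]"

text \<open>The first components \<open>a\<close> of the vectors whose products with \<open>V Q1 Q0\<close> and \<open>V Q2 Q0\<close> are prescribed.\<close>

fun quarter :: "bool option \<Rightarrow> bool option \<Rightarrow> q list" where
  "quarter (Some e) (Some f) = [if e then (if f then Q3 else Q2) else (if f then Q1 else Q0)]"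
| "quarter (Some e) None = (if e then [Q2, Q3] else [Q0, Q1])"
| "quarter None (Some f) = (if f then [Q1, Q3] else [Q0, Q2])"
| "quarter None None = all_q"

fun row_domain :: "q \<Rightarrow> q list \<Rightarrow> v list" where
  "row_domain a [] = []"
| "row_domain a (u # us) = V a u # row_domain a us"

fun grid :: "q list \<Rightarrow> q list \<Rightarrow> v list" where
  "grid [] us = []"
| "grid (a # as) us = row_domain a us @ grid as us"

text \<open>Turns quantification over \<open>bool\<close> into a conjunction that
  \<open>code_simp\<close> can evaluate.\<close>

definition all_bool :: "(bool \<Rightarrow> bool) \<Rightarrow> bool" where
  "all_bool f \<longleftrightarrow> f False \<and> f True"

lemma all_bool_iff: "all_bool f \<longleftrightarrow> (\<forall>b. f b)"
  unfolding all_bool_def by (metis (full_types))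

text \<open>The cells in the order \<open>(2,1), (1,2), (2,2), (3,1), (1,4), (4,1), (1,3), (4,3), (2,3), (2,4), (3,4), (4,2),
  (3,2), (1,1)\<close>; the cells \<open>(3,3)\<close> and \<open>(4,4)\<close> carry the hyperbolic pair \<open>V Q1 Q0\<close>, \<open>V Q2 Q0\<close>, and
  \<open>P\<^sub>3\<^sub>4\<close> is false, \<open>T\<^sub>3\<^sub>4\<close> true. \<open>us\<close> and \<open>vs\<close> are the possible second components in the first two cells; row \<open>c\<close> of
  \<open>cell_relations\<close> prescribes the products of cell \<open>c\<close> with the later cells.\<close>

definition cell_domains where
  "cell_domains us vs p12 p13 p14 p23 p24 t12 t13 t14 t23 t24 = [
    grid (quarter (Some (p23 \<noteq> t13)) (Some (p24 \<noteq> t14))) us,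
    grid (quarter (Some (p13 \<noteq> t23)) (Some (p14 \<noteq> t24))) vs,
    grid (quarter (Some (p23 \<noteq> t23)) (Some (p24 \<noteq> t24))) all_q,
    grid (quarter None (Some t14)) all_q,
    grid (quarter (Some p13) None) all_q,
    grid (quarter (Some (\<not> t13)) None) all_q,
    grid (quarter None (Some (\<not> p14))) all_q,
    grid (quarter None None) all_q,
    grid (quarter None (Some (\<not> p24))) all_q,
    grid (quarter (Some p23) None) all_q,
    grid (quarter None None) all_q,
    grid (quarter (Some (\<not> t23)) None) all_q,
    grid (quarter None (Some t24)) all_q,
    grid (quarter (Some (p13 \<noteq> t13)) (Some (p14 \<noteq> t14))) all_q]"

definition cell_relations where
  "cell_relations p12 p13 p14 p23 p24 t12 t13 t14 t23 t24 = [
    [Some (p12 = t12), None, None, Some (p12 = t14), None, Some (p12 = t13), Some (p24 \<noteq> t13), None, None, Some (p23 \<noteq> t14), Some (p24 \<noteq> t12), Some (p23 \<noteq> t12), None],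
    [None, Some (p13 = t12), None, Some (p14 = t12), None, Some (p14 \<noteq> t23), Some (p12 \<noteq> t23), Some (p12 \<noteq> t24), Some (p13 \<noteq> t24), None, None, None],
    [Some (p23 = t12), Some (p12 = t24), Some (p24 = t12), Some (p12 = t23), Some (p24 \<noteq> t23), None, None, Some (p23 \<noteq> t24), None, None, None],
    [Some (p13 = t14), None, Some (p13 = t13), Some t13, Some (p23 = t13), Some (p23 = t14), None, Some t12, None, None],
    [Some (p14 = t14), None, Some p14, Some p12, None, None, Some (p14 = t24), Some (p13 = t24), None],
    [Some (p14 = t13), None, Some (p24 = t13), Some (p24 = t14), Some (\<not> t14), None, Some (\<not> t12), None],
    [None, None, Some (\<not> p12), Some (\<not> p13), Some (p14 = t23), Some (p13 = t23), None],
    [None, Some p24, Some False, None, Some t23, Some (p14 \<noteq> t13)],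
    [None, Some (\<not> p23), Some (p24 = t23), Some (p23 = t23), Some (p12 \<noteq> t13)],
    [None, Some (p24 = t24), Some (p23 = t24), Some (p12 \<noteq> t14)],
    [Some (\<not> t24), None, Some (p13 \<noteq> t14)],
    [None, Some (p14 \<noteq> t12)],
    [Some (p13 \<noteq> t12)],
    []]"

text \<open>The two searches together cover the five orbit representatives of
  \<open>canonical_pair\<close>.\<close>

definition infeasible where
  "infeasible p12 p13 p14 p23 p24 t12 t13 t14 t23 t24 \<longleftrightarrow>
     \<not> search (cell_domains [Q0] [Q0, Q1] p12 p13 p14 p23 p24 t12 t13 t14 t23 t24) (cell_relations p12 p13 p14 p23 p24 t12 t13 t14 t23 t24) \<and>
     \<not> search (cell_domains [Q1] [Q0, Q1, Q2] p12 p13 p14 p23 p24 t12 t13 t14 t23 t24) (cell_relations p12 p13 p14 p23 p24 t12 t13 t14 t23 t24)"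

text \<open>The search is split into eight parts to keep each evaluation short.\<close>

definition infeasible_block where
  "infeasible_block p12 p13 p14 \<longleftrightarrow> all_bool (\<lambda>p23. all_bool (\<lambda>p24. all_bool (\<lambda>t12. all_bool (\<lambda>t13. all_bool (\<lambda>t14.
     all_bool (\<lambda>t23. all_bool (\<lambda>t24. infeasible p12 p13 p14 p23 p24 t12 t13 t14 t23 t24)))))))"

lemma infeasible_FFF: "infeasible_block False False False" by code_simp
lemma infeasible_FFT: "infeasible_block False False True" by code_simp
lemma infeasible_FTF: "infeasible_block False True False" by code_simp
lemma infeasible_FTT: "infeasible_block False True True" by code_simp
lemma infeasible_TFF: "infeasible_block True False False" by code_simp
lemma infeasible_TFT: "infeasible_block True False True" by code_simp
lemma infeasible_TTF: "infeasible_block True True False" by code_simp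
lemma infeasible_TTT: "infeasible_block True True True" by code_simp

lemma infeasible_all: "infeasible p12 p13 p14 p23 p24 t12 t13 t14 t23 t24"
proof -
  have "infeasible_block p12 p13 p14"
    using infeasible_FFF infeasible_FFT infeasible_FTF infeasible_FTT
      infeasible_TFF infeasible_TFT infeasible_TTF infeasible_TTT
    by (cases p12; cases p13; cases p14) simp_all
  then show ?thesis unfolding infeasible_block_def all_bool_iff by blast
qed

fun qadd :: "q \<Rightarrow> q \<Rightarrow> q" where
  "qadd Q0 x = x" | "qadd x Q0 = x"
| "qadd Q1 Q1 = Q0" | "qadd Q1 Q2 = Q3" | "qadd Q1 Q3 = Q2"
| "qadd Q2 Q1 = Q3" | "qadd Q2 Q2 = Q0" | "qadd Q2 Q3 = Q1"
| "qadd Q3 Q1 = Q2" | "qadd Q3 Q2 = Q1" | "qadd Q3 Q3 = Q0"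

fun vadd :: "v \<Rightarrow> v \<Rightarrow> v" where "vadd (V a b) (V c d) = V (qadd a c) (qadd b d)"

lemma qdet_qadd: "qdet (qadd a b) c = (qdet a c \<noteq> qdet b c)"
  by (cases a; cases b; cases c) simp_all

lemma qdet_commute: "qdet a b = qdet b a"
  by (cases a; cases b) simp_all

lemma om_vadd: "om (vadd x y) z = (om x z \<noteq> om y z)"
  by (cases x; cases y; cases z) (auto simp: qdet_qadd)

lemma om_commute: "om x y = om y x"
  by (cases x; cases y) (simp add: qdet_commute)

lemma om_self [simp]: "\<not> om x x"
proof -
  have "\<not> qdet a a" for a by (cases a) simp_all
  then show ?thesis by (cases x) simp
qed

section \<open>Normalisation by isometries\<close>

text \<open>The symplectic transvection sending x to x + om(a, x) a.\<close>

definition transvect :: "v \<Rightarrow> v \<Rightarrow> v" where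
  "transvect a x = (if om a x then vadd a x else x)"

text \<open>Preserving \<open>om\<close> is what matters, because the relations between cells are
  stated by \<open>om\<close> alone.\<close>

definition isometry :: "(v \<Rightarrow> v) \<Rightarrow> bool" where
  "isometry \<phi> \<longleftrightarrow> (\<forall>x y. om (\<phi> x) (\<phi> y) = om x y)"

lemma isometry_transvect: "isometry (transvect a)"
proof -
  have "om (transvect a x) (transvect a y) = om x y" for x y
  proof -
    have "om x (vadd a y) = (om a x \<noteq> om x y)" for x y
      using om_vadd[of a y x] om_commute[of x] by simp
    then show ?thesis
      unfolding transvect_def using om_vadd[of a x] om_self[of a] om_commute[of x a] om_commute[of y a]
      by (cases "om a x"; cases "om a y") simp_all
  qed
  then show ?thesis by (simp add: isometry_def)
qed

lemma isometry_comp: "isometry \<phi> \<Longrightarrow> isometry \<psi> \<Longrightarrow> isometry (\<lambda>x. \<phi> (\<psi> x))"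
  by (simp add: isometry_def)

definition all_v :: "v list" where
  "all_v = grid all_q all_q"

lemma set_grid: "V a u \<in> set (grid as us) \<longleftrightarrow> a \<in> set as \<and> u \<in> set us"
proof -
  have r: "V a u \<in> set (row_domain b us) \<longleftrightarrow> a = b \<and> u \<in> set us" for b by (induction us) auto
  show ?thesis by (induction as) (auto simp: r)
qed

lemma in_all_v: "x \<in> set all_v"
proof -
  have "a \<in> set all_q" for a by (cases a) simp_all
  then show ?thesis unfolding all_v_def by (cases x) (simp only: set_grid)
qed

lemma move_first: "x \<noteq> V Q0 Q0 \<Longrightarrow> \<exists>a b. transvect b (transvect a x) = V Q1 Q0"
proof -
  have "list_all (\<lambda>x. x = V Q0 Q0 \<or> list_ex (\<lambda>a. list_ex (\<lambda>b. transvect b (transvect a x) = V Q1 Q0) all_v) all_v) all_v"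
    by code_simp
  then show "x \<noteq> V Q0 Q0 \<Longrightarrow> ?thesis" using in_all_v[of x] unfolding list_all_iff list_ex_iff by blast
qed

text \<open>Transvections along vectors orthogonal to \<open>V Q1 Q0\<close> fix it, so the
  normalisation of the first vector is not undone.\<close>

lemma move_second:
  "om (V Q1 Q0) y \<Longrightarrow> \<exists>a b. \<not> om a (V Q1 Q0) \<and> \<not> om b (V Q1 Q0) \<and> transvect b (transvect a y) = V Q2 Q0"
proof -
  have "list_all (\<lambda>y. om (V Q1 Q0) y \<longrightarrow> list_ex (\<lambda>a. list_ex (\<lambda>b. \<not> om a (V Q1 Q0) \<and> \<not> om b (V Q1 Q0) \<and> transvect b (transvect a y) = V Q2 Q0) all_v) all_v) all_v"
    by code_simp
  then show "om (V Q1 Q0) y \<Longrightarrow> ?thesis" using in_all_v[of y] unfolding list_all_iff list_ex_iff by blast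
qed

fun inner :: "v \<Rightarrow> q" where "inner (V a u) = u"

definition qtransvect :: "q \<Rightarrow> q \<Rightarrow> q" where
  "qtransvect a u = (if qdet a u then qadd a u else u)"

lemma inner_transvect: "inner (transvect (V Q0 a) x) = qtransvect a (inner x)"
proof (cases x)
  case (V c u)
  have "qdet Q0 c = False" "qadd Q0 c = c" by (cases c; simp)+
  then show ?thesis by (simp add: V transvect_def qtransvect_def)
qed

text \<open>Orbit representatives of pairs in \<open>F\<^sub>2\<^sup>2\<close> under \<open>SL\<^sub>2(F\<^sub>2)\<close>.\<close>

definition canonical_pair :: "q \<Rightarrow> q \<Rightarrow> bool" where
  "canonical_pair u w \<longleftrightarrow> u = Q0 \<and> (w = Q0 \<or> w = Q1) \<or> u = Q1 \<and> (w = Q0 \<or> w = Q1 \<or> w = Q2)"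

text \<open>Transvections along \<open>V Q0 a\<close> fix the hyperbolic pair and act on its
  orthogonal complement as the transvections of F_2^2; two of them reach a representative of every
  orbit of pairs.\<close>

lemma move_inner:
  "\<exists>a b. canonical_pair (inner (transvect (V Q0 b) (transvect (V Q0 a) x))) (inner (transvect (V Q0 b) (transvect (V Q0 a) y)))"
proof -
  have all: "list_all (\<lambda>u. list_all (\<lambda>w. list_ex (\<lambda>a. list_ex (\<lambda>b.
      canonical_pair (qtransvect b (qtransvect a u)) (qtransvect b (qtransvect a w)))
     all_q) all_q) all_q) all_q"
    by code_simp
  have q: "a \<in> set all_q" for a by (cases a) simp_all
  show ?thesis unfolding inner_transvect
    using bspec[OF bspec[OF all[unfolded list_all_iff] q] q, of "inner x" "inner y"] unfolding list_ex_iff by blast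
qed

lemma normalising_isometry:
  assumes "om e f"
  shows "\<exists>\<phi>. isometry \<phi> \<and> \<phi> e = V Q1 Q0 \<and> \<phi> f = V Q2 Q0 \<and>
     canonical_pair (inner (\<phi> x)) (inner (\<phi> y))"
proof -
  have "e \<noteq> V Q0 Q0"
  proof
    have "\<not> qdet Q0 c" for c by (cases c) simp_all
    moreover assume "e = V Q0 Q0"
    ultimately show False using assms by (cases f) simp
  qed
  then obtain \<phi>1 where \<phi>1: "isometry \<phi>1" "\<phi>1 e = V Q1 Q0"
    using move_first isometry_comp[OF isometry_transvect isometry_transvect] by meson
  have "om (V Q1 Q0) (\<phi>1 f)" using assms \<phi>1 unfolding isometry_def by metis
  then obtain c d where cd: "\<not> om c (V Q1 Q0)" "\<not> om d (V Q1 Q0)" "transvect d (transvect c (\<phi>1 f)) = V Q2 Q0"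
    using move_second by blast
  define \<phi>2 where "\<phi>2 z = transvect d (transvect c z)" for z
  have \<phi>2: "isometry \<phi>2" unfolding \<phi>2_def by (rule isometry_comp[OF isometry_transvect isometry_transvect])
  have \<phi>2e: "\<phi>2 (V Q1 Q0) = V Q1 Q0" and \<phi>2f: "\<phi>2 (\<phi>1 f) = V Q2 Q0"
    using cd(3) by (simp_all only: \<phi>2_def transvect_def[of _ "V Q1 Q0"] cd(1,2) if_False)
  obtain r s where rs: "canonical_pair (inner (transvect (V Q0 s) (transvect (V Q0 r) (\<phi>2 (\<phi>1 x)))))
      (inner (transvect (V Q0 s) (transvect (V Q0 r) (\<phi>2 (\<phi>1 y)))))"
    using move_inner by blast
  define \<phi>3 where "\<phi>3 z = transvect (V Q0 s) (transvect (V Q0 r) z)" for z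
  have fix12: "transvect (V Q0 t) (V c Q0) = V c Q0" for t c
    by (cases t; cases c) (simp_all add: transvect_def)
  have \<phi>3: "isometry \<phi>3" unfolding \<phi>3_def by (rule isometry_comp[OF isometry_transvect isometry_transvect])
  have \<phi>3e: "\<phi>3 (V c Q0) = V c Q0" for c by (simp only: \<phi>3_def fix12)
  have "isometry (\<lambda>z. \<phi>3 (\<phi>2 (\<phi>1 z)))" by (rule isometry_comp[OF \<phi>3 isometry_comp[OF \<phi>2 \<phi>1(1)]])
  moreover have "\<phi>3 (\<phi>2 (\<phi>1 e)) = V Q1 Q0" "\<phi>3 (\<phi>2 (\<phi>1 f)) = V Q2 Q0"
    by (simp_all only: \<phi>1 \<phi>2e \<phi>2f \<phi>3e)
  moreover have "canonical_pair (inner (\<phi>3 (\<phi>2 (\<phi>1 x)))) (inner (\<phi>3 (\<phi>2 (\<phi>1 y))))"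
    using rs by (simp only: \<phi>3_def)
  ultimately show ?thesis by blast
qed

lemma quarter_mem:
  assumes "\<And>b. eo = Some b \<Longrightarrow> om x (V Q1 Q0) = b" "\<And>b. fo = Some b \<Longrightarrow> om x (V Q2 Q0) = b" "inner x \<in> set us"
  shows "x \<in> set (grid (quarter eo fo) us)"
proof -
  obtain a u where x: "x = V a u" by (cases x)
  have d: "qdet u Q0 = False" by (cases u) simp_all
  have "a \<in> set (quarter eo fo)"
    using assms(1,2) unfolding x by (cases eo; cases fo; cases a) (auto simp: d)
  then show ?thesis using assms(3) by (simp add: x set_grid)
qed

text \<open>\<open>T\<close> enters for increasing columns only; for decreasing ones its
  antisymmetry is already built into \<open>down0\<close>.\<close>

lemma no_solution_T34:
  fixes s0 :: "nat \<Rightarrow> nat \<Rightarrow> v" and P T :: "nat \<Rightarrow> nat \<Rightarrow> bool"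
  assumes up0: "\<And>i j k l. 1 \<le> i \<Longrightarrow> i < k \<Longrightarrow> k \<le> 4 \<Longrightarrow> 1 \<le> j \<Longrightarrow> j < l \<Longrightarrow> l \<le> 4 \<Longrightarrow>
      \<not> (i = 1 \<and> j = 1 \<and> k = 2 \<and> l = 2) \<Longrightarrow> om (s0 i j) (s0 k l) = (P i k \<noteq> T j l)"
    and down0: "\<And>i j k l. 1 \<le> i \<Longrightarrow> i < k \<Longrightarrow> k \<le> 4 \<Longrightarrow> 1 \<le> j \<Longrightarrow> j < l \<Longrightarrow> l \<le> 4 \<Longrightarrow>
      om (s0 i l) (s0 k j) = (P i k = T j l)"
    and PT: "\<not> P 3 4" "T 3 4"
  shows False
proof -
  have "om (s0 3 3) (s0 4 4)" using up0[of 3 4 3 4] PT by simp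
  then obtain \<phi> where \<phi>: "isometry \<phi>" "\<phi> (s0 3 3) = V Q1 Q0" "\<phi> (s0 4 4) = V Q2 Q0"
      "canonical_pair (inner (\<phi> (s0 2 1))) (inner (\<phi> (s0 1 2)))"
    using normalising_isometry by meson
  define s where "s i j = \<phi> (s0 i j)" for i j
  have om: "om (s i j) (s k l) = om (s0 i j) (s0 k l)" for i j k l using \<phi>(1) by (simp add: s_def isometry_def)
  note up = up0[folded om] and down = down0[folded om] and ef = \<phi>(2,3)[folded s_def] and inn = \<phi>(4)[folded s_def]
  have up': "om (s k l) (s i j) = (P i k \<noteq> T j l)" if "1 \<le> i" "i < k" "k \<le> 4" "1 \<le> j" "j < l" "l \<le> 4"
      "\<not> (i = 1 \<and> j = 1 \<and> k = 2 \<and> l = 2)" for i j k l using up[OF that] om_commute by metis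
  have down': "om (s k j) (s i l) = (P i k = T j l)" if "1 \<le> i" "i < k" "k \<le> 4" "1 \<le> j" "j < l" "l \<le> 4" for i j k l
    using down[OF that] om_commute by metis
  let ?sol = "[s 2 1, s 1 2, s 2 2, s 3 1, s 1 4, s 4 1, s 1 3, s 4 3, s 2 3, s 2 4, s 3 4, s 4 2, s 3 2, s 1 1]"
  let ?doms = "\<lambda>us vs. cell_domains us vs (P 1 2) (P 1 3) (P 1 4) (P 2 3) (P 2 4) (T 1 2) (T 1 3) (T 1 4) (T 2 3) (T 2 4)"
  let ?rels = "cell_relations (P 1 2) (P 1 3) (P 1 4) (P 2 3) (P 2 4) (T 1 2) (T 1 3) (T 1 4) (T 2 3) (T 2 4)"
  have full: "u \<in> set all_q" for u by (cases u) simp_all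
  \<comment> \<open>Among cells in different rows and columns only the exceptional pair (2,2), (1,1)
    is left open, by the \<open>None\<close> at the end of the third row of the table.\<close>
  have sol: "solves ?sol ?rels"
    unfolding cell_relations_def by (simp add: up down up' down' PT)
  have doms: "list_all2 (\<lambda>y d. y \<in> set d) ?sol (?doms us vs)"
    if "inner (s 2 1) \<in> set us" "inner (s 1 2) \<in> set vs" for us vs
    unfolding cell_domains_def list_all2_Cons
    apply (intro conjI list_all2_Nil[THEN iffD2] TrueI quarter_mem)
    apply (simp_all only: ef[symmetric] option.inject option.distinct full that)
    apply (simp_all add: up down up' down' PT)
    done
  show False
    using inn unfolding canonical_pair_def
  proof
    assume "inner (s 2 1) = Q0 \<and> (inner (s 1 2) = Q0 \<or> inner (s 1 2) = Q1)"
    then have "search (?doms [Q0] [Q0, Q1]) ?rels"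
      by (intro search_complete[OF doms sol]) auto
    then show False using infeasible_all unfolding infeasible_def by blast
  next
    assume "inner (s 2 1) = Q1 \<and> (inner (s 1 2) = Q0 \<or> inner (s 1 2) = Q1 \<or> inner (s 1 2) = Q2)"
    then have "search (?doms [Q1] [Q0, Q1, Q2]) ?rels"
      by (intro search_complete[OF doms sol]) auto
    then show False using infeasible_all unfolding infeasible_def by blast
  qed
qed

text \<open>The search takes \<open>T 3 4\<close> for granted. If it fails, exchanging columns 3 and
  4 restores it and leaves columns 1 and 2 of the exceptional pair alone.\<close>

lemma no_solution:
  fixes s :: "nat \<Rightarrow> nat \<Rightarrow> v" and P T :: "nat \<Rightarrow> nat \<Rightarrow> bool"
  assumes rel: "\<And>i j k l. 1 \<le> i \<Longrightarrow> i < k \<Longrightarrow> k \<le> 4 \<Longrightarrow> j \<in> {1..4} \<Longrightarrow> l \<in> {1..4} \<Longrightarrow> j \<noteq> l \<Longrightarrow>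
      \<not> (i = 1 \<and> j = 1 \<and> k = 2 \<and> l = 2) \<Longrightarrow> om (s i j) (s k l) = (P i k \<noteq> T j l)"
    and skew: "\<And>j l. j \<in> {1..4} \<Longrightarrow> l \<in> {1..4} \<Longrightarrow> j \<noteq> l \<Longrightarrow> T l j = (\<not> T j l)"
    and P: "\<not> P 3 4"
  shows False
proof (cases "T 3 4")
  case True
  show False
  proof (rule no_solution_T34[of s P T])
    show "om (s i j) (s k l) = (P i k \<noteq> T j l)"
      if "1 \<le> i" "i < k" "k \<le> 4" "1 \<le> j" "j < l" "l \<le> 4" "\<not> (i = 1 \<and> j = 1 \<and> k = 2 \<and> l = 2)" for i j k l
      using rel that by simp
    show "om (s i l) (s k j) = (P i k = T j l)"
      if "1 \<le> i" "i < k" "k \<le> 4" "1 \<le> j" "j < l" "l \<le> 4" for i j k l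
      using rel[of i k l j] skew[of j l] that by simp
  qed (use True P in auto)
next
  case False
  define \<sigma> :: "nat \<Rightarrow> nat" where "\<sigma> j = (if j = 3 then 4 else if j = 4 then 3 else j)" for j
  have \<sigma>: "\<sigma> j \<in> {1..4}" if "1 \<le> j" "j \<le> 4" for j using that by (auto simp: \<sigma>_def)
  have \<sigma>ne: "\<sigma> j \<noteq> \<sigma> l" if "j < l" for j l using that by (auto simp: \<sigma>_def)
  have \<sigma>2: "\<sigma> j = 1 \<longleftrightarrow> j = 1" "\<sigma> j = 2 \<longleftrightarrow> j = 2" for j by (auto simp: \<sigma>_def)
  show False
  proof (rule no_solution_T34[of "\<lambda>i j. s i (\<sigma> j)" P "\<lambda>j l. T (\<sigma> j) (\<sigma> l)"])
    show "om (s i (\<sigma> j)) (s k (\<sigma> l)) = (P i k \<noteq> T (\<sigma> j) (\<sigma> l))"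
      if "1 \<le> i" "i < k" "k \<le> 4" "1 \<le> j" "j < l" "l \<le> 4" "\<not> (i = 1 \<and> j = 1 \<and> k = 2 \<and> l = 2)" for i j k l
      by (rule rel) (use that \<sigma>[of j] \<sigma>[of l] \<sigma>ne \<sigma>2 in auto)
    show "om (s i (\<sigma> l)) (s k (\<sigma> j)) = (P i k = T (\<sigma> j) (\<sigma> l))"
      if "1 \<le> i" "i < k" "k \<le> 4" "1 \<le> j" "j < l" "l \<le> 4" for i j k l
    proof -
      have "om (s i (\<sigma> l)) (s k (\<sigma> j)) = (P i k \<noteq> T (\<sigma> l) (\<sigma> j))"
        by (rule rel) (use that \<sigma>[of j] \<sigma>[of l] \<sigma>ne[OF that(5)] \<sigma>2 in auto)
      then show ?thesis using skew[of "\<sigma> j" "\<sigma> l"] \<sigma>[of j] \<sigma>[of l] \<sigma>ne[OF that(5)] that by simp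
    qed
    show "T (\<sigma> 3) (\<sigma> 4)" using False skew[of 3 4] by (simp add: \<sigma>_def)
  qed (use P in auto)
qed

section \<open>The two tournaments of the 4-cycle classes\<close>

definition qpair :: "bit \<Rightarrow> bit \<Rightarrow> q" where
  "qpair a b = (if a = 0 then (if b = 0 then Q0 else Q2) else (if b = 0 then Q1 else Q3))"

definition emb :: "h4 \<Rightarrow> v" where
  "emb x = (case x of (a, b, c, d) \<Rightarrow> V (qpair a b) (qpair c d))"

lemma om_emb: "om (emb x) (emb y) \<longleftrightarrow> symp x y = 1"
proof -
  obtain a b c d where x: "x = (a, b, c, d)" by (cases x)
  obtain a' b' c' d' where y: "y = (a', b', c', d')" by (cases y)
  have d: "qdet (qpair p q) (qpair r s) \<longleftrightarrow> p * s + q * r = 1" for p q r s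
    by (cases p; cases q; cases r; cases s) (simp_all add: qpair_def)
  have "(u = 1) = (w \<noteq> 1) \<longleftrightarrow> u + w = 1" for u w :: bit by (cases u; cases w) simp_all
  then show ?thesis by (simp add: emb_def x y d symp_def add.assoc)
qed

lemma bit_solve: "x + y = z \<Longrightarrow> y = z + x" for x y z :: bit
  by (cases x; cases y; cases z) simp_all

context k55_parity
begin

text \<open>Rows 3 and 4 serve as reference because the exceptional pair lies in rows 1 and 2; this
  choice makes \<open>f 3 4\<close> vanish.\<close>

definition T :: "nat \<Rightarrow> nat \<Rightarrow> bit" where "T j l = symp (m 3 j) (m 4 l)"

text \<open>To be shown independent of the columns \<open>j\<close> and \<open>l\<close>; its
  constant value is the tournament on the rows.\<close>

definition f :: "nat \<Rightarrow> nat \<Rightarrow> nat \<Rightarrow> nat \<Rightarrow> bit" where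
  "f i k j l = symp (m i j) (m k l) + T j l"

lemma T_skew:
  assumes "j \<in> {1..4}" "l \<in> {1..4}" "j \<noteq> l" shows "T l j = 1 + T j l"
proof (rule bit_solve)
  have "\<not> ({3, 4} = {1, 2::nat} \<and> {j, l} = {1, 2})" by (simp add: doubleton_eq_iff)
  then show "T j l + T l j = 1" unfolding T_def using assms by (intro minor) simp_all
qed

lemma f_sym:
  assumes "i \<in> {1..4}" "k \<in> {1..4}" "i \<noteq> k" "j \<in> {1..4}" "l \<in> {1..4}" "j \<noteq> l"
    "\<not> ({i, k} = {1, 2} \<and> {j, l} = {1, 2})"
  shows "f i k l j = f i k j l"
proof -
  have "symp (m i j) (m k l) + symp (m i l) (m k j) = 1" using assms by (intro minor)
  then have "symp (m i l) (m k j) = 1 + symp (m i j) (m k l)" by (rule bit_solve)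
  then show ?thesis using T_skew[OF assms(4-6)]
    by (cases "symp (m i j) (m k l)"; cases "T j l") (simp_all add: f_def)
qed

lemma f_swap:
  assumes "j \<in> {1..4}" "l \<in> {1..4}" "j \<noteq> l"
  shows "f k i l j = 1 + f i k j l"
  unfolding f_def T_skew[OF assms] symp_commute[of "m k l"] by (simp add: ac_simps)

lemma f_torus:
  assumes "i \<in> {1..4}" "k \<in> {1..4}" "l \<in> {1..4}" "j \<in> {1..4}" "p \<in> {1..4}" "q \<in> {1..4}"
    "i \<noteq> k" "i \<noteq> l" "k \<noteq> l" "j \<noteq> p" "j \<noteq> q" "p \<noteq> q"
    "\<not> (i = 1 \<and> j = 1 \<and> 2 \<in> {k, l} \<and> 2 \<in> {p, q})" "\<not> (i = 2 \<and> j = 2 \<and> 1 \<in> {k, l} \<and> 1 \<in> {p, q})"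
    and eq: "f i l j p = f i l j q"
  shows "f i k j p = f i k j q"
proof -
  have "symp (m i j) (m k p) + symp (m i j) (m k q) + symp (m i j) (m l p) + symp (m i j) (m l q) = 0"
    by (rule torus[OF assms(1-14)])
  then show ?thesis using eq
    by (cases "symp (m i j) (m k p)"; cases "symp (m i j) (m k q)"; cases "symp (m i j) (m l p)";
        cases "symp (m i j) (m l q)"; cases "T j p"; cases "T j q") (simp_all add: f_def)
qed

text \<open>Constancy passes from rows i, l to rows i, k: \<open>f_torus\<close> changes the second
  column while the first is fixed, and \<open>f_sym\<close> exchanges the two. Everything is led
  through column 3, which is not in the exceptional pair.\<close>

lemma f_const:
  assumes "i \<in> {1..4}" "k \<in> {1..4}" "l \<in> {1..4}" "i \<noteq> k" "i \<noteq> l" "k \<noteq> l"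
    and prev: "\<And>j p q. j \<in> {1..4} \<Longrightarrow> p \<in> {1..4} \<Longrightarrow> q \<in> {1..4} \<Longrightarrow> j \<noteq> p \<Longrightarrow> j \<noteq> q \<Longrightarrow> f i l j p = f i l j q"
    and jp: "j \<in> {1..4}" "p \<in> {1..4}" "j \<noteq> p"
    and ok: "{i, k} \<noteq> {1, 2} \<or> i = 1 \<and> k = 2 \<and> \<not> (j = 1 \<and> p = 2)" and l: "{1, 2} \<subseteq> {i, l} \<Longrightarrow> False"
  shows "f i k j p = f i k 3 4"
proof -
  have row: "f i k j p = f i k j q" if "j \<in> {1..4}" "p \<in> {1..4}" "q \<in> {1..4}" "j \<noteq> p" "j \<noteq> q"
     "{i, k} \<noteq> {1, 2} \<or> i = 1 \<and> k = 2 \<and> \<not> (j = 1 \<and> 2 \<in> {p, q})" for j p q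
  proof (cases "p = q")
    case False
    have n1: "\<not> (i = 1 \<and> j = 1 \<and> 2 \<in> {k, l} \<and> 2 \<in> {p, q})" using that(6) l by auto
    have n2: "\<not> (i = 2 \<and> j = 2 \<and> 1 \<in> {k, l} \<and> 1 \<in> {p, q})" using that(6) l by auto
    show ?thesis
      by (rule f_torus[OF assms(1-3) that(1-3) assms(4-6) that(4,5) False n1 n2 prev[OF that(1-5)]])
  qed simp
  have sym: "f i k q 3 = f i k 3 q" if "q \<in> {1..4}" "q \<noteq> 3" for q
    by (rule f_sym) (use assms(1,2,4) that in \<open>auto simp: doubleton_eq_iff\<close>)
  have r3: "f i k 3 q = f i k 3 4" if "q \<in> {1..4}" "q \<noteq> 3" for q
    by (rule row) (use that ok in auto)
  show ?thesis
  proof (cases "j = 3 \<or> p = 3")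
    case True
    then show ?thesis using r3 sym jp by metis
  next
    case False
    have "f i k j p = f i k j 3" by (rule row) (use jp ok False in auto)
    then show ?thesis using r3 sym jp False by metis
  qed
qed

lemma f34: "f 3 4 j p = 0" by (simp add: f_def T_def)

text \<open>Constancy spreads from \<open>f 3 4 = 0\<close> to rows 3 and 4 against rows 1 and 2,
  and from there to rows 1 and 2, the only place where the exceptional pair interferes.\<close>

lemma f_constant:
  assumes ik: "1 \<le> i" "i < k" "k \<le> 4" and jp: "j \<in> {1..4}" "p \<in> {1..4}" "j \<noteq> p"
    and ok: "\<not> (i = 1 \<and> k = 2 \<and> j = 1 \<and> p = 2)"
  shows "f i k j p = f i k 3 4"
proof -
  have f43: "f 4 3 j p = 1" if "j \<in> {1..4}" "p \<in> {1..4}" "j \<noteq> p" for j p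
    using f_swap[of p j 4 3] that by (simp add: f34)
  have a: "f 3 k j p = f 3 k 3 4" if "k \<in> {1, 2}" "j \<in> {1..4}" "p \<in> {1..4}" "j \<noteq> p" for k j p
    by (rule f_const[of 3 k 4]) (use that f34 in \<open>auto simp: doubleton_eq_iff\<close>)
  have b: "f 4 k j p = f 4 k 3 4" if "k \<in> {1, 2}" "j \<in> {1..4}" "p \<in> {1..4}" "j \<noteq> p" for k j p
    by (rule f_const[of 4 k 3]) (use that f43 in \<open>auto simp: doubleton_eq_iff\<close>)
  have sw: "f i k j p = f i k 3 4" if "\<And>j p. j \<in> {1..4} \<Longrightarrow> p \<in> {1..4} \<Longrightarrow> j \<noteq> p \<Longrightarrow> f k i j p = f k i 3 4"
      "j \<in> {1..4}" "p \<in> {1..4}" "j \<noteq> p" for i k j p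
    using f_swap[of p j i k] f_swap[of 4 3 i k] that(1)[of p j] that(1)[of 4 3] that(2-4) by simp
  have c: "f i 3 j p = f i 3 3 4" if "i \<in> {1, 2}" "j \<in> {1..4}" "p \<in> {1..4}" "j \<noteq> p" for i j p
    by (rule sw) (use a that in blast)+
  have d: "f i 4 j p = f i 4 3 4" if "i \<in> {1, 2}" "j \<in> {1..4}" "p \<in> {1..4}" "j \<noteq> p" for i j p
    by (rule sw) (use b that in blast)+
  have e: "f 1 2 j p = f 1 2 3 4" if "\<not> (j = 1 \<and> p = 2)"
  proof (rule f_const[of 1 2 3])
    show "f 1 3 j p = f 1 3 j q" if "j \<in> {1..4}" "p \<in> {1..4}" "q \<in> {1..4}" "j \<noteq> p" "j \<noteq> q" for j p q
      using c[of 1 j p] c[of 1 j q] that by simp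
  qed (use jp that in auto)
  have "i = 1 \<and> k = 2 \<or> i \<in> {1, 2} \<and> k = 3 \<or> i \<in> {1, 2} \<and> k = 4 \<or> i = 3 \<and> k = 4" using ik by auto
  then show ?thesis
    using e c[OF _ jp] d[OF _ jp] f34 ok by (elim disjE conjE) simp_all
qed

lemma contradiction: False
proof (rule no_solution[of "\<lambda>i j. emb (m i j)" "\<lambda>i k. f i k 3 4 = 1" "\<lambda>j l. T j l = 1"])
  show "om (emb (m i j)) (emb (m k l)) = ((f i k 3 4 = 1) \<noteq> (T j l = 1))"
    if "1 \<le> i" "i < k" "k \<le> 4" "j \<in> {1..4}" "l \<in> {1..4}" "j \<noteq> l" "\<not> (i = 1 \<and> j = 1 \<and> k = 2 \<and> l = 2)" for i j k l
  proof -
    have "f i k j l = f i k 3 4" by (rule f_constant) (use that in auto)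
    then show ?thesis unfolding om_emb
      by (cases "symp (m i j) (m k l)"; cases "T j l"; cases "f i k 3 4") (simp_all add: f_def[of i k j l])
  qed
  show "(T l j = 1) = (\<not> T j l = 1)" if "j \<in> {1..4}" "l \<in> {1..4}" "j \<noteq> l" for j l
    unfolding T_skew[OF that] by (cases "T j l") simp_all
qed (simp add: f34)

end

section \<open>Relabelling and the lower bound\<close>

text \<open>A composite of two transpositions: the inner one sends 2 to the preimage of
  \<open>b\<close> under the outer one.\<close>

lemma injection_with_two_values:
  assumes "a < 5" "b < 5" "a \<noteq> (b :: nat)"
  obtains \<rho> :: "nat \<Rightarrow> nat" where "inj_on \<rho> {..<5}" "\<rho> ` {..<5} \<subseteq> {..<5}" "\<rho> 1 = a" "\<rho> 2 = b"
proof -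
  let ?\<tau> = "Transposition.transpose (1::nat) a"
  let ?c = "?\<tau> b"
  have c: "?c \<noteq> 1" "?c < 5" using assms by (auto simp: Transposition.transpose_def)
  define \<rho> where "\<rho> x = ?\<tau> (Transposition.transpose 2 ?c x)" for x
  have "inj \<rho>" unfolding \<rho>_def by (metis (no_types, lifting) injI transpose_involutory)
  moreover have "\<rho> x < 5" if "x < 5" for x
    using that assms c unfolding \<rho>_def by (auto simp: Transposition.transpose_def)
  moreover have "\<rho> 1 = a" using c unfolding \<rho>_def by (simp add: Transposition.transpose_def)
  moreover have "\<rho> 2 = b" unfolding \<rho>_def by (simp add: transpose_involutory)
  ultimately show ?thesis using that by (metis image_subsetI inj_on_subset lessThan_iff subset_UNIV)
qed

lemma crossing_number_lower_bound:
  assumes dr: "drawing_K55 S2 p q \<gamma>"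
  shows "2 \<le> card (crossings \<gamma>)"
proof (rule ccontr)
  assume "\<not> ?thesis"
  then have card: "card (crossings \<gamma>) \<le> 1" by simp
  obtain h \<tau>A \<tau>B SAA SAB SBA SBB HB i0 j0 i1 j1 where b: "i0 < 5" "i1 < 5" "j0 < 5" "j1 < 5" "i0 \<noteq> i1" "j0 \<noteq> j1"
    and R: "\<And>i j i' j'. i < 5 \<Longrightarrow> j < 5 \<Longrightarrow> i' < 5 \<Longrightarrow> j' < 5 \<Longrightarrow> i \<noteq> i' \<Longrightarrow> j \<noteq> j' \<Longrightarrow>
       {(i, j), (i', j')} \<noteq> {(i0, j0), (i1, j1)} \<Longrightarrow>
       independent_relation h \<tau>A \<tau>B SAA SAB SBA SBB (i, j) (i', j')"
    and SBB: "\<And>j j'. j < 5 \<Longrightarrow> j' < 5 \<Longrightarrow> j \<noteq> j' \<Longrightarrow> SBB j j' + SBB j' j = hex_skew (HB j) (HB j')"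
    by (rule drawing_parity[OF dr card]) blast
  obtain \<rho> :: "nat \<Rightarrow> nat" where \<rho>: "inj_on \<rho> {..<5}" "\<rho> ` {..<5} \<subseteq> {..<5}" "\<rho> 1 = i0" "\<rho> 2 = i1"
    using injection_with_two_values[OF b(1,2,5)] by blast
  obtain \<kappa> :: "nat \<Rightarrow> nat" where \<kappa>: "inj_on \<kappa> {..<5}" "\<kappa> ` {..<5} \<subseteq> {..<5}" "\<kappa> 1 = j0" "\<kappa> 2 = j1"
    using injection_with_two_values[OF b(3,4,6)] by blast
  have \<rho>5: "\<rho> i < 5" "\<kappa> i < 5" if "i < 5" for i using \<rho>(2) \<kappa>(2) that by auto
  have \<rho>e: "\<rho> i = \<rho> k \<longleftrightarrow> i = k" "\<kappa> i = \<kappa> k \<longleftrightarrow> i = k" if "i < 5" "k < 5" for i k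
    using inj_on_eq_iff[OF \<rho>(1)] inj_on_eq_iff[OF \<kappa>(1)] that by auto
  interpret k55_parity "\<lambda>i j. h (\<rho> i, \<kappa> j)" "\<lambda>i j k. \<tau>A (\<rho> i, \<kappa> j) (\<rho> k)" "\<lambda>i j l. \<tau>B (\<rho> i, \<kappa> j) (\<kappa> l)"
    "\<lambda>i k. SAA (\<rho> i) (\<rho> k)" "\<lambda>i l. SAB (\<rho> i) (\<kappa> l)" "\<lambda>j k. SBA (\<kappa> j) (\<rho> k)" "\<lambda>j l. SBB (\<kappa> j) (\<kappa> l)" "\<lambda>j. HB (\<kappa> j)"
  proof
    fix i j k l :: nat
    assume a: "i < 5" "j < 5" "k < 5" "l < 5" "i \<noteq> k" "j \<noteq> l"
      and nb: "\<not> (i = 1 \<and> j = 1 \<and> k = 2 \<and> l = 2 \<or> i = 2 \<and> j = 2 \<and> k = 1 \<and> l = 1)"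
    have ne: "{(\<rho> i, \<kappa> j), (\<rho> k, \<kappa> l)} \<noteq> {(i0, j0), (i1, j1)}"
    proof
      assume "{(\<rho> i, \<kappa> j), (\<rho> k, \<kappa> l)} = {(i0, j0), (i1, j1)}"
      then have "\<rho> i = \<rho> 1 \<and> \<kappa> j = \<kappa> 1 \<and> \<rho> k = \<rho> 2 \<and> \<kappa> l = \<kappa> 2 \<or> \<rho> i = \<rho> 2 \<and> \<kappa> j = \<kappa> 2 \<and> \<rho> k = \<rho> 1 \<and> \<kappa> l = \<kappa> 1"
        unfolding doubleton_eq_iff \<rho>(3,4) \<kappa>(3,4) by simp
      then show False using nb \<rho>e[OF a(1), of 1] \<rho>e[OF a(1), of 2] \<rho>e[OF a(2), of 1] \<rho>e[OF a(2), of 2]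
         \<rho>e[OF a(3), of 1] \<rho>e[OF a(3), of 2] \<rho>e[OF a(4), of 1] \<rho>e[OF a(4), of 2] by auto
    qed
    have "independent_relation h \<tau>A \<tau>B SAA SAB SBA SBB (\<rho> i, \<kappa> j) (\<rho> k, \<kappa> l)"
      by (rule R) (use a \<rho>5 \<rho>e ne in simp_all)
    then show "symp (h (\<rho> i, \<kappa> j)) (h (\<rho> k, \<kappa> l)) + \<tau>A (\<rho> i, \<kappa> j) (\<rho> k) + \<tau>B (\<rho> i, \<kappa> j) (\<kappa> l) +
       \<tau>A (\<rho> k, \<kappa> l) (\<rho> i) + \<tau>B (\<rho> k, \<kappa> l) (\<kappa> j) + SAA (\<rho> i) (\<rho> k) + SAB (\<rho> i) (\<kappa> l) + SBA (\<kappa> j) (\<rho> k) + SBB (\<kappa> j) (\<kappa> l) = 0"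
      by (simp add: independent_relation_def)
  next
    fix j l :: nat assume "j < 5" "l < 5" "j \<noteq> l"
    then show "SBB (\<kappa> j) (\<kappa> l) + SBB (\<kappa> l) (\<kappa> j) = hex_skew (HB (\<kappa> j)) (HB (\<kappa> l))"
      using SBB \<rho>5 \<rho>e by simp
  qed
  show False by (rule contradiction)
qed

section \<open>A piecewise linear model of the hexagons\<close>

lemma wave_square: "wave x = (x\<^sup>2 - 1/2)\<^sup>2 - 1/4"
  by (simp add: wave_def power2_eq_square algebra_simps power4_eq_xxxx)

text \<open>The positive x-coordinates of the corners, where \<open>wave\<close> is -1/10, -1/10 and
  1/10: completing the square gives (x^2 - 1/2)^2 = 3/20 or 7/20.\<close>

definition corner3 :: real where "corner3 = sqrt (1/2 - sqrt (3/20))"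
definition corner2 :: real where "corner2 = sqrt (1/2 + sqrt (3/20))"
definition corner1 :: real where "corner1 = sqrt (1/2 + sqrt (7/20))"

lemma corner_squares:
  "corner3\<^sup>2 = 1/2 - sqrt (3/20)" "corner2\<^sup>2 = 1/2 + sqrt (3/20)" "corner1\<^sup>2 = 1/2 + sqrt (7/20)"
proof -
  have "sqrt (3/20) < sqrt (1/4)" by (rule real_sqrt_less_mono) simp
  also have "sqrt (1/4) = (1/2::real)" by (rule real_sqrt_unique) (simp_all add: power_divide)
  finally show "corner3\<^sup>2 = 1/2 - sqrt (3/20)" by (simp add: corner3_def)
  show "corner2\<^sup>2 = 1/2 + sqrt (3/20)" "corner1\<^sup>2 = 1/2 + sqrt (7/20)"
    by (simp_all add: corner2_def corner1_def add_nonneg_nonneg)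
qed

lemma corner_order: "0 < corner3" "corner3 < corner2" "corner2 < corner1"
proof -
  have s: "0 < sqrt (3/20 :: real)" "sqrt (3/20) < sqrt (7/20 :: real)" by simp_all
  have "sqrt (3/20) < sqrt (1/4)" by (rule real_sqrt_less_mono) simp
  also have "sqrt (1/4) = (1/2::real)" by (rule real_sqrt_unique) (simp_all add: power_divide)
  finally show "0 < corner3" by (simp add: corner3_def)
  show "corner3 < corner2" "corner2 < corner1"
    unfolding corner3_def corner2_def corner1_def using s by (auto intro!: real_sqrt_less_mono)
qed

lemma wave_corner: "wave corner3 = - (1/10)" "wave corner2 = - (1/10)" "wave corner1 = 1/10"
  unfolding wave_square corner_squares by (simp_all add: power2_eq_square)

lemma wave_less_outer:
  assumes "\<bar>x\<bar> < corner1" shows "wave x < 1/10"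
proof -
  have "x\<^sup>2 < corner1\<^sup>2" using assms corner_order by (intro power2_strict_mono) auto
  moreover have "0 \<le> x\<^sup>2" by simp
  moreover have "1/2 < sqrt (7/20 :: real)" by (rule real_less_rsqrt) (simp add: power_divide)
  ultimately have "(x\<^sup>2 - 1/2)\<^sup>2 < (sqrt (7/20))\<^sup>2"
    unfolding corner_squares by (intro power2_strict_mono) linarith
  then show ?thesis by (simp add: wave_square)
qed

lemma wave_outside_hole:
  assumes "\<bar>x\<bar> \<le> corner3 \<or> corner2 \<le> \<bar>x\<bar>" shows "- (1/10) \<le> wave x"
proof -
  have "x\<^sup>2 \<le> corner3\<^sup>2 \<or> corner2\<^sup>2 \<le> x\<^sup>2"
    using assms corner_order by (auto simp: abs_le_square_iff[symmetric])
  then have "\<bar>sqrt (3/20)\<bar> \<le> \<bar>x\<^sup>2 - 1/2\<bar>" unfolding corner_squares by auto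
  then have "(sqrt (3/20))\<^sup>2 \<le> (x\<^sup>2 - 1/2)\<^sup>2" by (simp only: abs_le_square_iff)
  then show ?thesis by (simp add: wave_square)
qed

lemma wave_inside_hole:
  assumes "corner3 \<le> \<bar>x\<bar>" "\<bar>x\<bar> \<le> corner2" shows "wave x \<le> - (1/10)"
proof -
  have "corner3\<^sup>2 \<le> x\<^sup>2" "x\<^sup>2 \<le> corner2\<^sup>2"
    using assms corner_order by (auto simp: abs_le_square_iff[symmetric])
  then have "\<bar>x\<^sup>2 - 1/2\<bar> \<le> \<bar>sqrt (3/20)\<bar>" unfolding corner_squares by auto
  then have "(x\<^sup>2 - 1/2)\<^sup>2 \<le> (sqrt (3/20))\<^sup>2" by (simp only: abs_le_square_iff)
  then show ?thesis by (simp add: wave_square)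
qed

lemma wave_inside_hole_strict:
  assumes "corner3 < \<bar>x\<bar>" "\<bar>x\<bar> < corner2" shows "wave x < - (1/10)"
proof -
  have "corner3\<^sup>2 < \<bar>x\<bar>\<^sup>2" by (rule power_strict_mono) (use assms corner_order in simp_all)
  moreover have "\<bar>x\<bar>\<^sup>2 < corner2\<^sup>2" by (rule power_strict_mono) (use assms corner_order in simp_all)
  ultimately have "\<bar>x\<^sup>2 - 1/2\<bar> < \<bar>sqrt (3/20)\<bar>" unfolding corner_squares by auto
  then have "(x\<^sup>2 - 1/2)\<^sup>2 < (sqrt (3/20))\<^sup>2" by (rule power2_strict_mono)
  then show ?thesis by (simp add: wave_square)
qed

lemma wave_outside_hole_strict:
  assumes "\<bar>x\<bar> < corner3 \<or> corner2 < \<bar>x\<bar>" shows "- (1/10) < wave x"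
proof -
  have "\<bar>x\<bar>\<^sup>2 < corner3\<^sup>2" if "\<bar>x\<bar> < corner3" by (rule power_strict_mono) (use that in simp_all)
  moreover have "corner2\<^sup>2 < \<bar>x\<bar>\<^sup>2" if "corner2 < \<bar>x\<bar>"
    by (rule power_strict_mono) (use that corner_order in simp_all)
  ultimately have "\<bar>x\<bar>\<^sup>2 < corner3\<^sup>2 \<or> corner2\<^sup>2 < \<bar>x\<bar>\<^sup>2" using assms by blast
  then have "\<bar>sqrt (3/20)\<bar> < \<bar>x\<^sup>2 - 1/2\<bar>" unfolding corner_squares by auto
  then have "(sqrt (3/20))\<^sup>2 < (x\<^sup>2 - 1/2)\<^sup>2" by (rule power2_strict_mono)
  then show ?thesis by (simp add: wave_square)
qed

text \<open>In the model every hexagon is the rectangle \<open>[-24, 24] \<times> [0, 8]\<close> with its left and right sides collapsed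
  to points. The plane \<open>y = 0\<close> contains the bottom over \<open>[-24, -16]\<close>, \<open>[-8, 8]\<close>, \<open>[16, 24]\<close>, and the plane \<open>z = 0\<close>
  contains the rest of the bottom and the top. \<open>chi\<close> carries the multiples of 8 to the corners.\<close>

definition clamp :: "real \<Rightarrow> real \<Rightarrow> real \<Rightarrow> real" where "clamp a b X = max a (min b X)"

definition chi :: "real \<Rightarrow> real" where
  "chi X = corner3 / 8 * clamp (-8) 8 X
     + (corner2 - corner3) / 8 * (clamp 8 16 X + clamp (-16) (-8) X)
     + (corner1 - corner2) / 8 * (clamp 16 24 X + clamp (-24) (-16) X)"

lemma clamp_mono: "X \<le> Y \<Longrightarrow> clamp a b X \<le> clamp a b Y"
  by (auto simp: clamp_def)

text \<open>On [-24, 24] the clamped parts add up to the argument, and each has a slope of at least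
  \<open>c > 0\<close>.\<close>

lemma chi_strict_mono:
  assumes "\<bar>X\<bar> \<le> 24" "\<bar>Y\<bar> \<le> 24" "X < Y" shows "chi X < chi Y"
proof -
  define c where "c = min (corner3 / 8) (min ((corner2 - corner3) / 8) ((corner1 - corner2) / 8))"
  have c0: "0 < c" using corner_order by (simp add: c_def)
  have c1: "c \<le> corner3 / 8" unfolding c_def by (rule min.cobounded1)
  have c2: "c \<le> (corner2 - corner3) / 8" unfolding c_def by (rule min.coboundedI2[OF min.cobounded1])
  have c3: "c \<le> (corner1 - corner2) / 8" unfolding c_def by (rule min.coboundedI2[OF min.cobounded2])
  define d1 where "d1 = clamp (-8) 8 Y - clamp (-8) 8 X"
  define d2 where "d2 = clamp 8 16 Y + clamp (-16) (-8) Y - (clamp 8 16 X + clamp (-16) (-8) X)"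
  define d3 where "d3 = clamp 16 24 Y + clamp (-24) (-16) Y - (clamp 16 24 X + clamp (-24) (-16) X)"
  have d: "0 \<le> d1" "0 \<le> d2" "0 \<le> d3"
    using clamp_mono[of X Y] assms(3) by (auto simp: d1_def d2_def d3_def intro!: add_mono)
  have sum: "Z = clamp (-8) 8 Z + (clamp 8 16 Z + clamp (-16) (-8) Z) + (clamp 16 24 Z + clamp (-24) (-16) Z)"
    if "\<bar>Z\<bar> \<le> 24" for Z using that by (auto simp: clamp_def max_def min_def abs_if split: if_splits)
  have "d1 + d2 + d3 = Y - X"
    using sum[OF assms(1)] sum[OF assms(2)] unfolding d1_def d2_def d3_def by linarith
  then have "0 < c * (d1 + d2 + d3)" using c0 assms(3) by simp
  also have "\<dots> \<le> corner3 / 8 * d1 + (corner2 - corner3) / 8 * d2 + (corner1 - corner2) / 8 * d3"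
    unfolding distrib_left by (intro add_mono mult_right_mono c1 c2 c3 d)
  also have "\<dots> = chi Y - chi X"
    unfolding d1_def d2_def d3_def chi_def by (simp only: right_diff_distrib)
  finally show ?thesis by simp
qed

lemma chi_inj: "\<bar>X\<bar> \<le> 24 \<Longrightarrow> \<bar>Y\<bar> \<le> 24 \<Longrightarrow> chi X = chi Y \<Longrightarrow> X = Y"
  using chi_strict_mono by (metis linorder_neqE_linordered_idom less_irrefl)

lemma chi_minus: "chi (- X) = - chi X"
proof -
  have "clamp (-8) 8 (-X) = - clamp (-8) 8 X" "clamp 8 16 (-X) = - clamp (-16) (-8) X" "clamp (-16) (-8) (-X) = - clamp 8 16 X"
    "clamp 16 24 (-X) = - clamp (-24) (-16) X" "clamp (-24) (-16) (-X) = - clamp 16 24 X"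
    by (auto simp: clamp_def max_def min_def)
  then show ?thesis unfolding chi_def by (simp add: algebra_simps)
qed

lemma chi_corner: "chi 8 = corner3" "chi 16 = corner2" "chi 24 = corner1" "chi 0 = 0"
  by (simp_all add: chi_def clamp_def field_simps)

lemma chi_abs:
  assumes "\<bar>X\<bar> \<le> 24" shows "\<bar>chi X\<bar> = chi \<bar>X\<bar>"
proof (cases "0 \<le> X")
  case True
  then show ?thesis using assms chi_strict_mono[of 0 X] chi_corner by (cases "X = 0") auto
next
  case False
  then show ?thesis using assms chi_strict_mono[of X 0] chi_corner chi_minus[of X] by auto
qed

lemma chi_compare:
  assumes "\<bar>X\<bar> \<le> 24" "0 \<le> c" "c \<le> 24"
  shows "\<bar>chi X\<bar> < chi c \<longleftrightarrow> \<bar>X\<bar> < c" "chi c < \<bar>chi X\<bar> \<longleftrightarrow> c < \<bar>X\<bar>"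
  using chi_abs[OF assms(1)] chi_strict_mono[of "\<bar>X\<bar>" c] chi_strict_mono[of c "\<bar>X\<bar>"] assms
  by (metis abs_abs abs_of_nonneg linorder_neqE_linordered_idom less_asym less_irrefl)+

lemma continuous_chi: "continuous_on A chi"
  unfolding chi_def clamp_def by (intro continuous_intros)

text \<open>The lower edge of the chart image of a hexagon: a side on \<open>y = 0\<close> where
  \<open>wave\<close> is above -1/10, a hole side elsewhere. In \<open>level\<close> the fraction
  \<open>s / 8\<close> is the relative height between this edge and the upper side.\<close>

definition floor_level :: "real \<Rightarrow> real" where "floor_level x = max (- (1/10)) (wave x)"

definition level :: "real \<Rightarrow> real \<Rightarrow> real" where
  "level X s = floor_level (chi X) + s / 8 * (1/10 - floor_level (chi X))"

definition model :: "bool \<times> bool \<Rightarrow> real \<times> real \<Rightarrow> pt" where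
  "model H P = lift (of_bool (fst H), of_bool (snd H)) (chi (fst P), level (fst P) (snd P))"

definition model_box :: "(real \<times> real) set" where "model_box = {(X, s). \<bar>X\<bar> \<le> 24 \<and> 0 \<le> s \<and> s \<le> 8}"

definition on_y_side :: "real \<Rightarrow> real \<Rightarrow> bool" where
  "on_y_side X s \<longleftrightarrow> s = 0 \<and> (\<bar>X\<bar> \<le> 8 \<or> 16 \<le> \<bar>X\<bar>)"

definition on_z_side :: "real \<Rightarrow> real \<Rightarrow> bool" where
  "on_z_side X s \<longleftrightarrow> s = 8 \<or> s = 0 \<and> 8 \<le> \<bar>X\<bar> \<and> \<bar>X\<bar> \<le> 16"

lemma floor_level_less: "\<bar>X\<bar> < 24 \<Longrightarrow> floor_level (chi X) < 1/10"
  using wave_less_outer[of "chi X"] chi_compare(1)[of X 24] by (auto simp: floor_level_def chi_corner max_def)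

lemma floor_level_end: "\<bar>X\<bar> = 24 \<Longrightarrow> floor_level (chi X) = 1/10 \<and> wave (chi X) = 1/10"
proof -
  assume "\<bar>X\<bar> = 24"
  then have "X = 24 \<or> X = -24" by linarith
  then have "chi X = corner1 \<or> chi X = - corner1" using chi_minus[of 24] chi_corner by auto
  then have "wave (chi X) = 1/10" using wave_corner by (auto simp: wave_def)
  then show ?thesis by (simp add: floor_level_def)
qed

lemma level_bounds:
  assumes "(X, s) \<in> model_box"
  shows "floor_level (chi X) \<le> level X s" "level X s \<le> 1/10" "- (1/10) \<le> level X s" "wave (chi X) \<le> level X s"
proof -
  have f: "floor_level (chi X) \<le> 1/10"
    using assms floor_level_less[of X] floor_level_end[of X] by (cases "\<bar>X\<bar> < 24") (auto simp: model_box_def)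
  have s: "0 \<le> s / 8" "s / 8 \<le> 1" using assms by (auto simp: model_box_def)
  have "0 \<le> s / 8 * (1/10 - floor_level (chi X))" using s f by (intro mult_nonneg_nonneg) auto
  then show 1: "floor_level (chi X) \<le> level X s" by (simp only: level_def le_add_same_cancel1)
  have "s / 8 * (1/10 - floor_level (chi X)) \<le> 1 * (1/10 - floor_level (chi X))"
    using s f by (intro mult_right_mono) auto
  then show "level X s \<le> 1/10" by (simp add: level_def)
  show "- (1/10) \<le> level X s" "wave (chi X) \<le> level X s" using 1 by (auto simp: floor_level_def)
qed

lemma model_in_S2: "P \<in> model_box \<Longrightarrow> model H P \<in> S2"
proof -
  assume "P \<in> model_box"
  then have "model H P \<in> hexagon (of_bool (fst H), of_bool (snd H))"
    using level_bounds[of "fst P" "snd P"] unfolding model_def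
    by (intro lift_in_hexagon) (auto simp: abs_le_iff)
  then show ?thesis using hexagon_subset by blast
qed

lemma continuous_model: "continuous_on A (model H)"
  unfolding model_def level_def floor_level_def wave_def
  by (intro continuous_on_compose2[OF continuous_on_lift[of UNIV]] continuous_intros continuous_on_compose2[OF continuous_chi[of UNIV]]) auto

lemma level_inj: "\<bar>X\<bar> < 24 \<Longrightarrow> level X s = level X s' \<Longrightarrow> s = s'"
  using floor_level_less[of X] by (auto simp: level_def)

lemma level_floor: "\<bar>X\<bar> < 24 \<Longrightarrow> level X s = floor_level (chi X) \<Longrightarrow> s = 0"
  using floor_level_less[of X] by (auto simp: level_def)

lemma level_top: "\<bar>X\<bar> < 24 \<Longrightarrow> level X s = 1/10 \<Longrightarrow> s = 8"
  using level_inj[of X s 8] by (simp add: level_def)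

text \<open>Equal points have equal charts, which gives \<open>X\<close> and, off the collapsed
  ends, also \<open>s\<close>. Opposite signs of y or z force that coordinate to vanish, which
  happens only on the sides.\<close>

lemma model_collision:
  assumes P: "(X, s) \<in> model_box" "(X', s') \<in> model_box" and eq: "model H (X, s) = model K (X', s')"
  shows "X' = X" "\<bar>X\<bar> < 24 \<Longrightarrow> s' = s"
    "\<bar>X\<bar> < 24 \<Longrightarrow> fst H \<noteq> fst K \<Longrightarrow> on_y_side X s" "\<bar>X\<bar> < 24 \<Longrightarrow> snd H \<noteq> snd K \<Longrightarrow> on_z_side X s"
proof -
  have "chi X = chi X'" using eq by (simp add: model_def lift_def)
  then show X: "X' = X" using chi_inj[of X X'] P by (auto simp: model_box_def)
  have "ff (model H (X, s)) = ff (model K (X', s'))" using eq by simp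
  then have lev: "level X s = level X s'"
    using level_bounds[OF P(1)] level_bounds[OF P(2)] X by (simp add: model_def ff_lift)
  then show "\<bar>X\<bar> < 24 \<Longrightarrow> s' = s" using level_inj by blast
  show "on_y_side X s" if "\<bar>X\<bar> < 24" "fst H \<noteq> fst K"
  proof -
    have "sg (of_bool (fst H)) = - sg (of_bool (fst K))" using that(2) by (auto simp: sg_def)
    then have "sqrt (level X s - wave (chi X)) = - sqrt (level X s' - wave (chi X))"
      using eq X by (auto simp: model_def lift_def sg_def split: if_splits)
    then have "level X s = wave (chi X)" using lev by simp
    then have fl: "level X s = floor_level (chi X)" "- (1/10) \<le> wave (chi X)"
      using level_bounds[OF P(1)] by (auto simp: floor_level_def)
    have "\<not> (8 < \<bar>X\<bar> \<and> \<bar>X\<bar> < 16)"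
      using fl(2) wave_inside_hole_strict[of "chi X"] chi_compare[of X 8] chi_compare[of X 16] that(1)
      by (auto simp: chi_corner)
    then show ?thesis using level_floor[OF that(1) fl(1)] by (auto simp: on_y_side_def)
  qed
  show "on_z_side X s" if "\<bar>X\<bar> < 24" "snd H \<noteq> snd K"
  proof -
    have "sqrt (1/100 - (level X s)\<^sup>2) = - sqrt (1/100 - (level X s')\<^sup>2)"
      using eq X that(2) by (auto simp: model_def lift_def sg_def split: if_splits)
    then have "(level X s)\<^sup>2 = (1/10)\<^sup>2" using lev by (simp add: power_divide)
    then consider "level X s = 1/10" | "level X s = - (1/10)" using power2_eq_iff by blast
    then show ?thesis
    proof cases
      case 1 then show ?thesis using level_top[OF that(1)] by (simp add: on_z_side_def)
    next
      case 2
      then have fl: "level X s = floor_level (chi X)" "wave (chi X) \<le> - (1/10)"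
        using level_bounds[OF P(1)] by (auto simp: floor_level_def)
      have "8 \<le> \<bar>X\<bar> \<and> \<bar>X\<bar> \<le> 16"
        using fl(2) wave_outside_hole_strict[of "chi X"] chi_compare[of X 8] chi_compare[of X 16] that(1)
        by (auto simp: chi_corner not_less)
      then show ?thesis using level_floor[OF that(1) fl(1)] by (simp add: on_z_side_def)
    qed
  qed
qed

lemma model_glue:
  assumes P: "(X, s) \<in> model_box" and y: "fst H = fst K \<or> on_y_side X s" and z: "snd H = snd K \<or> on_z_side X s"
  shows "model H (X, s) = model K (X, s)"
proof -
  have X: "\<bar>X\<bar> \<le> 24" using P by (simp add: model_box_def)
  have 1: "level X s = wave (chi X)" if "on_y_side X s"
  proof -
    have "\<bar>chi X\<bar> \<le> corner3 \<or> corner2 \<le> \<bar>chi X\<bar>"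
      using that chi_compare[OF X, of 8] chi_compare[OF X, of 16] by (auto simp: on_y_side_def chi_corner not_less[symmetric])
    from wave_outside_hole[OF this] show ?thesis using that by (simp add: level_def floor_level_def on_y_side_def)
  qed
  have 2: "(level X s)\<^sup>2 = 1/100" if "on_z_side X s"
  proof (cases "s = 8")
    case True then show ?thesis by (simp add: level_def power_divide)
  next
    case False
    then have "corner3 \<le> \<bar>chi X\<bar>" "\<bar>chi X\<bar> \<le> corner2" "s = 0"
      using that chi_compare[OF X, of 8] chi_compare[OF X, of 16] by (auto simp: on_z_side_def chi_corner not_less[symmetric])
    with wave_inside_hole have "level X s = - (1/10)" by (simp add: level_def floor_level_def)
    then show ?thesis by (simp add: power_divide)
  qed
  show ?thesis using y z 1 2 by (auto simp: model_def lift_def)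
qed

lemma model_end: "\<bar>X\<bar> = 24 \<Longrightarrow> model H (X, s) = model K (X, s')"
proof -
  assume "\<bar>X\<bar> = 24"
  then have L: "level X r = 1/10" and W: "wave (chi X) = 1/10" for r
    using floor_level_end[of X] by (simp_all add: level_def)
  show ?thesis unfolding model_def lift_def fst_conv snd_conv L W by (simp add: power_divide)
qed

text \<open>An edge runs linearly in the hexagon \<open>H\<close> from \<open>a\<close> to \<open>b\<close> and then in the hexagon \<open>K\<close> from \<open>b\<close> to \<open>c\<close>, the flags
  meaning \<open>y < 0\<close> and \<open>z < 0\<close>. The flags at the end of a segment tell whether it contains its end points.\<close>

type_synonym gridpt = "int \<times> int"
type_synonym edge_data = "(bool \<times> bool) \<times> gridpt \<times> gridpt \<times> (bool \<times> bool) \<times> gridpt"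
type_synonym seg = "(bool \<times> bool) \<times> gridpt \<times> gridpt \<times> bool \<times> bool"

section \<open>Separating segments by linear forms\<close>

definition lerp :: "gridpt \<Rightarrow> gridpt \<Rightarrow> real \<Rightarrow> real \<times> real" where
  "lerp a b r = ((1 - r) * of_int (fst a) + r * of_int (fst b), (1 - r) * of_int (snd a) + r * of_int (snd b))"

fun seg_set :: "seg \<Rightarrow> (real \<times> real) set" where
  "seg_set (H, a, b, i0, i1) = {lerp a b r | r. 0 \<le> r \<and> r \<le> 1 \<and> (r = 0 \<longrightarrow> i0) \<and> (r = 1 \<longrightarrow> i1)}"

fun fval :: "int \<times> int \<Rightarrow> gridpt \<Rightarrow> int" where
  "fval (u, v) (x, s) = u * x + v * s"

text \<open>The linear form \<open>f\<close> is larger on the first segment than on the second.\<close>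

fun above :: "int \<times> int \<Rightarrow> seg \<Rightarrow> seg \<Rightarrow> bool" where
  "above f (H, a, b, i0, i1) (K, c, d, j0, j1) =
     (let \<alpha> = fval f a; \<alpha>' = fval f b; \<beta> = fval f c; \<beta>' = fval f d; m = min \<alpha> \<alpha>'; M = max \<beta> \<beta>' in
      M < m \<or> M = m \<and> \<not> ((if \<alpha> < \<alpha>' then i0 else if \<alpha>' < \<alpha> then i1 else True) \<and>
                         (if \<beta>' < \<beta> then j0 else if \<beta> < \<beta>' then j1 else True)))"

text \<open>The normals of both segments and the axis directions, each in both senses.\<close>

fun candidates :: "seg \<Rightarrow> seg \<Rightarrow> (int \<times> int) list" where
  "candidates (H, (x0, s0), (x1, s1), i) (K, (x2, s2), (x3, s3), j) =
     [(s1 - s0, x0 - x1), (s0 - s1, x1 - x0), (s3 - s2, x2 - x3), (s2 - s3, x3 - x2), (1, 0), (-1, 0), (0, 1), (0, -1)]"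

definition separated :: "seg \<Rightarrow> seg \<Rightarrow> bool" where
  "separated A B \<longleftrightarrow> list_ex (\<lambda>f. above f A B) (candidates A B)"

text \<open>The flags \<open>(False, False)\<close> are placeholders: the sides are used as plane
  point sets.\<close>

definition y_sides :: "seg list" where
  "y_sides = [((False, False), (-24, 0), (-16, 0), True, True), ((False, False), (-8, 0), (8, 0), True, True),
     ((False, False), (16, 0), (24, 0), True, True)]"

definition z_sides :: "seg list" where
  "z_sides = [((False, False), (-16, 0), (-8, 0), True, True), ((False, False), (8, 0), (16, 0), True, True),
     ((False, False), (-24, 8), (24, 8), True, True)]"

text \<open>Off the collapsed ends, points of hexagons with different signs of y can coincide only
  on \<open>y = 0\<close>, so it is enough that one segment avoids these sides; likewise for
  z.\<close>

definition free :: "seg \<Rightarrow> seg \<Rightarrow> bool" where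
  "free A B \<longleftrightarrow> separated A B
     \<or> fst (fst A) \<noteq> fst (fst B) \<and> (list_all (separated A) y_sides \<or> list_all (separated B) y_sides)
     \<or> snd (fst A) \<noteq> snd (fst B) \<and> (list_all (separated A) z_sides \<or> list_all (separated B) z_sides)"

text \<open>On \<open>A\<close> the form is at least its smaller end value, on \<open>B\<close> at
  most its larger one. If these are equal, one segment lacks the only end point at which it could
  attain the value.\<close>

lemma above_disjoint:
  assumes "above f A B" "P \<in> seg_set A" "P \<in> seg_set B" shows False
proof -
  obtain H a b i0 i1 where A: "A = (H, a, b, i0, i1)" by (metis surj_pair)
  obtain K c d j0 j1 where B: "B = (K, c, d, j0, j1)" by (metis surj_pair)
  obtain u v where f: "f = (u, v)" by (cases f)
  define F where "F Q = of_int u * fst Q + of_int v * snd Q" for Q :: "real \<times> real"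
  have F: "F (lerp p q r) = of_int (fval f p) + r * (of_int (fval f q) - of_int (fval f p))" for p q r
    by (cases p; cases q) (simp add: F_def lerp_def f algebra_simps)
  obtain r where r: "P = lerp a b r" "0 \<le> r" "r \<le> 1" "r = 0 \<longrightarrow> i0" "r = 1 \<longrightarrow> i1" using assms(2) A by auto
  obtain s where s: "P = lerp c d s" "0 \<le> s" "s \<le> 1" "s = 0 \<longrightarrow> j0" "s = 1 \<longrightarrow> j1" using assms(3) B by auto
  define \<alpha> \<alpha>' \<beta> \<beta>' where "\<alpha> = fval f a" "\<alpha>' = fval f b" "\<beta> = fval f c" "\<beta>' = fval f d"
  note defs = this
  have lo: "of_int (min \<alpha> \<alpha>') \<le> F P \<and> (F P = of_int (min \<alpha> \<alpha>') \<longrightarrow> (if \<alpha> < \<alpha>' then i0 else if \<alpha>' < \<alpha> then i1 else True))"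
  proof -
    have FP: "F P = of_int \<alpha> + r * (of_int \<alpha>' - of_int \<alpha>)" unfolding r(1) F defs ..
    consider "\<alpha> < \<alpha>'" | "\<alpha>' < \<alpha>" | "\<alpha> = \<alpha>'" by linarith
    then show ?thesis
    proof cases
      case 1
      then have "0 \<le> r * (of_int \<alpha>' - of_int \<alpha>)" using r by (intro mult_nonneg_nonneg) auto
      then show ?thesis using 1 r FP by auto
    next
      case 2
      then have "0 \<le> (1 - r) * (of_int \<alpha> - of_int \<alpha>')" using r by (intro mult_nonneg_nonneg) auto
      moreover have "F P = of_int \<alpha>' + (1 - r) * (of_int \<alpha> - of_int \<alpha>')" unfolding FP by (simp add: algebra_simps)
      ultimately show ?thesis using 2 r by auto
    next
      case 3
      then show ?thesis using FP by simp
    qed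
  qed
  have hi: "F P \<le> of_int (max \<beta> \<beta>') \<and> (F P = of_int (max \<beta> \<beta>') \<longrightarrow> (if \<beta>' < \<beta> then j0 else if \<beta> < \<beta>' then j1 else True))"
  proof -
    have FP: "F P = of_int \<beta> + s * (of_int \<beta>' - of_int \<beta>)" unfolding s(1) F defs ..
    consider "\<beta>' < \<beta>" | "\<beta> < \<beta>'" | "\<beta> = \<beta>'" by linarith
    then show ?thesis
    proof cases
      case 1
      then have "0 \<le> s * (of_int \<beta> - of_int \<beta>')" using s by (intro mult_nonneg_nonneg) auto
      moreover have "F P = of_int \<beta> - s * (of_int \<beta> - of_int \<beta>')" unfolding FP by (simp add: algebra_simps)
      ultimately show ?thesis using 1 s by auto
    next
      case 2
      then have "0 \<le> (1 - s) * (of_int \<beta>' - of_int \<beta>)" using s by (intro mult_nonneg_nonneg) auto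
      moreover have "F P = of_int \<beta>' - (1 - s) * (of_int \<beta>' - of_int \<beta>)" unfolding FP by (simp add: algebra_simps)
      ultimately show ?thesis using 2 s by auto
    next
      case 3
      then show ?thesis using FP by simp
    qed
  qed
  have "max \<beta> \<beta>' < min \<alpha> \<alpha>' \<or> max \<beta> \<beta>' = min \<alpha> \<alpha>' \<and> \<not> ((if \<alpha> < \<alpha>' then i0 else if \<alpha>' < \<alpha> then i1 else True) \<and>
                         (if \<beta>' < \<beta> then j0 else if \<beta> < \<beta>' then j1 else True))"
    using assms(1) unfolding A B above.simps Let_def defs .
  moreover have "real_of_int (min \<alpha> \<alpha>') \<le> real_of_int (max \<beta> \<beta>')" using lo hi by linarith
  then have "min \<alpha> \<alpha>' \<le> max \<beta> \<beta>'" by (simp only: of_int_le_iff)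
  ultimately have e: "max \<beta> \<beta>' = min \<alpha> \<alpha>'" and n: "\<not> ((if \<alpha> < \<alpha>' then i0 else if \<alpha>' < \<alpha> then i1 else True) \<and>
                         (if \<beta>' < \<beta> then j0 else if \<beta> < \<beta>' then j1 else True))" by linarith+
  have "F P = of_int (min \<alpha> \<alpha>')" "F P = of_int (max \<beta> \<beta>')" using lo hi e by linarith+
  then show False using lo hi n by blast
qed

lemma separated_disjoint: "separated A B \<Longrightarrow> P \<in> seg_set A \<Longrightarrow> P \<notin> seg_set B"
  unfolding separated_def list_ex_iff using above_disjoint by blast

lemma horizontal_seg:
  assumes "of_int a \<le> X" "X \<le> of_int b" "a < b"
  shows "(X, of_int s) \<in> seg_set (H, (a, s), (b, s), True, True)"
proof -
  let ?r = "(X - of_int a) / (of_int b - of_int a)"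
  have p: "(0::real) < of_int b - of_int a" using assms(3) by simp
  have e: "?r * (of_int b - of_int a) = X - of_int a" using p by simp
  have "lerp (a, s) (b, s) ?r = (of_int a + ?r * (of_int b - of_int a), of_int s)"
  proof -
    have "(1 - r) * u + r * w = u + r * (w - u)" for r u w :: real by (simp add: algebra_simps)
    then show ?thesis unfolding lerp_def fst_conv snd_conv by (simp only: diff_self mult_zero_right add_0_right)
  qed
  also have "\<dots> = (X, of_int s)" unfolding e by simp
  finally have l: "lerp (a, s) (b, s) ?r = (X, of_int s)" .
  have "0 \<le> ?r" "?r \<le> 1" using assms p by (simp_all add: divide_le_eq)
  then show ?thesis unfolding seg_set.simps using l[symmetric] by blast
qed

lemma y_side_seg:
  assumes "on_y_side X s" "\<bar>X\<bar> \<le> 24" shows "\<exists>S\<in>set y_sides. (X, s) \<in> seg_set S"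
proof -
  have "(-24 \<le> X \<and> X \<le> -16) \<or> (-8 \<le> X \<and> X \<le> 8) \<or> (16 \<le> X \<and> X \<le> 24)" "s = 0"
    using assms by (auto simp: on_y_side_def)
  then show ?thesis
    using horizontal_seg[of "-24" X "-16" 0 "(False, False)"] horizontal_seg[of "-8" X 8 0 "(False, False)"]
      horizontal_seg[of 16 X 24 0 "(False, False)"]
    by (auto simp: y_sides_def simp del: seg_set.simps)
qed

lemma z_side_seg:
  assumes "on_z_side X s" "\<bar>X\<bar> \<le> 24" shows "\<exists>S\<in>set z_sides. (X, s) \<in> seg_set S"
proof -
  have "(-16 \<le> X \<and> X \<le> -8 \<and> s = 0) \<or> (8 \<le> X \<and> X \<le> 16 \<and> s = 0) \<or> (-24 \<le> X \<and> X \<le> 24 \<and> s = 8)"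
    using assms by (auto simp: on_z_side_def)
  then show ?thesis
    using horizontal_seg[of "-16" X "-8" 0 "(False, False)"] horizontal_seg[of 8 X 16 0 "(False, False)"]
      horizontal_seg[of "-24" X 24 8 "(False, False)"]
    by (auto simp: z_sides_def simp del: seg_set.simps)
qed

lemma free_no_collision:
  assumes fr: "free A B" and P: "(X, s) \<in> seg_set A" "(X, s) \<in> seg_set B" "\<bar>X\<bar> \<le> 24"
    and y: "fst (fst A) \<noteq> fst (fst B) \<Longrightarrow> on_y_side X s" and z: "snd (fst A) \<noteq> snd (fst B) \<Longrightarrow> on_z_side X s"
  shows False
  using fr unfolding free_def list_all_iff
  using separated_disjoint P y_side_seg[OF y P(3)] z_side_seg[OF z P(3)] by blast

lemma model_free:
  assumes fr: "free A B" and P: "P \<in> seg_set A" "Q \<in> seg_set B" "P \<in> model_box" "Q \<in> model_box" "\<bar>fst P\<bar> < 24"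
    and eq: "model (fst A) P = model (fst B) Q"
  shows False
proof -
  obtain X s X' s' where XY: "P = (X, s)" "Q = (X', s')" by (cases P; cases Q)
  note c = model_collision[OF P(3,4)[unfolded XY] eq[unfolded XY]]
  have X: "\<bar>X\<bar> < 24" using P(5) by (simp add: XY)
  have "Q = P" using c(1) c(2)[OF X] by (simp add: XY)
  then show False using free_no_collision[OF fr, of X s] P X c(3,4)[OF X] by (simp add: XY)
qed

section \<open>The drawing\<close>

text \<open>Each side on \<open>y = 0\<close> or \<open>z = 0\<close> has two copies on the surface,
  one for each sign of the other coordinate. An edge between centres passes through one copy, and
  the edge along the side uses the other. The diagonal \<open>(2, 0)\<close> avoids a crossing by
  passing through the upper side into a second hexagon. Heights at -24 and 24 may be chosen freely
  because these ends are collapsed.\<close>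

definition edge_list :: "((nat \<times> nat) \<times> edge_data) list" where
  "edge_list = [
     ((0, 0), (True, True), (-24, 0), (-20, 0), (True, True), (-16, 0)),
     ((0, 1), (False, False), (-24, 6), (8, 6), (False, False), (8, 0)),
     ((0, 2), (False, False), (-24, 8), (0, 8), (False, False), (24, 8)),
     ((0, 3), (True, False), (-24, 4), (-12, 4), (True, False), (0, 4)),
     ((0, 4), (False, True), (-24, 4), (-12, 4), (False, True), (0, 4)),
     ((1, 0), (True, False), (-8, 0), (-12, 0), (True, False), (-16, 0)),
     ((1, 1), (False, False), (-8, 0), (0, 0), (False, False), (8, 0)),
     ((1, 2), (True, True), (-8, 0), (-8, 6), (True, True), (24, 6)),
     ((1, 3), (True, False), (-8, 0), (-4, 2), (True, False), (0, 4)),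
     ((1, 4), (False, True), (-8, 0), (-4, 2), (False, True), (0, 4)),
     ((2, 0), (True, False), (16, 0), (-8, 8), (True, True), (-16, 0)),
     ((2, 1), (False, False), (16, 0), (12, 0), (False, False), (8, 0)),
     ((2, 2), (False, False), (16, 0), (20, 0), (False, False), (24, 0)),
     ((2, 3), (True, False), (16, 0), (8, 2), (True, False), (0, 4)),
     ((2, 4), (False, True), (16, 0), (8, 2), (False, True), (0, 4)),
     ((3, 0), (False, False), (0, 4), (-8, 2), (False, False), (-16, 0)),
     ((3, 1), (False, False), (0, 4), (4, 2), (False, False), (8, 0)),
     ((3, 2), (False, False), (0, 4), (12, 4), (False, False), (24, 4)),
     ((3, 3), (False, False), (0, 4), (-20, 0), (True, False), (0, 4)),
     ((3, 4), (False, False), (0, 4), (-12, 0), (False, True), (0, 4)),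
     ((4, 0), (True, True), (0, 4), (-8, 2), (True, True), (-16, 0)),
     ((4, 1), (True, True), (0, 4), (4, 2), (True, True), (8, 0)),
     ((4, 2), (True, True), (0, 4), (12, 4), (True, True), (24, 4)),
     ((4, 3), (True, True), (0, 4), (12, 0), (True, False), (0, 4)),
     ((4, 4), (True, True), (0, 4), (0, 0), (False, True), (0, 4))]"

definition edge_data :: "nat \<times> nat \<Rightarrow> edge_data" where "edge_data e = the (map_of edge_list e)"

definition vertex_list :: "((bool \<times> bool) \<times> gridpt) list" where
  "vertex_list = [((False, False), -24, 0), ((False, False), -8, 0), ((False, False), 16, 0), ((False, False), 0, 4), ((True, True), 0, 4),
     ((False, False), -16, 0), ((False, False), 8, 0), ((False, False), 24, 0), ((True, False), 0, 4), ((False, True), 0, 4)]"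

definition grid_model :: "(bool \<times> bool) \<times> gridpt \<Rightarrow> pt" where
  "grid_model v = model (fst v) (of_int (fst (snd v)), of_int (snd (snd v)))"

definition edge_path :: "nat \<times> nat \<Rightarrow> real \<Rightarrow> pt" where
  "edge_path e t = (case edge_data e of (H, a, b, K, c) \<Rightarrow>
     if t \<le> 1/2 then model H (lerp a b (2 * t)) else model K (lerp b c (2 * t - 1)))"

fun grid_box :: "gridpt \<Rightarrow> bool" where "grid_box (x, s) = (\<bar>x\<bar> \<le> 24 \<and> 0 \<le> s \<and> s \<le> 8)"

fun glued :: "(bool \<times> bool) \<times> gridpt \<Rightarrow> (bool \<times> bool) \<times> gridpt \<Rightarrow> bool" where
  "glued ((y, z), (x, s)) ((y', z'), (x', s')) = (x = x' \<and> (\<bar>x\<bar> = 24 \<or> s = s' \<and>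
     (y = y' \<or> s = 0 \<and> (\<bar>x\<bar> \<le> 8 \<or> 16 \<le> \<bar>x\<bar>)) \<and> (z = z' \<or> s = 8 \<or> s = 0 \<and> 8 \<le> \<bar>x\<bar> \<and> \<bar>x\<bar> \<le> 16)))"

lemma glued_model:
  assumes g: "glued v w" "grid_box (snd v)" shows "grid_model v = grid_model w"
proof -
  obtain y z x s where v: "v = ((y, z), (x, s))" by (metis surj_pair)
  obtain y' z' x' s' where w: "w = ((y', z'), (x', s'))" by (metis surj_pair)
  have "\<bar>real_of_int x\<bar> \<le> 24" using g(2) unfolding v by simp linarith
  then have B: "(of_int x, of_int s) \<in> model_box" using g(2) by (simp add: v model_box_def)
  show ?thesis
  proof (cases "\<bar>x\<bar> = 24")
    case True
    then have "\<bar>real_of_int x\<bar> = 24" by linarith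
    then show ?thesis using g(1) model_end by (simp add: v w grid_model_def)
  next
    case False
    have "y = y' \<or> on_y_side (of_int x) (of_int s)" "z = z' \<or> on_z_side (of_int x) (of_int s)" "x' = x" "s' = s"
      using g(1) False unfolding v w on_y_side_def on_z_side_def by (auto; linarith)+
    then show ?thesis using model_glue[OF B, of "(y, z)" "(y', z')"] by (simp add: v w grid_model_def)
  qed
qed

text \<open>The bend belongs to the first half.\<close>

fun seg1 :: "edge_data \<Rightarrow> seg" where "seg1 (H, a, b, K, c) = (H, a, b, False, True)"
fun seg2 :: "edge_data \<Rightarrow> seg" where "seg2 (H, a, b, K, c) = (K, b, c, False, False)"

text \<open>Points over -24 or 24 coincide whatever their heights, which \<open>free\<close> does
  not see; hence the condition on \<open>fst a\<close> and \<open>fst c\<close>. The second half is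
  taken without the bend, which it shares with the first.\<close>

fun valid_edge :: "edge_data \<Rightarrow> bool" where
  "valid_edge (H, a, b, K, c) = (grid_box a \<and> grid_box b \<and> grid_box c \<and> \<bar>fst b\<bar> < 24 \<and> glued (H, b) (K, b)
     \<and> a \<noteq> b \<and> b \<noteq> c \<and> (\<bar>fst a\<bar> = 24 \<longrightarrow> fst a \<noteq> fst c) \<and> free (H, a, b, True, True) (K, b, c, False, True))"

definition vertex_seg :: "(bool \<times> bool) \<times> gridpt \<Rightarrow> seg" where
  "vertex_seg v = (fst v, snd v, snd v, True, True)"

text \<open>Interior points of an edge satisfy |X| < 24, so they cannot meet a vertex at a collapsed
  end.\<close>

definition avoids :: "edge_data \<Rightarrow> bool" where
  "avoids d \<longleftrightarrow> list_all (\<lambda>v. \<bar>fst (snd v)\<bar> = 24 \<or> free (seg1 d) (vertex_seg v) \<and> free (seg2 d) (vertex_seg v)) vertex_list"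

text \<open>The two exempt pairs of halves are those that really cross, written in the order in
  which the edges occur in \<open>edge_list\<close>.\<close>

definition no_crossing :: "(nat \<times> nat) \<times> edge_data \<Rightarrow> (nat \<times> nat) \<times> edge_data \<Rightarrow> bool" where
  "no_crossing c d \<longleftrightarrow> (free (seg1 (snd c)) (seg1 (snd d)) \<or> fst c = (1, 2) \<and> fst d = (4, 0))
     \<and> free (seg1 (snd c)) (seg2 (snd d))
     \<and> (free (seg2 (snd c)) (seg1 (snd d)) \<or> fst c = (0, 1) \<and> fst d = (3, 2))
     \<and> free (seg2 (snd c)) (seg2 (snd d))"

definition ends_match :: "(nat \<times> nat) \<times> edge_data \<Rightarrow> bool" where
  "ends_match x = (case x of ((i, j), (H, a, b, K, c)) \<Rightarrow>
     glued (H, a) (vertex_list ! i) \<and> glued (K, c) (vertex_list ! (5 + j)))"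

definition distinct_vertices :: "(bool \<times> bool) \<times> gridpt \<Rightarrow> (bool \<times> bool) \<times> gridpt \<Rightarrow> bool" where
  "distinct_vertices v w \<longleftrightarrow> fst (snd v) \<noteq> fst (snd w) \<or> \<bar>fst (snd v)\<bar> < 24 \<and> free (vertex_seg v) (vertex_seg w)"

lemma valid_edges: "list_all (\<lambda>x. valid_edge (snd x)) edge_list"
  by code_simp

lemma edges_avoid: "list_all (\<lambda>x. avoids (snd x)) edge_list"
  by code_simp

lemma edges_no_crossing: "sorted_wrt no_crossing edge_list"
  by code_simp

lemma vertices_distinct: "sorted_wrt distinct_vertices vertex_list"
  by code_simp

lemma vertices_in_box: "list_all (\<lambda>v. grid_box (snd v)) vertex_list"
  by code_simp

lemma edges_ends: "list_all ends_match edge_list"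
  unfolding edge_list_def ends_match_def vertex_list_def by simp

lemma edge_data_mem:
  assumes "e \<in> K55_edges" shows "(e, edge_data e) \<in> set edge_list"
proof -
  have "fst ` set edge_list = {0, 1, 2, 3, 4} \<times> {0, 1, 2, 3, 4}"
    unfolding edge_list_def by simp
  moreover have "{..<5::nat} = {0, 1, 2, 3, 4}" by auto
  ultimately have "e \<in> fst ` set edge_list" using assms unfolding K55_edges_def by metis
  then show ?thesis unfolding edge_data_def
    by (metis map_of_SomeD map_of_eq_None_iff option.exhaust_sel option.sel)
qed

lemma lerp_in_box:
  assumes "grid_box a" "grid_box b" "0 \<le> r" "r \<le> 1" shows "lerp a b r \<in> model_box"
proof -
  have c: "convex ({-24..24::real} \<times> {0..8::real})" by (intro convex_Times convex_real_interval)
  have g: "(real_of_int (fst p), real_of_int (snd p)) \<in> {-24..24} \<times> {0..8}" if "grid_box p" for p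
    using that by (cases p) auto
  have "(1 - r) *\<^sub>R (real_of_int (fst a), real_of_int (snd a)) + r *\<^sub>R (real_of_int (fst b), real_of_int (snd b)) \<in> {-24..24} \<times> {0..8}"
    by (rule convexD[OF c g[OF assms(1)] g[OF assms(2)]]) (use assms in auto)
  then show ?thesis by (auto simp: lerp_def model_box_def)
qed

lemma abs_lerp_less:
  assumes "\<bar>u\<bar> \<le> 24" "\<bar>w\<bar> < 24" "0 < r" "r \<le> 1" shows "\<bar>(1 - r) * u + r * w\<bar> < (24::real)"
proof -
  have "\<bar>(1 - r) * u + r * w\<bar> \<le> (1 - r) * \<bar>u\<bar> + r * \<bar>w\<bar>"
    using assms(3,4) abs_triangle_ineq[of "(1 - r) * u" "r * w"] by (simp add: abs_mult)
  moreover have "(1 - r) * \<bar>u\<bar> \<le> (1 - r) * 24" using assms by (intro mult_left_mono) auto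
  moreover have "r * \<bar>w\<bar> < r * 24" using assms by (intro mult_strict_left_mono) auto
  ultimately show ?thesis by (simp add: algebra_simps)
qed

lemma fst_lerp_less:
  assumes "grid_box a" "\<bar>fst b\<bar> < 24" "0 < r" "r \<le> 1"
  shows "\<bar>fst (lerp a b r)\<bar> < 24" "\<bar>fst (lerp b a (1 - r))\<bar> < 24"
proof -
  have a: "\<bar>real_of_int (fst a)\<bar> \<le> 24" using assms(1) by (cases a) (simp, linarith)
  have b: "\<bar>real_of_int (fst b)\<bar> < 24" using assms(2) by linarith
  show "\<bar>fst (lerp a b r)\<bar> < 24" "\<bar>fst (lerp b a (1 - r))\<bar> < 24"
    using abs_lerp_less[OF a b assms(3,4)] by (simp_all add: lerp_def add.commute)
qed

lemma lerp_inj: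
  assumes "lerp a b r = lerp a b s" "a \<noteq> b" shows "r = s"
proof -
  have e: "(1 - r) * u + r * w = u + r * (w - u)" for r u w :: real by (simp add: algebra_simps)
  have "fst a \<noteq> fst b \<or> snd a \<noteq> snd b" using assms(2) by (metis prod.collapse)
  then show ?thesis using assms(1) unfolding lerp_def e by auto
qed

context
  fixes e :: "nat \<times> nat" and H K :: "bool \<times> bool" and a b c :: gridpt
  assumes e: "e \<in> K55_edges" and d: "edge_data e = (H, a, b, K, c)"
begin

lemma valid: "valid_edge (H, a, b, K, c)"
  using valid_edges edge_data_mem[OF e] unfolding list_all_iff d by force

lemma grid: "grid_box a" "grid_box b" "grid_box c" "\<bar>fst b\<bar> < 24" "glued (H, b) (K, b)" "a \<noteq> b" "b \<noteq> c"
    "\<bar>fst a\<bar> = 24 \<longrightarrow> fst a \<noteq> fst c" "free (H, a, b, True, True) (K, b, c, False, True)"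
  using valid by (simp_all add: valid_edge.simps del: glued.simps grid_box.simps)

lemma edge_path_first: "t \<le> 1/2 \<Longrightarrow> edge_path e t = model H (lerp a b (2 * t))"
  by (simp add: edge_path_def d)

lemma edge_path_second: "1/2 < t \<Longrightarrow> edge_path e t = model K (lerp b c (2 * t - 1))"
  by (simp add: edge_path_def d)

lemma edge_path_box: "0 \<le> t \<Longrightarrow> t \<le> 1/2 \<Longrightarrow> lerp a b (2 * t) \<in> model_box" "1/2 \<le> t \<Longrightarrow> t \<le> 1 \<Longrightarrow> lerp b c (2 * t - 1) \<in> model_box"
  using lerp_in_box[OF grid(1,2), of "2 * t"] lerp_in_box[OF grid(2,3), of "2 * t - 1"] by auto

lemma edge_path_in_S2: "t \<in> {0..1} \<Longrightarrow> edge_path e t \<in> S2"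
  using edge_path_box[of t] edge_path_first[of t] edge_path_second[of t] model_in_S2
  by (cases "t \<le> 1/2") auto

lemma continuous_edge_path: "continuous_on {0..1} (edge_path e)"
proof -
  have l: "continuous_on S (\<lambda>t. lerp p q (g t))" if "continuous_on S g" for p q g and S :: "real set"
    unfolding lerp_def by (intro continuous_intros that)
  have "grid_model (H, b) = grid_model (K, b)" using glued_model[OF grid(5)] grid(2) by simp
  then have m: "model H (lerp a b 1) = model K (lerp b c 0)" by (simp add: grid_model_def lerp_def)
  have "continuous_on {0..1} (\<lambda>t. if t \<le> 1/2 then model H (lerp a b (2 * t)) else model K (lerp b c (2 * t - 1)))"
  proof (rule continuous_on_cases_le)
    show "continuous_on {t \<in> {0..1}. t \<le> 1/2} (\<lambda>t. model H (lerp a b (2 * t)))"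
      by (rule continuous_on_compose2[OF continuous_model[of UNIV H]]) (intro l continuous_intros, simp)
    show "continuous_on {t \<in> {0..1}. 1/2 \<le> t} (\<lambda>t. model K (lerp b c (2 * t - 1)))"
      by (rule continuous_on_compose2[OF continuous_model[of UNIV K]]) (intro l continuous_intros, simp)
    show "model H (lerp a b (2 * t)) = model K (lerp b c (2 * t - 1))" if "t \<in> {0..1}" "t = 1/2" for t
      using m unfolding that(2) by simp
  qed (intro continuous_intros)
  then show ?thesis unfolding edge_path_def d prod.case .
qed

lemma edge_path_interior:
  assumes "0 < t" "t < 1"
  obtains S P where "S = seg1 (edge_data e) \<and> t \<le> 1/2 \<and> P = lerp a b (2 * t) \<or> S = seg2 (edge_data e) \<and> 1/2 < t \<and> P = lerp b c (2 * t - 1)"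
    "P \<in> seg_set S" "P \<in> model_box" "\<bar>fst P\<bar> < 24" "edge_path e t = model (fst S) P"
proof (cases "t \<le> 1/2")
  case True
  show ?thesis
  proof (rule that[of "seg1 (edge_data e)" "lerp a b (2 * t)"])
    show "lerp a b (2 * t) \<in> seg_set (seg1 (edge_data e))" using True assms by (force simp: d)
    show "\<bar>fst (lerp a b (2 * t))\<bar> < 24" using fst_lerp_less(1)[OF grid(1,4), of "2 * t"] True assms by simp
  qed (use True assms edge_path_box edge_path_first in \<open>auto simp: d\<close>)
next
  case False
  show ?thesis
  proof (rule that[of "seg2 (edge_data e)" "lerp b c (2 * t - 1)"])
    show "lerp b c (2 * t - 1) \<in> seg_set (seg2 (edge_data e))" using False assms by (force simp: d)
    show "\<bar>fst (lerp b c (2 * t - 1))\<bar> < 24" using fst_lerp_less(2)[OF grid(3,4), of "2 - 2 * t"] False assms by simp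
  qed (use False assms edge_path_box edge_path_second in \<open>auto simp: d\<close>)
qed

text \<open>Each half is injective because \<open>lerp\<close> is. The halves are separated by
  \<open>free\<close>, except that start and end may both lie over collapsed ends; these are then
  different ends by \<open>valid_edge\<close>.\<close>

lemma edge_path_less_ne:
  assumes tu: "0 \<le> t" "t < u" "u \<le> 1" shows "edge_path e t \<noteq> edge_path e u"
proof
  assume eq: "edge_path e t = edge_path e u"
  have g1: "\<bar>fst (lerp a b (2 * r))\<bar> < 24" if "0 < r" "r \<le> 1/2" for r
    using fst_lerp_less(1)[OF grid(1,4), of "2 * r"] that by simp
  have g2: "\<bar>fst (lerp b c (2 * r - 1))\<bar> < 24" if "1/2 \<le> r" "r < 1" for r
    using fst_lerp_less(2)[OF grid(3,4), of "2 - 2 * r"] that by simp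
  have col: "fst Q = fst P \<and> (\<bar>fst P\<bar> < 24 \<longrightarrow> Q = P)" if "P \<in> model_box" "Q \<in> model_box" "model M P = model N Q" for P Q M N
  proof -
    obtain X s X' s' where PQ: "P = (X, s)" "Q = (X', s')" by (cases P; cases Q)
    show ?thesis using model_collision(1,2)[OF that[unfolded PQ]] unfolding PQ by simp
  qed
  consider "u \<le> 1/2" | "1/2 < t" | "t \<le> 1/2" "1/2 < u" by linarith
  then show False
  proof cases
    case 1
    have c: "fst (lerp a b (2 * t)) = fst (lerp a b (2 * u))" "lerp a b (2 * t) = lerp a b (2 * u)"
      using col[OF edge_path_box(1)[of u] edge_path_box(1)[of t], of H H] eq edge_path_first[of t] edge_path_first[of u] g1[of u] 1 tu by auto
    then show False using lerp_inj[OF c(2) grid(6)] tu by simp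
  next
    case 2
    have c: "lerp b c (2 * u - 1) = lerp b c (2 * t - 1)"
      using col[OF edge_path_box(2)[of t] edge_path_box(2)[of u], of K K] eq edge_path_second[of t] edge_path_second[of u] g2[of t] 2 tu by auto
    then show False using lerp_inj[OF c grid(7)] tu by simp
  next
    case 3
    have model_box: "lerp a b (2 * t) \<in> model_box" "lerp b c (2 * u - 1) \<in> model_box" using edge_path_box[of t] edge_path_box[of u] 3 tu by auto
    have eq': "model H (lerp a b (2 * t)) = model K (lerp b c (2 * u - 1))" using eq 3 edge_path_first edge_path_second by simp
    show False
    proof (cases "\<bar>fst (lerp a b (2 * t))\<bar> < 24")
      case True
      have "lerp a b (2 * t) \<in> seg_set (H, a, b, True, True)" "lerp b c (2 * u - 1) \<in> seg_set (K, b, c, False, True)"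
        using 3 tu by force+
      then show False using model_free[OF grid(9) _ _ model_box True] eq' by simp
    next
      case False
      then have t0: "t = 0" using g1[of t] 3 tu by force
      have "fst (lerp b c (2 * u - 1)) = fst (lerp a b (2 * t))" using col[OF model_box eq'] by simp
      then have "u = 1" using g2[of u] False 3 tu by force
      then have "fst a = fst c" "\<bar>fst a\<bar> = 24"
        using col[OF model_box eq'] t0 False lerp_in_box[OF grid(1,2), of 0] by (auto simp: lerp_def model_box_def)
      then show False using grid(8) by simp
    qed
  qed
qed

lemma edge_path_inj: "inj_on (edge_path e) {0..1}"
proof (rule inj_onI)
  fix t u assume "t \<in> {0..1}" "u \<in> {0..1}" "edge_path e t = edge_path e u"
  then show "t = u" using edge_path_less_ne[of t u] edge_path_less_ne[of u t] by (cases t u rule: linorder_cases) auto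
qed

lemma edge_path_ends:
  "edge_path e 0 = grid_model (vertex_list ! fst e)" "edge_path e 1 = grid_model (vertex_list ! (5 + snd e))"
proof -
  have "ends_match (e, (H, a, b, K, c))" using edges_ends edge_data_mem[OF e] unfolding list_all_iff d by blast
  then have g: "glued (H, a) (vertex_list ! fst e)" "glued (K, c) (vertex_list ! (5 + snd e))"
    by (auto simp: ends_match_def split: prod.splits)
  have "edge_path e 0 = grid_model (H, a)" "edge_path e 1 = grid_model (K, c)"
    by (simp_all add: edge_path_def d grid_model_def lerp_def)
  then show "edge_path e 0 = grid_model (vertex_list ! fst e)" "edge_path e 1 = grid_model (vertex_list ! (5 + snd e))"
    using glued_model[OF g(1)] glued_model[OF g(2)] grid(1,3) by simp_all
qed

lemma edge_path_avoids_vertex: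
  assumes t: "0 < t" "t < 1" and v: "v \<in> set vertex_list" shows "edge_path e t \<noteq> grid_model v"
proof
  assume eq: "edge_path e t = grid_model v"
  obtain S P where S: "S = seg1 (edge_data e) \<or> S = seg2 (edge_data e)" "P \<in> seg_set S" "P \<in> model_box" "\<bar>fst P\<bar> < 24" "edge_path e t = model (fst S) P"
    using edge_path_interior[OF t] by metis
  let ?V = "(real_of_int (fst (snd v)), real_of_int (snd (snd v)))"
  have gb: "grid_box (snd v)" using vertices_in_box v unfolding list_all_iff by blast
  have l: "?V = lerp (snd v) (snd v) 0" by (simp add: lerp_def)
  have V: "?V \<in> model_box" "?V \<in> seg_set (vertex_seg v)"
    using lerp_in_box[OF gb gb, of 0] unfolding l by (force simp: vertex_seg_def)+
  have eq': "model (fst S) P = model (fst (vertex_seg v)) ?V" using eq S(5) by (simp add: grid_model_def vertex_seg_def)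
  have "fst ?V = fst P" using model_collision(1)[of "fst P" "snd P" "fst ?V" "snd ?V"] S(3) V(1) eq' by simp
  then have "\<bar>fst (snd v)\<bar> \<noteq> 24" using S(4) by auto
  then have "free S (vertex_seg v)"
    using edges_avoid edge_data_mem[OF e] v S(1) unfolding list_all_iff avoids_def by fastforce
  then show False using model_free[OF _ S(2) V(2) S(3) V(1) S(4) eq'] by blast
qed

end

lemma vertex_model_inj:
  assumes ij: "i < j" "j < 10" shows "grid_model (vertex_list ! i) \<noteq> grid_model (vertex_list ! j)"
proof
  assume eq: "grid_model (vertex_list ! i) = grid_model (vertex_list ! j)"
  have len: "length vertex_list = 10" by (simp add: vertex_list_def)
  let ?P = "\<lambda>v. (real_of_int (fst (snd v)), real_of_int (snd (snd v)))"
  define v w where "v = vertex_list ! i" "w = vertex_list ! j"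
  have gb: "grid_box (snd v)" "grid_box (snd w)"
    using vertices_in_box ij len by (simp_all add: list_all_length v_w_def)
  have l: "?P v = lerp (snd v) (snd v) 0" for v :: "(bool \<times> bool) \<times> gridpt" by (simp add: lerp_def)
  have V: "?P v \<in> model_box" "?P w \<in> model_box" "?P v \<in> seg_set (vertex_seg v)" "?P w \<in> seg_set (vertex_seg w)"
    using lerp_in_box[OF gb(1) gb(1), of 0] lerp_in_box[OF gb(2) gb(2), of 0] unfolding l by (force simp: vertex_seg_def)+
  have eq': "model (fst (vertex_seg v)) (?P v) = model (fst (vertex_seg w)) (?P w)"
    using eq by (simp add: grid_model_def vertex_seg_def v_w_def)
  have "fst (snd w) = fst (snd v)" using model_collision(1)[OF V(1,2) eq'] by simp
  moreover have "distinct_vertices v w"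
    using vertices_distinct ij len by (auto simp: sorted_wrt_iff_nth_less v_w_def)
  ultimately have "\<bar>fst (snd v)\<bar> < 24" "free (vertex_seg v) (vertex_seg w)" by (auto simp: distinct_vertices_def)
  then show False using model_free[OF _ V(3,4,1,2) _ eq'] by force
qed

text \<open>The crossings are at (8, 4) in the hexagon with y, z >= 0 and at (-8, 2) in the one with
  y, z <= 0. Each half of an edge takes half of the parameter interval, which gives the
  parameters.\<close>

definition first_crossing where "first_crossing = {((0::nat, 1::nat), 2/3::real), ((3, 2), 1/3)}"
definition second_crossing where "second_crossing = {((1::nat, 2::nat), 1/6::real), ((4, 0), 1/2)}"

lemma ordered_crossing:
  assumes e: "e \<in> K55_edges" "f \<in> K55_edges" and nc: "no_crossing (e, edge_data e) (f, edge_data f)"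
    and t: "0 < t" "t < 1" "0 < u" "u < 1" and eq: "edge_path e t = edge_path f u"
  shows "{(e, t), (f, u)} \<in> {first_crossing, second_crossing}"
proof -
  obtain H a b K c where d: "edge_data e = (H, a, b, K, c)" by (metis surj_pair)
  obtain H' a' b' K' c' where d': "edge_data f = (H', a', b', K', c')" by (metis surj_pair)
  obtain S P where S: "S = seg1 (edge_data e) \<and> t \<le> 1/2 \<and> P = lerp a b (2 * t) \<or> S = seg2 (edge_data e) \<and> 1/2 < t \<and> P = lerp b c (2 * t - 1)"
    "P \<in> seg_set S" "P \<in> model_box" "\<bar>fst P\<bar> < 24" "edge_path e t = model (fst S) P"
    using edge_path_interior[OF e(1) d t(1,2)] .
  obtain S' P' where S': "S' = seg1 (edge_data f) \<and> u \<le> 1/2 \<and> P' = lerp a' b' (2 * u) \<or> S' = seg2 (edge_data f) \<and> 1/2 < u \<and> P' = lerp b' c' (2 * u - 1)"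
    "P' \<in> seg_set S'" "P' \<in> model_box" "\<bar>fst P'\<bar> < 24" "edge_path f u = model (fst S') P'"
    using edge_path_interior[OF e(2) d' t(3,4)] .
  have eq': "model (fst S) P = model (fst S') P'" using eq S(5) S'(5) by simp
  have nf: "\<not> free S S'" using model_free[OF _ S(2) S'(2) S(3) S'(3) S(4) eq'] by blast
  have PP: "P' = P"
    using model_collision(1,2)[of "fst P" "snd P" "fst P'" "snd P'"] S(3,4) S'(3) eq' by (simp add: prod_eq_iff)
  consider "e = (1, 2)" "f = (4, 0)" "S = seg1 (edge_data e)" "S' = seg1 (edge_data f)"
    | "e = (0, 1)" "f = (3, 2)" "S = seg2 (edge_data e)" "S' = seg1 (edge_data f)"
    using nc nf S(1) S'(1) unfolding no_crossing_def by auto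
  then show ?thesis
  proof cases
    case 1
    have "edge_data e = ((True, True), (-8, 0), (-8, 6), (True, True), (24, 6))"
      "edge_data f = ((True, True), (0, 4), (-8, 2), (True, True), (-16, 0))"
      unfolding 1(1,2) edge_data_def edge_list_def by simp_all
    note dd = this
    have "P = lerp (-8, 0) (-8, 6) (2 * t)" "P' = lerp (0, 4) (-8, 2) (2 * u)"
      using S(1) S'(1) d d' dd 1(3,4) by auto
    then have tu: "t = 1/6" "u = 1/2" using PP by (auto simp: lerp_def)
    have "{(e, t), (f, u)} = second_crossing" unfolding second_crossing_def 1(1,2) tu ..
    then show ?thesis by blast
  next
    case 2
    have "edge_data e = ((False, False), (-24, 6), (8, 6), (False, False), (8, 0))"
      "edge_data f = ((False, False), (0, 4), (12, 4), (False, False), (24, 4))"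
      unfolding 2(1,2) edge_data_def edge_list_def by simp_all
    note dd = this
    have "P = lerp (8, 6) (8, 0) (2 * t - 1)" "P' = lerp (0, 4) (12, 4) (2 * u)"
      using S(1) S'(1) d d' dd 2(3,4) by auto
    then have tu: "t = 2/3" "u = 1/3" using PP by (auto simp: lerp_def)
    have "{(e, t), (f, u)} = first_crossing" unfolding first_crossing_def 2(1,2) tu ..
    then show ?thesis by blast
  qed
qed

lemma crossings_edge_path: "crossings edge_path \<subseteq> {first_crossing, second_crossing}"
proof
  fix x assume "x \<in> crossings edge_path"
  then obtain e s f t where x: "x = {(e, s), (f, t)}" and ef: "e \<in> K55_edges" "f \<in> K55_edges"
    and st: "0 < s" "s < 1" "0 < t" "t < 1" and ne: "(e, s) \<noteq> (f, t)" and eq: "edge_path e s = edge_path f t"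
    unfolding crossings_def greaterThanLessThan_iff by blast
  have "e \<noteq> f"
  proof
    assume "e = f"
    obtain H a b K c where d: "edge_data e = (H, a, b, K, c)" by (metis surj_pair)
    have "s = t" using inj_onD[OF edge_path_inj[OF ef(1) d], of s t] eq st \<open>e = f\<close> by auto
    then show False using ne \<open>e = f\<close> by simp
  qed
  have "(e, edge_data e) \<in> set edge_list" "(f, edge_data f) \<in> set edge_list"
    using edge_data_mem ef by blast+
  then obtain k l where kl: "k < length edge_list" "l < length edge_list" "edge_list ! k = (e, edge_data e)" "edge_list ! l = (f, edge_data f)"
    by (metis in_set_conv_nth)
  then have "k \<noteq> l" using \<open>e \<noteq> f\<close> by auto
  then have "no_crossing (e, edge_data e) (f, edge_data f) \<or> no_crossing (f, edge_data f) (e, edge_data e)"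
    using edges_no_crossing kl unfolding sorted_wrt_iff_nth_less by (metis linorder_neqE_nat)
  then show "x \<in> {first_crossing, second_crossing}"
  proof
    assume "no_crossing (e, edge_data e) (f, edge_data f)"
    from ordered_crossing[OF ef this st eq] show ?thesis by (simp add: x)
  next
    assume "no_crossing (f, edge_data f) (e, edge_data e)"
    from ordered_crossing[OF ef(2,1) this st(3,4,1,2) eq[symmetric]] show ?thesis by (simp add: x insert_commute)
  qed
qed

lemma drawing_edge_path:
  "drawing_K55 S2 (\<lambda>i. grid_model (vertex_list ! i)) (\<lambda>j. grid_model (vertex_list ! (5 + j))) edge_path"
proof -
  let ?v = "\<lambda>i. grid_model (vertex_list ! i)"
  have len: "length vertex_list = 10" by (simp add: vertex_list_def)
  have inj: "i = j" if "?v i = ?v j" "i < 10" "j < 10" for i j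
    using vertex_model_inj[of i j] vertex_model_inj[of j i] that by (cases i j rule: linorder_cases) auto
  have S: "?v i \<in> S2" if "i < 10" for i
  proof -
    have g: "grid_box (snd (vertex_list ! i))" using vertices_in_box that len by (simp add: list_all_length)
    show ?thesis unfolding grid_model_def
      by (rule model_in_S2) (use lerp_in_box[OF g g, of 0] in \<open>simp add: lerp_def\<close>)
  qed
  have edge: "continuous_on {0..1} (edge_path e) \<and> edge_path e ` {0..1} \<subseteq> S2 \<and>
        edge_path e 0 = ?v (fst e) \<and> edge_path e 1 = ?v (5 + snd e) \<and>
        (\<forall>t \<in> {0..1}. \<exists>\<epsilon>>0. inj_on (edge_path e) ({0..1} \<inter> ball t \<epsilon>)) \<and>
        (\<forall>t \<in> {0<..<1}. edge_path e t \<notin> ?v ` {..<5} \<union> (\<lambda>j. ?v (5 + j)) ` {..<5})" if e: "e \<in> K55_edges" for e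
  proof -
    obtain H a b K c where d: "edge_data e = (H, a, b, K, c)" by (metis surj_pair)
    have "edge_path e t \<notin> ?v ` {..<5} \<union> (\<lambda>j. ?v (5 + j)) ` {..<5}" if t: "t \<in> {0<..<1}" for t
    proof
      assume "edge_path e t \<in> ?v ` {..<5} \<union> (\<lambda>j. ?v (5 + j)) ` {..<5}"
      then consider i where "i < 5" "edge_path e t = ?v i" | j where "j < 5" "edge_path e t = ?v (5 + j)" by blast
      then obtain k where "k < 10" "edge_path e t = ?v k"
      proof cases
        case 1 then show ?thesis using that[of i] by simp
      next
        case 2 then show ?thesis using that[of "5 + j"] by simp
      qed
      then show False using edge_path_avoids_vertex[OF e d, of t "vertex_list ! k"] t len by auto
    qed
    \<comment> \<open>The paths are injective on the whole interval, so any radius serves.\<close>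
    moreover have "\<exists>\<epsilon>>0. inj_on (edge_path e) ({0..1} \<inter> ball t \<epsilon>)" for t
      using inj_on_subset[OF edge_path_inj[OF e d], of "{0..1} \<inter> ball t 1"] by (intro exI[of _ 1]) auto
    ultimately show ?thesis
      using continuous_edge_path[OF e d] edge_path_in_S2[OF e d] edge_path_ends[OF e d] by blast
  qed
  show ?thesis unfolding drawing_K55_def
  proof (intro conjI ballI)
    show "?v ` {..<5} \<subseteq> S2" "(\<lambda>j. ?v (5 + j)) ` {..<5} \<subseteq> S2" using S by auto
    show "inj_on ?v {..<5}" "inj_on (\<lambda>j. ?v (5 + j)) {..<5}"
      using inj by (auto intro!: inj_onI) (metis add_left_cancel nat_add_left_cancel_less numeral_Bit0)
    show "?v ` {..<5} \<inter> (\<lambda>j. ?v (5 + j)) ` {..<5} = {}"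
    proof (rule ccontr)
      assume "\<not> ?thesis"
      then obtain i j where ij: "i < 5" "j < 5" "?v i = ?v (5 + j)" by blast
      have "i = 5 + j" by (rule inj[OF ij(3)]) (use ij in auto)
      then show False using ij by simp
    qed
    show "finite (crossings edge_path)" using crossings_edge_path finite_subset by blast
  qed (use edge in blast)+
qed

theorem mainTheorem10:
  shows "cr_K55 S2 = 2"
proof -
  let ?Q = "\<lambda>n. \<exists>p q \<gamma>. drawing_K55 S2 p q \<gamma> \<and> card (crossings \<gamma>) = n"
  have "card (crossings edge_path) \<le> card {first_crossing, second_crossing}"
    by (rule card_mono[OF _ crossings_edge_path]) simp
  also have "\<dots> \<le> 2" by (simp add: card_insert_if)
  \<comment> \<open>The lower bound applied to this drawing shows that both listed crossings
    occur.\<close>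
  finally have "card (crossings edge_path) = 2"
    using crossing_number_lower_bound[OF drawing_edge_path] by linarith
  then have "?Q 2" using drawing_edge_path by blast
  then show ?thesis unfolding cr_K55_def
    by (rule Least_equality) (use crossing_number_lower_bound in blast)
qed

end
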